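(* Let $p$ be a prime, $a\in\{1,2,3,\dots\}\cup\{\infty\}$, $q=p^a$, and let $n\ge 1$ be an integer with $\gcd(n,p)=1$. Let $\mathcal R=\mathbb Z_q[X]/(X^n-1)$, and let $\pi_a^{(1)},\dots,\pi_a^{(A)}$ be the distinct monic irreducible divisors of $X^n-1$ over $\mathbb Z_q$. Then every ideal $\mathcal A$ of $\mathcal R$ can be written in a unique way as $$\mathcal A=\prod_{i=1}^{A}\bigl(\pi_a^{(i)},p\bigr)^{m_i},\qquad 0\le m_i\le a .$$ In particular, if $a$ is finite, $\mathcal R$ has exactly $(a+1)^A$ distinct ideals.
   Context: $\mathbb Z_{p^a}$ denotes $\mathbb Z/p^a\mathbb Z$ for finite $a$, and $\mathbb Z_{p^\infty}$ denotes the ring of $p$-adic integers. For $f_1,\dots,f_k\in\mathbb Z_q[X]$, $(f_1,\dots,f_k)$ denotes the ideal of $\mathcal R$ generated by their images; products of ideals are ideal products, and $(\pi,p)^0=(1)=\mathcal R$. When $a=\infty$, $m_i$ ranges over $\{0,1,2,\dots\}\cup\{\infty\}$, with the convention $(\pi_\infty,p)^\infty:=(\pi_\infty)$. *)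

theory Defs
  imports
    "HOL-Algebra.UnivPoly"
    "HOL-Algebra.Divisibility"
    "HOL-Algebra.QuotRing"
    "HOL-Algebra.Ideal_Product"
    "HOL-Number_Theory.Residues"
    "HOL-Library.Extended_Nat"
    "HOL-Library.FuncSet"
begin

text \<open>The ring of \<open>p\<close>-adic integers as the inverse limit of the rings of residues modulo
  \<open>p ^ k\<close>: a \<open>p\<close>-adic integer is the coherent sequence of its least nonnegative residues.\<close>

definition padic_ints :: "nat \<Rightarrow> (nat \<Rightarrow> int) ring" where
  "padic_ints p =
    \<lparr>carrier = {x. \<forall>k. x k \<in> {0..<int p ^ k} \<and> x (Suc k) mod int p ^ k = x k},
     monoid.mult = (\<lambda>x y k. (x k * y k) mod int p ^ k),
     one = (\<lambda>k. 1 mod int p ^ k),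
     zero = (\<lambda>k. 0),
     add = (\<lambda>x y k. (x k + y k) mod int p ^ k)\<rparr>"

text \<open>\<open>is_Zq p a Z\<close>: the commutative ring \<open>Z\<close> is (a copy of) the integers modulo \<open>p ^ a\<close> if
  \<open>a\<close> is finite, and of the \<open>p\<close>-adic integers if \<open>a = \<infinity>\<close>. It is stated up to isomorphism because
  the two standard models have different element types; both are instances, see below.\<close>

definition is_Zq :: "nat \<Rightarrow> enat \<Rightarrow> ('r, 'm) ring_scheme \<Rightarrow> bool" where
  "is_Zq p a Z \<longleftrightarrow> cring Z \<and>
    (case a of enat k \<Rightarrow> Z \<simeq> residue_ring (int p ^ k) | \<infinity> \<Rightarrow> Z \<simeq> padic_ints p)"

lemma is_Zq_residue_ring:
  assumes "prime p" "k \<ge> 1"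
  shows "is_Zq p (enat k) (residue_ring (int p ^ k))"
proof -
  have "int p ^ k > 1"
    using assms prime_gt_1_nat[of p] by (intro one_less_power) auto
  then interpret residues "int p ^ k" "residue_ring (int p ^ k)"
    by unfold_locales auto
  show ?thesis
    using cring ring_iso_set_refl by (auto simp: is_Zq_def is_ring_iso_def)
qed

lemma cring_padic_ints:
  assumes "prime p"
  shows "cring (padic_ints p)"
proof -
  have pos: "int p ^ k > 0" for k
    using assms prime_gt_0_nat[of p] by simp
  have dv: "int p ^ k dvd int p ^ Suc k" for k
    by simp
  have modmod: "x mod int p ^ Suc k mod int p ^ k = x mod int p ^ k" for x k
    using dv by (rule mod_mod_cancel)
  have sq: "x k mod int p ^ k = x k" if "x \<in> carrier (padic_ints p)" for x k
    using that by (auto simp: padic_ints_def)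
  have st: "x (Suc k) mod int p ^ k = x k" if "x \<in> carrier (padic_ints p)" for x k
    using that by (auto simp: padic_ints_def)
  have memI: "x \<in> carrier (padic_ints p)"
    if "\<And>k. \<exists>z. x k = z mod int p ^ k" "\<And>k. x (Suc k) mod int p ^ k = x k" for x
  proof -
    have "x k \<in> {0..<int p ^ k}" for k
      using that(1)[of k] pos[of k] by auto
    then show ?thesis
      using that(2) by (simp add: padic_ints_def)
  qed
  have addc: "x \<oplus>\<^bsub>padic_ints p\<^esub> y \<in> carrier (padic_ints p)"
    if "x \<in> carrier (padic_ints p)" "y \<in> carrier (padic_ints p)" for x y
  proof (rule memI)
    show "\<exists>z. (x \<oplus>\<^bsub>padic_ints p\<^esub> y) k = z mod int p ^ k" for k
      by (auto simp: padic_ints_def)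
    show "(x \<oplus>\<^bsub>padic_ints p\<^esub> y) (Suc k) mod int p ^ k = (x \<oplus>\<^bsub>padic_ints p\<^esub> y) k" for k
      using mod_add_eq[of "x (Suc k)" "int p ^ k" "y (Suc k)"] st[OF that(1)] st[OF that(2)]
      by (simp add: padic_ints_def modmod del: power_Suc)
  qed
  have mulc: "x \<otimes>\<^bsub>padic_ints p\<^esub> y \<in> carrier (padic_ints p)"
    if "x \<in> carrier (padic_ints p)" "y \<in> carrier (padic_ints p)" for x y
  proof (rule memI)
    show "\<exists>z. (x \<otimes>\<^bsub>padic_ints p\<^esub> y) k = z mod int p ^ k" for k
      by (auto simp: padic_ints_def)
    show "(x \<otimes>\<^bsub>padic_ints p\<^esub> y) (Suc k) mod int p ^ k = (x \<otimes>\<^bsub>padic_ints p\<^esub> y) k" for k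
      using mod_mult_eq[of "x (Suc k)" "int p ^ k" "y (Suc k)"] st[OF that(1)] st[OF that(2)]
      by (simp add: padic_ints_def modmod del: power_Suc)
  qed
  have onec: "\<one>\<^bsub>padic_ints p\<^esub> \<in> carrier (padic_ints p)"
    by (rule memI) (auto simp: padic_ints_def modmod simp del: power_Suc)
  have zeroc: "\<zero>\<^bsub>padic_ints p\<^esub> \<in> carrier (padic_ints p)"
    using pos by (auto simp: padic_ints_def)
  have invc: "\<exists>y\<in>carrier (padic_ints p). y \<oplus>\<^bsub>padic_ints p\<^esub> x = \<zero>\<^bsub>padic_ints p\<^esub>"
    if "x \<in> carrier (padic_ints p)" for x
  proof (rule bexI)
    show "(\<lambda>k. (- x k) mod int p ^ k) \<oplus>\<^bsub>padic_ints p\<^esub> x = \<zero>\<^bsub>padic_ints p\<^esub>"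
      by (simp add: padic_ints_def mod_add_left_eq)
    show "(\<lambda>k. (- x k) mod int p ^ k) \<in> carrier (padic_ints p)"
    proof (rule memI)
      show "(- x (Suc k)) mod int p ^ Suc k mod int p ^ k = (- x k) mod int p ^ k" for k
        using mod_minus_eq[of "x (Suc k)" "int p ^ k"] st[OF that]
        by (simp add: modmod del: power_Suc)
    qed auto
  qed
  have "abelian_group (padic_ints p)"
    by (rule abelian_groupI)
      (use addc zeroc invc sq in \<open>auto simp: padic_ints_def mod_simps ac_simps fun_eq_iff\<close>)
  moreover have "comm_monoid (padic_ints p)"
    by (rule comm_monoidI)
      (use mulc onec sq in \<open>auto simp: padic_ints_def mod_simps ac_simps fun_eq_iff\<close>)
  ultimately show ?thesis
    by (rule cringI) (auto simp: padic_ints_def mod_simps algebra_simps fun_eq_iff)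
qed

lemma is_Zq_padic_ints: "prime p \<Longrightarrow> is_Zq p \<infinity> (padic_ints p)"
  using cring_padic_ints ring_iso_set_refl by (auto simp: is_Zq_def is_ring_iso_def)

definition xn_minus_one :: "('r, 'm) ring_scheme \<Rightarrow> nat \<Rightarrow> nat \<Rightarrow> 'r" where
  "xn_minus_one Z n = monom (UP Z) \<one>\<^bsub>Z\<^esub> n \<ominus>\<^bsub>UP Z\<^esub> \<one>\<^bsub>UP Z\<^esub>"

definition cyc_ring :: "('r, 'm) ring_scheme \<Rightarrow> nat \<Rightarrow> (nat \<Rightarrow> 'r) set ring" where
  "cyc_ring Z n = UP Z Quot (PIdl\<^bsub>UP Z\<^esub> (xn_minus_one Z n))"

text \<open>\<open>irreducible\<close> is the divisibility-theoretic notion: a nonunit all of whose proper divisors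
  are units. It also makes sense over the non-domain of integers modulo \<open>p ^ a\<close>; for a monic
  (hence regular) \<open>f\<close> it says that \<open>f = g \<otimes> h\<close> implies that \<open>g\<close> or \<open>h\<close> is a unit.\<close>

definition monic_irred_divisors :: "('r, 'm) ring_scheme \<Rightarrow> nat \<Rightarrow> (nat \<Rightarrow> 'r) set" where
  "monic_irred_divisors Z n =
    {f \<in> carrier (UP Z). coeff (UP Z) f (deg Z f) = \<one>\<^bsub>Z\<^esub> \<and>
       Divisibility.irreducible (UP Z) f \<and> f divides\<^bsub>UP Z\<^esub> xn_minus_one Z n}"

definition image_ideal :: "('r, 'm) ring_scheme \<Rightarrow> nat \<Rightarrow> (nat \<Rightarrow> 'r) set \<Rightarrow> (nat \<Rightarrow> 'r) set set" where
  "image_ideal Z n F =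
    Idl\<^bsub>cyc_ring Z n\<^esub> ((\<lambda>f. PIdl\<^bsub>UP Z\<^esub> (xn_minus_one Z n) +>\<^bsub>UP Z\<^esub> f) ` F)"

text \<open>The power \<open>(\<pi>, p) ^ m\<close> in the monoid of ideals under the ideal product, with the convention
  \<open>(\<pi>, p) ^ \<infinity> = (\<pi>)\<close>. The integer \<open>p\<close> is viewed as the constant polynomial \<open>p \<cdot> 1\<close>.\<close>

definition pi_p_power ::
    "('r, 'm) ring_scheme \<Rightarrow> nat \<Rightarrow> nat \<Rightarrow> (nat \<Rightarrow> 'r) \<Rightarrow> enat \<Rightarrow> (nat \<Rightarrow> 'r) set set" where
  "pi_p_power Z n p \<pi> m =
    (case m of
       enat k \<Rightarrow> image_ideal Z n {\<pi>, [p] \<cdot>\<^bsub>UP Z\<^esub> \<one>\<^bsub>UP Z\<^esub>} [^]\<^bsub>ideals_set (cyc_ring Z n)\<^esub> k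
     | \<infinity> \<Rightarrow> image_ideal Z n {\<pi>})"

end

theory Submission
  imports Defs
begin

text \<open>Let \<open>F = X ^ n - 1\<close>. Since \<open>X F' - n F = n\<close> is a unit modulo \<open>p\<close>, \<open>F\<close> is squarefree modulo \<open>p\<close>, so by
  Hensel's lemma every residual irreducible factor of \<open>F\<close> lifts to a monic divisor \<open>\<pi>\<close> of \<open>F\<close> over
  \<open>\<int>\<^sub>q\<close>; the monic irreducible divisors are exactly these lifts, that is, the monic \<open>\<pi>\<close> dividing \<open>F\<close>
  for which \<open>(\<pi>, p)\<close> is a maximal ideal. They are pairwise comaximal with intersection \<open>(F)\<close>, and modulo each of
  them every nonzero element is a unit times some \<open>p ^ k\<close> with \<open>k < a\<close>. Hence, by the Chinese remainder
  theorem, an ideal of the quotient by \<open>F\<close> is determined by its images modulo the \<open>\<pi>\<close>, and each image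
  is generated by a unique power \<open>p ^ m\<close> with \<open>m \<le> a\<close> (where \<open>p ^ \<infinity> = 0\<close>).

  Hensel's lemma and Nakayama's lemma are proved with ideals of the polynomial ring containing \<open>p\<close>
  in place of polynomials over the residue field, so that reduction modulo \<open>p\<close> never leaves the ring.\<close>

section \<open>Ideals of a commutative ring with given local components\<close>

text \<open>The polynomial ring over \<open>Z\<close> is in general neither a domain nor factorial,
  and \<open>p\<close> need not lie in its Jacobson radical: over the p-adic integers
  \<open>1 - p X\<close> is not a unit. So an ideal that becomes the unit ideal modulo
  \<open>p\<close> need not be the unit ideal. It is one if it contains a monic polynomial: modulo a
  monic polynomial of degree \<open>d\<close> only the polynomials of degree less than
  \<open>d\<close> matter, and these are complete and separated for the powers of \<open>p\<close>.
  Hence comaximality is first obtained modulo \<open>p\<close> and then freed of \<open>p\<close>,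
  always with some monic divisor of \<open>F\<close> in the ideal at hand. Monicity also replaces
  the missing cancellation, since division by a monic polynomial is unique. Completeness and
  separatedness hold for finite \<open>a\<close> because high powers of \<open>p\<close> vanish, so
  both kinds of coefficient ring are treated at once; \<open>a\<close> enters only as the least
  exponent with \<open>p ^ a = 0\<close>, if there is one.\<close>

context cring begin

lemma ideal_add: "ideal I R \<Longrightarrow> x \<in> I \<Longrightarrow> y \<in> I \<Longrightarrow> x \<oplus> y \<in> I"
  by (meson additive_subgroup.a_closed ideal.axioms(1))

lemma ideal_minus: "ideal I R \<Longrightarrow> x \<in> I \<Longrightarrow> y \<in> I \<Longrightarrow> x \<ominus> y \<in> I"
  by (metis a_minus_def additive_subgroup.a_closed additive_subgroup.a_inv_closed ideal.axioms(1))

lemma ideal_zero: "ideal I R \<Longrightarrow> \<zero> \<in> I"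
  by (simp add: additive_subgroup.zero_closed ideal.axioms(1))

lemma ideal_cancel:
  assumes "ideal I R" "x \<ominus> y \<in> I" "x \<in> carrier R" "y \<in> carrier R" shows "x \<in> I \<longleftrightarrow> y \<in> I"
proof -
  have "x = (x \<ominus> y) \<oplus> y" "y = x \<ominus> (x \<ominus> y)"
    using assms(3,4) by algebra+
  then show ?thesis
    using assms ideal_add ideal_minus by metis
qed

lemma cring_idealI:
  assumes "I \<subseteq> carrier R" "\<zero> \<in> I" "\<And>x y. x \<in> I \<Longrightarrow> y \<in> I \<Longrightarrow> x \<oplus> y \<in> I"
    "\<And>r x. r \<in> carrier R \<Longrightarrow> x \<in> I \<Longrightarrow> r \<otimes> x \<in> I"
  shows "ideal I R"
proof (rule idealI[OF ring_axioms])
  have "\<ominus> x \<in> I" if "x \<in> I" for x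
  proof -
    have "x \<in> carrier R" using that assms(1) by auto
    then have "\<ominus> x = \<ominus> \<one> \<otimes> x" by algebra
    then show ?thesis using assms(4) that by simp
  qed
  then show "subgroup I (add_monoid R)"
    by (intro subgroup.intro) (use assms in \<open>auto simp: a_inv_def\<close>)
  show "a \<otimes> x \<in> I" if "a \<in> I" "x \<in> carrier R" for a x
    using assms(1,4) that m_comm[of a x] by auto
qed (use assms in auto)

section \<open>Principal and two-generated ideals\<close>

lemma Idl1_iff: "x \<in> carrier R \<Longrightarrow> z \<in> Idl {x} \<longleftrightarrow> (\<exists>r\<in>carrier R. z = r \<otimes> x)"
  by (auto simp: cgenideal_eq_genideal[symmetric] cgenideal_def)

lemma Idl2_iff:
  assumes "x \<in> carrier R" "y \<in> carrier R"
  shows "z \<in> Idl {x, y} \<longleftrightarrow> (\<exists>r\<in>carrier R. \<exists>s\<in>carrier R. z = r \<otimes> x \<oplus> s \<otimes> y)"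
proof
  let ?L = "{z. \<exists>r\<in>carrier R. \<exists>s\<in>carrier R. z = r \<otimes> x \<oplus> s \<otimes> y}"
  have "ideal ?L R"
  proof (rule cring_idealI)
    show "\<zero> \<in> ?L"
      using assms by (auto intro!: bexI[of _ \<zero>])
  next
    fix z w assume "z \<in> ?L" "w \<in> ?L"
    then obtain r s r' s' where c: "r \<in> carrier R" "s \<in> carrier R" "r' \<in> carrier R" "s' \<in> carrier R"
      and eq: "z = r \<otimes> x \<oplus> s \<otimes> y" "w = r' \<otimes> x \<oplus> s' \<otimes> y" by auto
    have "z \<oplus> w = (r \<oplus> r') \<otimes> x \<oplus> (s \<oplus> s') \<otimes> y"
      unfolding eq using c assms by algebra
    then show "z \<oplus> w \<in> ?L" using c by blast
  next
    fix t z assume t: "t \<in> carrier R" and "z \<in> ?L"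
    then obtain r s where c: "r \<in> carrier R" "s \<in> carrier R" and eq: "z = r \<otimes> x \<oplus> s \<otimes> y" by auto
    have "t \<otimes> z = (t \<otimes> r) \<otimes> x \<oplus> (t \<otimes> s) \<otimes> y"
      unfolding eq using c t assms by algebra
    then show "t \<otimes> z \<in> ?L" using c t by blast
  qed (use assms in auto)
  moreover have "x = \<one> \<otimes> x \<oplus> \<zero> \<otimes> y" "y = \<zero> \<otimes> x \<oplus> \<one> \<otimes> y"
    using assms by simp_all
  then have "{x, y} \<subseteq> ?L" by blast
  ultimately have "Idl {x, y} \<subseteq> ?L" by (rule genideal_minimal)
  then show "z \<in> Idl {x, y} \<Longrightarrow> \<exists>r\<in>carrier R. \<exists>s\<in>carrier R. z = r \<otimes> x \<oplus> s \<otimes> y" by blast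
next
  assume "\<exists>r\<in>carrier R. \<exists>s\<in>carrier R. z = r \<otimes> x \<oplus> s \<otimes> y"
  moreover have "ideal (Idl {x, y}) R" "x \<in> Idl {x, y}" "y \<in> Idl {x, y}"
    using assms genideal_ideal[of "{x, y}"] genideal_self[of "{x, y}"] by auto
  ultimately show "z \<in> Idl {x, y}"
    by (auto intro!: ideal_add ideal.I_l_closed)
qed

lemma Idl_pair:
  assumes "x \<in> carrier R" "y \<in> carrier R"
  shows "ideal (Idl {x, y}) R" "x \<in> Idl {x, y}" "y \<in> Idl {x, y}"
  using assms genideal_ideal[of "{x, y}"] genideal_self[of "{x, y}"] by auto

lemma Idl_single:
  assumes "x \<in> carrier R"
  shows "ideal (Idl {x}) R" "x \<in> Idl {x}"
  using assms genideal_ideal[of "{x}"] genideal_self[of "{x}"] by auto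

lemma Idl_pair_le:
  assumes "ideal I R" "x \<in> I" "y \<in> I"
  shows "Idl {x, y} \<subseteq> I"
  using assms by (intro genideal_minimal) auto

lemma Idl_single_le:
  assumes "ideal I R" "x \<in> I"
  shows "Idl {x} \<subseteq> I"
  using assms by (intro genideal_minimal) auto

lemma power_Idl_antimono:
  assumes "q \<in> carrier R" "l \<le> (k::nat)"
  shows "Idl {q [^] k} \<subseteq> Idl {q [^] l}"
proof (rule Idl_single_le)
  have "q [^] k = q [^] (k - l) \<otimes> q [^] l" using assms by (simp add: nat_pow_mult)
  then show "q [^] k \<in> Idl {q [^] l}" using assms by (auto simp: Idl1_iff)
qed (use assms Idl_single in simp)

lemma sum_Idl1_iff:
  assumes "x \<in> carrier R"
  shows "z \<in> I <+>\<^bsub>R\<^esub> Idl {x} \<longleftrightarrow> (\<exists>u\<in>I. \<exists>r\<in>carrier R. z = u \<oplus> r \<otimes> x)"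
  by (simp add: set_add_def' Bex_def Idl1_iff[OF assms]) (metis (no_types))

lemma ideal_prod_least:
  assumes "ideal K R" "\<And>i j. i \<in> I \<Longrightarrow> j \<in> J \<Longrightarrow> i \<otimes> j \<in> K"
  shows "I \<cdot> J \<subseteq> K"
proof
  fix s assume "s \<in> I \<cdot> J"
  then show "s \<in> K"
    by induct (use assms ideal_add in auto)
qed

end

text \<open>The conditions say that \<open>R\<close> is the product of the rings \<open>R / (g i)\<close>, with idempotents \<open>e i\<close>, and that in
  each factor the nonzero ideals are the distinct ideals \<open>(p ^ k)\<close>, \<open>k < a\<close>.\<close>

locale local_components = cring R for R (structure) +
  fixes D :: "'i set" and g e :: "'i \<Rightarrow> 'a" and p :: 'a and a :: enat
  assumes finD: "finite D"
    and gC: "i \<in> D \<Longrightarrow> g i \<in> carrier R"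
    and eC: "i \<in> D \<Longrightarrow> e i \<in> carrier R"
    and pC: "p \<in> carrier R"
    and e_g: "i \<in> D \<Longrightarrow> e i \<otimes> g i = \<zero>"
    and e_one: "i \<in> D \<Longrightarrow> \<one> \<ominus> e i \<in> Idl {g i}"
    and e_other: "i \<in> D \<Longrightarrow> j \<in> D \<Longrightarrow> i \<noteq> j \<Longrightarrow> e i \<in> Idl {g j}"
    and separating: "x \<in> carrier R \<Longrightarrow> (\<And>i. i \<in> D \<Longrightarrow> x \<in> Idl {g i}) \<Longrightarrow> x = \<zero>"
    and assoc_power: "i \<in> D \<Longrightarrow> x \<in> carrier R \<Longrightarrow> x \<notin> Idl {g i} \<Longrightarrow>
      \<exists>k. enat k < a \<and> p [^] k \<in> Idl {x, g i} \<and> x \<in> Idl {g i, p [^] k}"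
    and power_in: "i \<in> D \<Longrightarrow> p [^] k \<in> Idl {g i} \<Longrightarrow> a \<le> enat k"
    and power_zero: "a = enat k \<Longrightarrow> p [^] k = \<zero>"
    and proper: "i \<in> D \<Longrightarrow> \<one> \<notin> Idl {g i, p}"
begin

text \<open>Multiplication by \<open>e i\<close> kills \<open>g i\<close>, so the local hypothesis
  puts every \<open>e i \<otimes> x\<close> into \<open>I\<close>. The \<open>e i\<close> are then
  combined into a \<open>t\<close> with \<open>\<one> \<ominus> t\<close> in every
  \<open>(g i)\<close>, and such a \<open>t\<close> is \<open>\<one>\<close> by
  \<open>separating\<close>.\<close>

lemma mem_of_local:
  assumes I: "ideal I R" and x: "x \<in> carrier R" and loc: "\<And>i. i \<in> D \<Longrightarrow> x \<in> I <+>\<^bsub>R\<^esub> Idl {g i}"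
  shows "x \<in> I"
proof -
  have ex: "e i \<otimes> x \<in> I" if i: "i \<in> D" for i
  proof -
    obtain u r where u: "u \<in> I" "r \<in> carrier R" "x = u \<oplus> r \<otimes> g i"
      using loc[OF i] gC[OF i] by (auto simp: sum_Idl1_iff)
    have uc: "u \<in> carrier R" using u I ideal.Icarr by metis
    have "e i \<otimes> x = e i \<otimes> u \<oplus> r \<otimes> (e i \<otimes> g i)"
      unfolding u(3) using uc u(2) gC[OF i] eC[OF i] by algebra
    also have "\<dots> = e i \<otimes> u" using uc u(2) e_g[OF i] eC[OF i] by simp
    finally show ?thesis using I u(1) eC[OF i] by (simp add: ideal.I_l_closed)
  qed
  have "S \<subseteq> D \<Longrightarrow> \<exists>t\<in>carrier R. t \<otimes> x \<in> I \<and> (\<forall>i\<in>S. \<one> \<ominus> t \<in> Idl {g i})" if "finite S" for S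
    using that
  proof (induct S rule: finite_induct)
    case empty
    show ?case using I x ideal_zero by (auto intro!: bexI[of _ \<zero>])
  next
    case (insert i S)
    then obtain t where t: "t \<in> carrier R" "t \<otimes> x \<in> I" "\<And>j. j \<in> S \<Longrightarrow> \<one> \<ominus> t \<in> Idl {g j}" by auto
    have i: "i \<in> D" using insert by auto
    \<comment> \<open>Chosen so that \<open>\<one> \<ominus> ?s\<close> is the product of
      \<open>\<one> \<ominus> t\<close> and \<open>\<one> \<ominus> e i\<close>: it keeps the
      memberships collected for \<open>S\<close> and gains the one for \<open>i\<close>.\<close>
    let ?s = "t \<oplus> (\<one> \<ominus> t) \<otimes> e i"
    have c: "t \<in> carrier R" "e i \<in> carrier R" "x \<in> carrier R" using t i eC x by auto
    have "?s \<otimes> x = t \<otimes> x \<oplus> (\<one> \<ominus> t) \<otimes> (e i \<otimes> x)"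
      using c by algebra
    then have "?s \<otimes> x \<in> I" using I t ex[OF i] c by (simp add: ideal_add ideal.I_l_closed)
    moreover have s1: "\<one> \<ominus> ?s = (\<one> \<ominus> t) \<otimes> (\<one> \<ominus> e i)" using c by algebra
    have "\<one> \<ominus> ?s \<in> Idl {g j}" if j: "j \<in> insert i S" for j
    proof (cases "j = i")
      case True
      then show ?thesis unfolding s1 using e_one[OF i] Idl_single[OF gC[OF i]] c
        by (auto intro!: ideal.I_l_closed)
    next
      case False
      then have "j \<in> S" "j \<in> D" using j insert by auto
      then show ?thesis unfolding s1 using t(3) Idl_single[OF gC[of j]] c
        by (auto intro!: ideal.I_r_closed)
    qed
    ultimately show ?case using c by (intro bexI[of _ ?s]) auto
  qed
  from this[OF finD] obtain t where t: "t \<in> carrier R" "t \<otimes> x \<in> I" "\<And>j. j \<in> D \<Longrightarrow> \<one> \<ominus> t \<in> Idl {g j}" by auto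
  then have "\<one> \<ominus> t = \<zero>" by (intro separating) auto
  then have "t = \<one>" using t(1) by (metis minus_closed r_right_minus_eq one_closed)
  then show ?thesis using t x by simp
qed

lemma sum_Idl_upper: "ideal I R \<Longrightarrow> i \<in> D \<Longrightarrow> I \<subseteq> I <+>\<^bsub>R\<^esub> Idl {g i}"
proof
  fix x assume A: "ideal I R" "i \<in> D" "x \<in> I"
  have "x \<in> carrier R" using A ideal.Icarr by metis
  then have "x = x \<oplus> \<zero> \<otimes> g i" using A gC by simp
  then show "x \<in> I <+>\<^bsub>R\<^esub> Idl {g i}" using A gC by (subst sum_Idl1_iff) blast+
qed

lemma eq_of_local:
  assumes "ideal I R" "ideal J R" "\<And>i. i \<in> D \<Longrightarrow> I <+>\<^bsub>R\<^esub> Idl {g i} = J <+>\<^bsub>R\<^esub> Idl {g i}"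
  shows "I = J"
proof -
  have "I \<subseteq> J" if I: "ideal I R" and J: "ideal J R" and eq: "\<And>i. i \<in> D \<Longrightarrow> I <+>\<^bsub>R\<^esub> Idl {g i} = J <+>\<^bsub>R\<^esub> Idl {g i}" for I J
  proof
    fix x assume x: "x \<in> I"
    have "x \<in> J <+>\<^bsub>R\<^esub> Idl {g i}" if "i \<in> D" for i
      using x sum_Idl_upper[OF I that] eq[OF that] by blast
    then show "x \<in> J" using mem_of_local[OF J ideal.Icarr[OF I x]] by blast
  qed
  then show ?thesis using assms by blast
qed

text \<open>In general a power of \<open>(g, p)\<close> need not contain \<open>g\<close>. Here
  \<open>e i \<otimes> g i = \<zero>\<close> and
  \<open>\<one> \<ominus> e i = r \<otimes> g i\<close> give
  \<open>g i = g i \<otimes> (r \<otimes> g i)\<close>, so \<open>g i\<close> survives in every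
  product.\<close>

lemma Idl_pair_power:
  assumes i: "i \<in> D"
  shows "Idl {g i, p} [^]\<^bsub>ideals_set R\<^esub> (k::nat) = Idl {g i, p [^] k}"
proof (induct k)
  case 0
  have "ideal (Idl {g i, \<one>}) R" "\<one> \<in> Idl {g i, \<one>}" using gC[OF i] Idl_pair by auto
  then have "Idl {g i, \<one>} = carrier R" by (metis ideal.one_imp_carrier)
  then show ?case by (simp add: ideals_set_def nat_pow_def)
next
  case (Suc k)
  note c = gC[OF i] eC[OF i] pC nat_pow_closed[OF pC, of k] nat_pow_closed[OF pC, of "Suc k"]
  let ?A = "Idl {g i, p [^] k}" and ?B = "Idl {g i, p}" and ?C = "Idl {g i, p [^] Suc k}"
  have A: "ideal ?A R" "g i \<in> ?A" "p [^] k \<in> ?A" using c Idl_pair by auto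
  have B: "ideal ?B R" "g i \<in> ?B" "p \<in> ?B" using c Idl_pair by auto
  have C: "ideal ?C R" "g i \<in> ?C" "p [^] Suc k \<in> ?C" using c Idl_pair by auto
  have "?A \<cdot> ?B \<subseteq> ?C"
  proof (rule ideal_prod_least[OF C(1)])
    fix x y assume "x \<in> ?A" "y \<in> ?B"
    then obtain r s r' s' where d: "r \<in> carrier R" "s \<in> carrier R" "r' \<in> carrier R" "s' \<in> carrier R"
      and eq: "x = r \<otimes> g i \<oplus> s \<otimes> p [^] k" "y = r' \<otimes> g i \<oplus> s' \<otimes> p"
      using c by (auto simp: Idl2_iff)
    have "x \<otimes> y = (r \<otimes> y \<oplus> s \<otimes> p [^] k \<otimes> r') \<otimes> g i \<oplus> (s \<otimes> s') \<otimes> (p [^] k \<otimes> p)"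
      unfolding eq using c d by algebra
    then have "x \<otimes> y = (r \<otimes> y \<oplus> s \<otimes> p [^] k \<otimes> r') \<otimes> g i \<oplus> (s \<otimes> s') \<otimes> p [^] Suc k" by simp
    moreover have "r \<otimes> y \<oplus> s \<otimes> p [^] k \<otimes> r' \<in> carrier R" using c d eq by simp
    ultimately show "x \<otimes> y \<in> ?C" using c d by (subst Idl2_iff) auto
  qed
  moreover have "?C \<subseteq> ?A \<cdot> ?B"
  proof (rule Idl_pair_le[OF ideal_prod_is_ideal[OF A(1) B(1)]])
    show "p [^] Suc k \<in> ?A \<cdot> ?B" using ideal_prod.prod[OF A(3) B(3)] by simp
    obtain r where r: "r \<in> carrier R" "\<one> \<ominus> e i = r \<otimes> g i"
      using e_one[OF i] c by (auto simp: Idl1_iff)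
    have "g i = (\<one> \<ominus> e i) \<otimes> g i \<oplus> e i \<otimes> g i" using c by algebra
    also have "\<dots> = g i \<otimes> (r \<otimes> g i)" using r e_g[OF i] c by (simp add: m_comm)
    finally have "g i = g i \<otimes> (r \<otimes> g i)" .
    moreover have "r \<otimes> g i \<in> ?B" using B r ideal.I_l_closed by metis
    ultimately show "g i \<in> ?A \<cdot> ?B" using ideal_prod.prod[OF A(2), of "r \<otimes> g i" ?B R] by simp
  qed
  ultimately show ?case using Suc by (simp add: ideals_set_def nat_pow_def)
qed

text \<open>The last two clauses say that at \<open>j\<close> the product looks like the unit ideal
  if \<open>j\<close> is outside \<open>S\<close>, and like \<open>B j\<close> if \<open>j\<close>
  is in \<open>S\<close>. The first of them supplies the factor \<open>e i\<close> when
  \<open>i\<close> is inserted; idempotence lets one \<open>e j\<close> be split between two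
  factors.\<close>

lemma finprod_ideals:
  assumes "finite S" "S \<subseteq> D" and B: "\<And>j. j \<in> D \<Longrightarrow> ideal (B j) R" "\<And>j. j \<in> D \<Longrightarrow> g j \<in> B j"
  shows "ideal (finprod (ideals_set R) B S) R \<and> (\<forall>j\<in>S. finprod (ideals_set R) B S \<subseteq> B j) \<and>
    (\<forall>j\<in>D - S. e j \<in> finprod (ideals_set R) B S) \<and>
    (\<forall>j\<in>S. \<forall>x\<in>B j. e j \<otimes> x \<in> finprod (ideals_set R) B S)"
  using assms(1,2)
proof (induct S rule: finite_induct)
  interpret ids: comm_monoid "ideals_set R" by (rule ideals_set_is_comm_monoid)
  case empty
  show ?case using eC oneideal by (simp add: ids.finprod_empty) (simp add: ideals_set_def)
next
  interpret ids: comm_monoid "ideals_set R" by (rule ideals_set_is_comm_monoid)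
  case (insert i S)
  let ?P = "finprod (ideals_set R) B S"
  have i: "i \<in> D" and P: "ideal ?P R" "\<And>j. j \<in> S \<Longrightarrow> ?P \<subseteq> B j"
    and eP: "\<And>j. j \<in> D - S \<Longrightarrow> e j \<in> ?P" and exP: "\<And>j x. j \<in> S \<Longrightarrow> x \<in> B j \<Longrightarrow> e j \<otimes> x \<in> ?P"
    using insert by auto
  have eq: "finprod (ideals_set R) B (insert i S) = B i \<cdot> ?P"
    using insert B by (subst ids.finprod_insert) (auto simp: ideals_set_def)
  have id: "ideal (B i \<cdot> ?P) R" using P B i ideal_prod_is_ideal by auto
  have idem: "e j = e j \<otimes> e j" if j: "j \<in> D" for j
  proof -
    obtain r where r: "r \<in> carrier R" "\<one> \<ominus> e j = r \<otimes> g j"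
      using e_one[OF j] gC[OF j] by (auto simp: Idl1_iff)
    have "e j = e j \<otimes> e j \<oplus> e j \<otimes> (\<one> \<ominus> e j)" using eC[OF j] by algebra
    also have "e j \<otimes> (\<one> \<ominus> e j) = r \<otimes> (e j \<otimes> g j)"
      unfolding r(2) using eC[OF j] gC[OF j] r(1) by algebra
    finally show ?thesis using r eC[OF j] e_g[OF j] by simp
  qed
  have other: "e j \<in> B i" if "j \<in> D" "j \<noteq> i" for j
    using e_other[of j i] that i Idl_single_le[OF B(1)[OF i] B(2)[OF i]] by auto
  show ?case unfolding eq
  proof (intro conjI ballI)
    show "ideal (B i \<cdot> ?P) R" by fact
    show "B i \<cdot> ?P \<subseteq> B j" if "j \<in> insert i S" for j
      using that ideal_prod_inter[OF B(1)[OF i] P(1)] P(2) by auto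
    show "e j \<in> B i \<cdot> ?P" if "j \<in> D - insert i S" for j
      using that ideal_prod.prod[OF other[of j] eP[of j], of R] idem[of j] by auto
    show "e j \<otimes> x \<in> B i \<cdot> ?P" if j: "j \<in> insert i S" and x: "x \<in> B j" for j x
    proof (cases "j = i")
      case True
      have "x \<in> carrier R" using x True i B ideal.Icarr by metis
      then show ?thesis using True x insert i ideal_prod.prod[of x "B i" "e i" ?P R] eP[of i] eC[OF i]
        by (simp add: m_comm)
    next
      case False
      then have jS: "j \<in> S" "j \<in> D" using j insert by auto
      have xc: "x \<in> carrier R" using x jS B ideal.Icarr by metis
      have "e j \<otimes> (e j \<otimes> x) \<in> B i \<cdot> ?P"
        using ideal_prod.prod[OF other[of j] exP[OF jS(1) x], of R] False jS by auto
      then show ?thesis using idem[OF jS(2)] eC[OF jS(2)] xc by (metis m_assoc)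
    qed
  qed
qed

text \<open>Split \<open>x\<close> in \<open>B i\<close> as \<open>e i \<otimes> x\<close> plus a
  multiple of \<open>\<one> \<ominus> e i\<close>: the first summand lies in the product, the second
  in \<open>(g i)\<close>.\<close>

lemma finprod_local:
  assumes B: "\<And>j. j \<in> D \<Longrightarrow> ideal (B j) R" "\<And>j. j \<in> D \<Longrightarrow> g j \<in> B j" and i: "i \<in> D"
  shows "finprod (ideals_set R) B D <+>\<^bsub>R\<^esub> Idl {g i} = B i"
proof
  let ?P = "finprod (ideals_set R) B D"
  have P: "ideal ?P R" "?P \<subseteq> B i" "\<And>x. x \<in> B i \<Longrightarrow> e i \<otimes> x \<in> ?P"
    using finprod_ideals[OF finD subset_refl B] i by auto
  show "?P <+>\<^bsub>R\<^esub> Idl {g i} \<subseteq> B i"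
  proof
    fix x assume "x \<in> ?P <+>\<^bsub>R\<^esub> Idl {g i}"
    then show "x \<in> B i"
      using P B[OF i] gC[OF i] by (auto simp: sum_Idl1_iff intro!: ideal_add ideal.I_l_closed)
  qed
  show "B i \<subseteq> ?P <+>\<^bsub>R\<^esub> Idl {g i}"
  proof
    fix x assume x: "x \<in> B i"
    have xc: "x \<in> carrier R" using x i B ideal.Icarr by metis
    obtain r where r: "r \<in> carrier R" "\<one> \<ominus> e i = r \<otimes> g i"
      using e_one[OF i] gC[OF i] by (auto simp: Idl1_iff)
    have "x = e i \<otimes> x \<oplus> x \<otimes> (\<one> \<ominus> e i)" using eC[OF i] xc by algebra
    also have "x \<otimes> (\<one> \<ominus> e i) = x \<otimes> r \<otimes> g i"
      unfolding r(2) using xc r(1) gC[OF i] by algebra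
    finally show "x \<in> ?P <+>\<^bsub>R\<^esub> Idl {g i}"
      using P(3)[OF x] xc r gC[OF i] by (subst sum_Idl1_iff) (blast intro: m_closed)+
  qed
qed

section \<open>The chain of ideals above one component\<close>

definition comp_power :: "'i \<Rightarrow> enat \<Rightarrow> 'a set" where
  "comp_power i m = (case m of enat k \<Rightarrow> Idl {g i, p} [^]\<^bsub>ideals_set R\<^esub> k | \<infinity> \<Rightarrow> Idl {g i})"

lemma comp_power_simps:
  assumes "i \<in> D"
  shows "comp_power i (enat k) = Idl {g i, p [^] k}" "comp_power i \<infinity> = Idl {g i}"
  using Idl_pair_power[OF assms] by (simp_all add: comp_power_def)

lemma comp_power_ideal:
  assumes "i \<in> D"
  shows "ideal (comp_power i m) R" "g i \<in> comp_power i m"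
  using assms Idl_pair[OF gC nat_pow_closed[OF pC]] Idl_single[OF gC]
  by (cases m; simp add: comp_power_simps)+

text \<open>Modulo \<open>g i\<close> every element outside \<open>(g i)\<close> is associated with
  a power of \<open>p\<close>, so \<open>J\<close> is generated by the least power it contains. If
  \<open>J\<close> is just \<open>(g i)\<close>, the exponent is \<open>a\<close>.\<close>

lemma comp_power_surj:
  assumes i: "i \<in> D" and J: "ideal J R" "g i \<in> J"
  shows "\<exists>m\<le>a. J = comp_power i m"
proof (cases "J \<subseteq> Idl {g i}")
  case True
  then have J': "J = Idl {g i}" using Idl_single_le[OF J] by auto
  \<comment> \<open>For finite \<open>a\<close> because \<open>p [^] a\<close> vanishes, for
    infinite \<open>a\<close> by the convention on the exponent \<open>\<infinity>\<close>.\<close>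
  have "comp_power i a = Idl {g i}"
  proof (cases a)
    case (enat k)
    have "Idl {g i, \<zero>} = Idl {g i}"
      using gC[OF i] Idl_single[OF gC[OF i]] Idl_pair[of "g i" \<zero>]
      by (intro equalityI Idl_pair_le Idl_single_le) (auto intro: ideal_zero)
    then show ?thesis using enat power_zero i by (simp add: comp_power_simps)
  qed (use i in \<open>simp add: comp_power_simps\<close>)
  then show ?thesis using J' by auto
next
  case False
  have ex: "\<exists>k. enat k < a \<and> p [^] k \<in> J \<and> x \<in> Idl {g i, p [^] k}" if x: "x \<in> J" "x \<notin> Idl {g i}" for x
  proof -
    have xc: "x \<in> carrier R" using x J ideal.Icarr by metis
    then show ?thesis using assoc_power[OF i xc x(2)] Idl_pair_le[OF J(1) x(1) J(2)] by blast
  qed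
  define m :: nat where "m = (LEAST k. p [^] k \<in> J)"
  obtain k where k: "enat k < a" "p [^] k \<in> J" using False ex by blast
  have m: "p [^] m \<in> J" "m \<le> k" unfolding m_def using k by (auto intro: LeastI Least_le)
  have "J = Idl {g i, p [^] m}"
  proof
    show "Idl {g i, p [^] m} \<subseteq> J" using Idl_pair_le J m by auto
    show "J \<subseteq> Idl {g i, p [^] m}"
    proof
      fix x assume x: "x \<in> J"
      note id = Idl_pair[OF gC[OF i] nat_pow_closed[OF pC, of m]]
      show "x \<in> Idl {g i, p [^] m}"
      proof (cases "x \<in> Idl {g i}")
        case True
        then show ?thesis using Idl_single_le[OF id(1,2)] by auto
      next
        case False
        then obtain l :: nat where l: "p [^] l \<in> J" "x \<in> Idl {g i, p [^] l}" using ex[OF x] by auto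
        have "m \<le> l" unfolding m_def using l by (auto intro: Least_le)
        then have "p [^] l = p [^] (l - m) \<otimes> p [^] m" using pC by (simp add: nat_pow_mult)
        then have "p [^] l \<in> Idl {g i, p [^] m}" using id(1,3) pC by (simp add: ideal.I_l_closed)
        then show ?thesis using Idl_pair_le[OF id(1,2)] l by blast
      qed
    qed
  qed
  moreover have "enat m \<le> a" using k m by (meson enat_ord_simps(1) less_imp_le order_trans)
  ultimately show ?thesis using i by (auto simp: comp_power_simps)
qed

text \<open>If \<open>p [^] k\<close> were \<open>s \<otimes> p [^] l\<close> modulo
  \<open>g i\<close> with \<open>l > k\<close>, then
  \<open>\<one> \<ominus> s \<otimes> p [^] (l - k)\<close> would kill \<open>p [^] k\<close> modulo
  \<open>g i\<close>. That element is a unit modulo \<open>g i\<close>, so \<open>p [^] k\<close>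
  would lie in \<open>(g i)\<close>, contrary to \<open>power_in\<close>.\<close>

lemma power_notin:
  assumes i: "i \<in> D" and k: "enat k < m" "m \<le> a"
  shows "p [^] k \<notin> comp_power i m"
proof
  assume A: "p [^] k \<in> comp_power i m"
  have not: "p [^] k \<notin> Idl {g i}" using power_in[OF i] k by force
  then obtain l where l: "m = enat l" using A i by (cases m) (auto simp: comp_power_simps)
  then have kl: "k < l" using k by simp
  note c = gC[OF i] pC nat_pow_closed[OF pC, of k] nat_pow_closed[OF pC, of "l - Suc k"]
  obtain r s where rs: "r \<in> carrier R" "s \<in> carrier R" "p [^] k = r \<otimes> g i \<oplus> s \<otimes> p [^] l"
    using A l i c by (auto simp: comp_power_simps Idl2_iff)
  let ?q = "p [^] (l - Suc k)"
  have "p [^] l = p [^] (k + (1 + (l - Suc k)))" using kl by simp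
  also have "\<dots> = p [^] k \<otimes> (p \<otimes> ?q)" using pC by (simp only: nat_pow_mult[symmetric] nat_pow_eone)
  finally have pl: "p [^] l = p [^] k \<otimes> (p \<otimes> ?q)" .
  let ?y = "\<one> \<ominus> s \<otimes> ?q \<otimes> p"
  have yc: "?y \<in> carrier R" using c rs by simp
  have "p [^] k \<otimes> ?y = p [^] k \<ominus> s \<otimes> (p [^] k \<otimes> (p \<otimes> ?q))" using c rs(1,2) by algebra
  also have "\<dots> = p [^] k \<ominus> s \<otimes> p [^] l" by (simp only: pl)
  also have "\<dots> = r \<otimes> g i"
  proof -
    have "s \<otimes> p [^] l \<in> carrier R" "r \<otimes> g i \<in> carrier R" using c rs pC by auto
    then show ?thesis unfolding rs(3) by algebra
  qed
  finally have kill: "p [^] k \<otimes> ?y \<in> Idl {g i}" using c rs by (auto simp: Idl1_iff)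
  note idp = Idl_pair[OF c(1,2)] and ids = Idl_single[OF c(1)]
  have y: "?y \<notin> Idl {g i, p}"
  proof
    assume "?y \<in> Idl {g i, p}"
    moreover have "s \<otimes> ?q \<otimes> p \<in> Idl {g i, p}" using idp c rs by (simp add: ideal.I_l_closed)
    ultimately have "?y \<oplus> s \<otimes> ?q \<otimes> p \<in> Idl {g i, p}" using idp ideal_add by blast
    moreover have "?y \<oplus> s \<otimes> ?q \<otimes> p = \<one>" using c rs(1,2) by algebra
    ultimately show False using proper[OF i] by simp
  qed
  then have "?y \<notin> Idl {g i}" using Idl_single_le[OF idp(1,2)] by auto
  from assoc_power[OF i yc this] obtain j :: nat where j: "p [^] j \<in> Idl {?y, g i}" "?y \<in> Idl {g i, p [^] j}" by blast
  \<comment> \<open>The element \<open>?y\<close> is associated with \<open>p [^] j\<close> modulo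
    \<open>g i\<close>. A positive \<open>j\<close> would place it in \<open>(g i, p)\<close>, so it
    is a unit modulo \<open>g i\<close>.\<close>
  have "j = 0"
  proof (rule ccontr)
    assume "j \<noteq> 0"
    then obtain j' where "j = Suc j'" by (cases j) auto
    then have "p [^] j \<in> Idl {g i, p}" using idp pC by (simp add: ideal.I_l_closed)
    then show False using y j Idl_pair_le[OF idp(1,2)] by blast
  qed
  then obtain r' s' where u: "r' \<in> carrier R" "s' \<in> carrier R" "\<one> = r' \<otimes> ?y \<oplus> s' \<otimes> g i"
    using j c yc by (auto simp: Idl2_iff)
  have expand: "A \<otimes> (r' \<otimes> Y \<oplus> s' \<otimes> g i) = r' \<otimes> (A \<otimes> Y) \<oplus> A \<otimes> s' \<otimes> g i"
    if "A \<in> carrier R" "Y \<in> carrier R" for A Y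
    using that c(1) u(1,2) by algebra
  have "p [^] k \<otimes> \<one> = r' \<otimes> (p [^] k \<otimes> ?y) \<oplus> p [^] k \<otimes> s' \<otimes> g i"
    by (subst u(3)) (rule expand[OF c(3) yc])
  then have "p [^] k = r' \<otimes> (p [^] k \<otimes> ?y) \<oplus> p [^] k \<otimes> s' \<otimes> g i"
    using c(3) by (metis r_one)
  moreover have "r' \<otimes> (p [^] k \<otimes> ?y) \<in> Idl {g i}" using ids(1) kill u(1) by (rule ideal.I_l_closed)
  moreover have "p [^] k \<otimes> s' \<otimes> g i \<in> Idl {g i}" using ids c(3) u(2) by (simp add: ideal.I_l_closed)
  ultimately have "p [^] k \<in> Idl {g i}" using ideal_add[OF ids(1)] by metis
  then show False using not by simp
qed

lemma comp_power_inj: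
  assumes i: "i \<in> D" and "m \<le> a" "m' \<le> a" "comp_power i m = comp_power i m'"
  shows "m = m'"
proof -
  have False if lt: "m < m'" "m' \<le> a" "comp_power i m = comp_power i m'" for m m'
  proof -
    obtain k where k: "m = enat k" using lt(1) by (cases m) auto
    then have "p [^] k \<in> comp_power i m"
      using i gC pC by (simp add: comp_power_simps Idl_pair)
    then show False using power_notin[OF i, of k m'] k lt by auto
  qed
  then show ?thesis using assms by (metis linorder_neqE)
qed

theorem ideal_decomposition:
  assumes "ideal I R"
  shows "\<exists>!m. m \<in> D \<rightarrow>\<^sub>E {..a} \<and> I = (\<Otimes>\<^bsub>ideals_set R\<^esub> i \<in> D. comp_power i (m i))"
proof (rule ex_ex1I)
  have "\<exists>m. m \<le> a \<and> I <+>\<^bsub>R\<^esub> Idl {g i} = comp_power i m" if i: "i \<in> D" for i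
  proof -
    have "ideal (I <+>\<^bsub>R\<^esub> Idl {g i}) R" using assms gC[OF i] Idl_single add_ideals by auto
    moreover have "g i \<in> I <+>\<^bsub>R\<^esub> Idl {g i}"
    proof -
      have "g i = \<zero> \<oplus> \<one> \<otimes> g i" using gC[OF i] by simp
      then show ?thesis using assms gC[OF i] ideal_zero by (subst sum_Idl1_iff) blast+
    qed
    ultimately show ?thesis using comp_power_surj[OF i] by blast
  qed
  then have "\<forall>i\<in>D. \<exists>m. m \<le> a \<and> I <+>\<^bsub>R\<^esub> Idl {g i} = comp_power i m" by blast
  from bchoice[OF this] obtain m
    where m: "\<And>i. i \<in> D \<Longrightarrow> m i \<le> a \<and> I <+>\<^bsub>R\<^esub> Idl {g i} = comp_power i (m i)" by blast
  let ?m = "restrict m D"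
  have "I = (\<Otimes>\<^bsub>ideals_set R\<^esub> i \<in> D. comp_power i (?m i))"
  proof (rule eq_of_local[OF assms])
    show "ideal (\<Otimes>\<^bsub>ideals_set R\<^esub> i \<in> D. comp_power i (?m i)) R"
      using finprod_ideals[OF finD subset_refl, of "\<lambda>i. comp_power i (?m i)"] comp_power_ideal by auto
    show "I <+>\<^bsub>R\<^esub> Idl {g i} = (\<Otimes>\<^bsub>ideals_set R\<^esub> i \<in> D. comp_power i (?m i)) <+>\<^bsub>R\<^esub> Idl {g i}"
      if i: "i \<in> D" for i
      using finprod_local[of "\<lambda>i. comp_power i (?m i)", OF _ _ i] comp_power_ideal m[OF i] i by auto
  qed
  then show "\<exists>m. m \<in> D \<rightarrow>\<^sub>E {..a} \<and> I = (\<Otimes>\<^bsub>ideals_set R\<^esub> i \<in> D. comp_power i (m i))"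
    using m by (intro exI[of _ ?m]) auto
next
  fix m m' assume A: "m \<in> D \<rightarrow>\<^sub>E {..a} \<and> I = (\<Otimes>\<^bsub>ideals_set R\<^esub> i \<in> D. comp_power i (m i))"
    "m' \<in> D \<rightarrow>\<^sub>E {..a} \<and> I = (\<Otimes>\<^bsub>ideals_set R\<^esub> i \<in> D. comp_power i (m' i))"
  have "m i = m' i" if i: "i \<in> D" for i
  proof (rule comp_power_inj[OF i])
    show "m i \<le> a" "m' i \<le> a" using A i by auto
    have "comp_power i (m i) = I <+>\<^bsub>R\<^esub> Idl {g i}" "comp_power i (m' i) = I <+>\<^bsub>R\<^esub> Idl {g i}"
      using A finprod_local[of "\<lambda>i. comp_power i (m i)"] finprod_local[of "\<lambda>i. comp_power i (m' i)"] i comp_power_ideal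
      by auto
    then show "comp_power i (m i) = comp_power i (m' i)" by simp
  qed
  then show "m = m'" using PiE_ext[of m D "\<lambda>_. {..a}" m'] A by blast
qed

theorem card_ideals:
  assumes "a = enat k"
  shows "card {I. ideal I R} = (k + 1) ^ card D"
proof -
  let ?f = "\<lambda>m. \<Otimes>\<^bsub>ideals_set R\<^esub> i \<in> D. comp_power i (m i)"
  have id: "ideal (?f m) R" for m
    using finprod_ideals[OF finD subset_refl, of "\<lambda>i. comp_power i (m i)"] comp_power_ideal by auto
  have "bij_betw ?f (D \<rightarrow>\<^sub>E {..a}) {I. ideal I R}"
    unfolding bij_betw_def inj_on_def
  proof (intro conjI ballI impI equalityI subsetI)
    fix m m' assume "m \<in> D \<rightarrow>\<^sub>E {..a}" "m' \<in> D \<rightarrow>\<^sub>E {..a}" "?f m = ?f m'"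
    then show "m = m'" using ideal_decomposition[OF id[of m]] by blast
  next
    fix I assume "I \<in> {I. ideal I R}"
    then show "I \<in> ?f ` (D \<rightarrow>\<^sub>E {..a})" using ideal_decomposition by blast
  qed (use id in auto)
  then have "card {I. ideal I R} = card (D \<rightarrow>\<^sub>E {..a})" using bij_betw_same_card by fastforce
  also have "\<dots> = card {..a} ^ card D" using finD by (simp add: card_PiE)
  also have "{..a} = enat ` {..k}"
  proof -
    have "x \<in> enat ` {..k}" if "x \<le> enat k" for x using that by (cases x) auto
    then show ?thesis unfolding assms by auto
  qed
  also have "card \<dots> = k + 1" by (simp add: card_image inj_on_def)
  finally show ?thesis .
qed

end

section \<open>Nakayama's and Hensel's lemmas\<close>

text \<open>An abstraction of the polynomial ring over a \<open>p\<close>-adically complete ring whose elements are units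
  modulo \<open>p\<close> or multiples of \<open>p\<close>: \<open>V d\<close> stands for the polynomials of degree less than \<open>d\<close> and \<open>M d\<close> for the
  monic polynomials of degree \<open>d\<close>.\<close>

locale poly_filtration = cring R for R (structure) +
  fixes p :: 'a and V M :: "nat \<Rightarrow> 'a set"
  assumes pC: "p \<in> carrier R"
    and V_carr: "x \<in> V d \<Longrightarrow> x \<in> carrier R"
    and V_minus: "x \<in> V d \<Longrightarrow> y \<in> V d \<Longrightarrow> x \<ominus> y \<in> V d"
    and V_zero: "\<zero> \<in> V d"
    and V_p: "x \<in> V d \<Longrightarrow> p \<otimes> x \<in> V d"
    and V_0: "x \<in> V 0 \<Longrightarrow> x = \<zero>"
    and V_one: "\<one> \<in> V (Suc d)"
    and M_carr: "f \<in> M d \<Longrightarrow> f \<in> carrier R"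
    and M_add: "f \<in> M d \<Longrightarrow> x \<in> V d \<Longrightarrow> f \<oplus> x \<in> M d"
    and M_minus: "f \<in> M d \<Longrightarrow> h \<in> M d \<Longrightarrow> f \<ominus> h \<in> V d"
    and M_less: "f \<in> M d \<Longrightarrow> d < e \<Longrightarrow> f \<in> V e"
    and M_0: "f \<in> M 0 \<Longrightarrow> f = \<one>"
    and division: "f \<in> M d \<Longrightarrow> x \<in> carrier R \<Longrightarrow> \<exists>q\<in>carrier R. x \<ominus> q \<otimes> f \<in> V d"
    and unique: "f \<in> M d \<Longrightarrow> q \<in> carrier R \<Longrightarrow> q \<otimes> f \<in> V d \<Longrightarrow> q = \<zero>"
    and limit: "(\<And>k. s k \<in> V d) \<Longrightarrow> (\<And>k. s (Suc k) \<ominus> s k \<in> Idl {p [^] k}) \<Longrightarrow>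
      \<exists>x\<in>V d. \<forall>k. x \<ominus> s k \<in> Idl {p [^] k}"
    and separated: "x \<in> V d \<Longrightarrow> (\<And>k::nat. x \<in> Idl {p [^] k}) \<Longrightarrow> x = \<zero>"
    and lead: "x \<in> V (Suc d) \<Longrightarrow>
      (\<exists>w\<in>Idl {p}. x \<ominus> w \<in> V d) \<or> (\<exists>u\<in>carrier R. \<exists>w\<in>Idl {p}. u \<otimes> x \<oplus> w \<in> M d)"
begin

section \<open>Reduction modulo a monic element and Nakayama's lemma\<close>

lemma pkC [simp]: "p [^] (k::nat) \<in> carrier R"
  using pC by simp

lemma V_add: "x \<in> V d \<Longrightarrow> y \<in> V d \<Longrightarrow> x \<oplus> y \<in> V d"
proof -
  assume A: "x \<in> V d" "y \<in> V d"
  then have "x \<oplus> y = x \<ominus> (\<zero> \<ominus> y)" using V_carr[of x d] V_carr[of y d] by algebra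
  then show ?thesis using A V_minus V_zero by metis
qed

lemma V_pk: "x \<in> V d \<Longrightarrow> p [^] (k::nat) \<otimes> x \<in> V d"
proof (induct k)
  case (Suc k)
  have "p [^] Suc k \<otimes> x = p \<otimes> (p [^] k \<otimes> x)" using V_carr[OF Suc(2)] pC by (simp add: m_ac)
  then show ?case using Suc V_p by simp
qed (use V_carr in simp)

text \<open>Reducing modulo the monic \<open>f\<close> turns membership in all ideals \<open>(f, p ^ k)\<close> into divisibility of
  the remainder by all \<open>p ^ k\<close>.\<close>

lemma mem_Idl_of_mem_powers:
  assumes f: "f \<in> M d" and x: "x \<in> carrier R" and mem: "\<And>k::nat. x \<in> Idl {f, p [^] k}"
  shows "x \<in> Idl {f}"
proof -
  have fC: "f \<in> carrier R" using f M_carr by auto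
  obtain q where q: "q \<in> carrier R" "x \<ominus> q \<otimes> f \<in> V d" using division[OF f x] by auto
  have "x \<ominus> q \<otimes> f \<in> Idl {p [^] k}" for k :: nat
  proof -
    obtain r s where rs: "r \<in> carrier R" "s \<in> carrier R" "x = r \<otimes> f \<oplus> s \<otimes> p [^] k"
      using mem[of k] fC by (auto simp: Idl2_iff)
    \<comment> \<open>The coefficient \<open>s\<close> is reduced modulo \<open>f\<close> as well.
      Both \<open>x \<ominus> q \<otimes> f\<close> and \<open>p [^] k\<close> times the reduced
      \<open>s\<close> then have degree less than \<open>d\<close> and differ by a multiple of
      \<open>f\<close>, so they agree by uniqueness of division.\<close>
    obtain t where t: "t \<in> carrier R" "s \<ominus> t \<otimes> f \<in> V d" using division[OF f rs(2)] by auto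
    have "x \<ominus> q \<otimes> f \<ominus> p [^] k \<otimes> (s \<ominus> t \<otimes> f) = (r \<ominus> q \<oplus> p [^] k \<otimes> t) \<otimes> f"
      unfolding rs(3) using rs(1,2) t(1) q(1) fC pkC[of k] by algebra
    moreover have "x \<ominus> q \<otimes> f \<ominus> p [^] k \<otimes> (s \<ominus> t \<otimes> f) \<in> V d"
      using V_minus V_pk q t by blast
    ultimately have "r \<ominus> q \<oplus> p [^] k \<otimes> t = \<zero>"
      using unique[OF f, of "r \<ominus> q \<oplus> p [^] k \<otimes> t"] rs q t by simp
    then have "x \<ominus> q \<otimes> f \<ominus> p [^] k \<otimes> (s \<ominus> t \<otimes> f) = \<zero>"
      using \<open>x \<ominus> q \<otimes> f \<ominus> p [^] k \<otimes> (s \<ominus> t \<otimes> f) = _\<close> fC by simp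
    then have "x \<ominus> q \<otimes> f = p [^] k \<otimes> (s \<ominus> t \<otimes> f)"
      using rs q t fC x by simp
    then have "x \<ominus> q \<otimes> f = (s \<ominus> t \<otimes> f) \<otimes> p [^] k"
      using rs(1,2) t(1) fC by (simp add: m_comm)
    then show ?thesis using rs t fC by (auto simp: Idl1_iff)
  qed
  then have "x \<ominus> q \<otimes> f = \<zero>" using separated q by blast
  then have "x = q \<otimes> f" using x q fC by simp
  then show ?thesis using q fC by (auto simp: Idl1_iff)
qed

text \<open>Nakayama's lemma: the geometric series for \<open>1 / (1 - p y)\<close>, with each \<open>y ^ k\<close> reduced modulo \<open>f\<close>,
  converges.\<close>

lemma nakayama:
  assumes I: "ideal I R" and f: "f \<in> M d" "f \<in> I" and one: "\<one> \<in> I <+>\<^bsub>R\<^esub> Idl {p}"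
  shows "\<one> \<in> I"
proof -
  have fC: "f \<in> carrier R" using f M_carr by auto
  obtain u y where u: "u \<in> I" "y \<in> carrier R" "\<one> = u \<oplus> y \<otimes> p"
    using one pC by (auto simp: sum_Idl1_iff)
  have uC: "u \<in> carrier R" using I u ideal.Icarr by metis
  have u_eq: "u = \<one> \<ominus> y \<otimes> p" unfolding u(3) using uC u(2) pC by algebra
  have "\<exists>q\<in>carrier R. y [^] k \<ominus> q \<otimes> f \<in> V d" for k :: nat using division[OF f(1)] u by simp
  then obtain q where q: "\<And>k::nat. q k \<in> carrier R" "\<And>k. y [^] k \<ominus> q k \<otimes> f \<in> V d" by metis
  define r where "r k = y [^] k \<ominus> q k \<otimes> f" for k :: nat
  have rV: "r k \<in> V d" for k using q by (simp add: r_def)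
  then have rC: "r k \<in> carrier R" for k using V_carr by blast
  \<comment> \<open>Partial sums of the geometric series. Since the powers of \<open>y\<close> are
    replaced by their remainders \<open>r k\<close>, all sums stay in \<open>V d\<close>, where
    limits exist.\<close>
  define s where "s = rec_nat \<zero> (\<lambda>k z. z \<oplus> r k \<otimes> p [^] k)"
  have s0: "s 0 = \<zero>" and sS: "\<And>k. s (Suc k) = s k \<oplus> r k \<otimes> p [^] k" by (simp_all add: s_def)
  have sV: "s k \<in> V d" for k
    by (induct k) (use V_pk[OF rV] rC in \<open>auto simp: s0 sS V_zero m_comm intro!: V_add\<close>)
  then have sC: "s k \<in> carrier R" for k using V_carr by blast
  have "s (Suc k) \<ominus> s k = r k \<otimes> p [^] k" for k
    unfolding sS using sC[of k] rC[of k] pkC[of k] by algebra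
  then have "s (Suc k) \<ominus> s k \<in> Idl {p [^] k}" for k using rC by (auto simp: Idl1_iff)
  then obtain x where x: "x \<in> V d" "\<And>k. x \<ominus> s k \<in> Idl {p [^] k}" using limit[of s d, OF sV] by blast
  have xC: "x \<in> carrier R" using x V_carr by auto
  note idf = Idl_single[OF fC]
  \<comment> \<open>The usual telescoping, valid only modulo \<open>f\<close> because
    \<open>r k\<close> agrees with \<open>y [^] k\<close> only modulo \<open>f\<close>.\<close>
  have series: "u \<otimes> s k \<ominus> (\<one> \<ominus> (y \<otimes> p) [^] k) \<in> Idl {f}" for k
  proof (induct k)
    case 0
    have "u \<otimes> s 0 \<ominus> (\<one> \<ominus> (y \<otimes> p) [^] (0::nat)) = \<zero>" unfolding s0 using uC by (simp add: minus_eq r_neg)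
    then show ?case using idf ideal_zero by simp
  next
    case (Suc k)
    note c = uC sC[of k] rC[of k] pkC[of k] pC u(2) fC q(1)[of k] nat_pow_closed[OF u(2), of k]
    have "(y \<otimes> p) [^] Suc k = y [^] k \<otimes> p [^] k \<otimes> (y \<otimes> p)" "(y \<otimes> p) [^] k = y [^] k \<otimes> p [^] k"
      using c by (simp_all add: nat_pow_distrib)
    then have "u \<otimes> s (Suc k) \<ominus> (\<one> \<ominus> (y \<otimes> p) [^] Suc k) =
      (u \<otimes> s k \<ominus> (\<one> \<ominus> (y \<otimes> p) [^] k)) \<oplus>
        (u \<otimes> (r k \<otimes> p [^] k) \<ominus> y [^] k \<otimes> p [^] k \<otimes> (\<one> \<ominus> y \<otimes> p))"
      unfolding sS by (simp only:) (use c in algebra)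
    also have "u \<otimes> (r k \<otimes> p [^] k) \<ominus> y [^] k \<otimes> p [^] k \<otimes> (\<one> \<ominus> y \<otimes> p) = (\<ominus> (u \<otimes> q k \<otimes> p [^] k)) \<otimes> f"
      unfolding u_eq[symmetric] r_def using c by algebra
    finally show ?case using Suc idf c by (simp only:) (intro ideal_add ideal.I_l_closed, auto)
  qed
  \<comment> \<open>Three errors occur: replacing \<open>x\<close> by \<open>s k\<close> and
    dropping \<open>(y \<otimes> p) [^] k\<close> cost multiples of \<open>p [^] k\<close>, the
    telescoping costs a multiple of \<open>f\<close>.\<close>
  have "u \<otimes> x \<ominus> \<one> \<in> Idl {f, p [^] k}" for k :: nat
  proof -
    note idp = Idl_pair[OF fC pkC[of k]]
    have pk: "(y \<otimes> p) [^] k \<in> Idl {f, p [^] k}"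
      using idp u pC by (auto simp: nat_pow_distrib intro!: ideal.I_l_closed)
    have a: "u \<otimes> s k \<ominus> (\<one> \<ominus> (y \<otimes> p) [^] k) \<in> Idl {f, p [^] k}"
      using series[of k] Idl_single_le[OF idp(1,2)] by blast
    have b: "u \<otimes> (x \<ominus> s k) \<in> Idl {f, p [^] k}"
      using x(2)[of k] Idl_single_le[OF idp(1,3)] uC by (intro ideal.I_l_closed[OF idp(1)]) auto
    have "(y \<otimes> p) [^] k \<in> carrier R" using u pC by simp
    then have "u \<otimes> x \<ominus> \<one> = u \<otimes> (x \<ominus> s k) \<oplus> (u \<otimes> s k \<ominus> (\<one> \<ominus> (y \<otimes> p) [^] k)) \<ominus> (y \<otimes> p) [^] k"
      using uC xC sC[of k] by algebra
    then show ?thesis using a b pk idp by (simp add: ideal_add ideal_minus)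
  qed
  then have "u \<otimes> x \<ominus> \<one> \<in> Idl {f}" using mem_Idl_of_mem_powers[OF f(1), of "u \<otimes> x \<ominus> \<one>"] uC xC by simp
  then have "u \<otimes> x \<ominus> \<one> \<in> I" using Idl_single_le[OF I f(2)] by blast
  moreover have "u \<otimes> x \<in> I" using I u xC ideal.I_r_closed by metis
  ultimately show ?thesis using ideal_cancel[OF I, of "u \<otimes> x" \<one>] uC xC by simp
qed

text \<open>The substitute for the Euclidean algorithm over the residue field: division by
  \<open>g\<close> leaves a remainder in \<open>I\<close> of degree less than \<open>d\<close>, and
  minimality of \<open>d\<close> forces it to be divisible by \<open>p\<close>.\<close>

lemma ideal_eq_monic_p:
  assumes I: "ideal I R" "p \<in> I" and g: "g \<in> M d" "g \<in> I" and least: "\<And>m. m < d \<Longrightarrow> M m \<inter> I = {}"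
  shows "I = Idl {g, p}"
proof
  have gC: "g \<in> carrier R" using g M_carr by auto
  show "Idl {g, p} \<subseteq> I" using Idl_pair_le I g by simp
  have pI: "Idl {p} \<subseteq> I" using Idl_single_le I by simp
  \<comment> \<open>Descent on the degree: a leading coefficient divisible by \<open>p\<close> is
    subtracted; any other one could be normalised modulo \<open>p\<close>, giving a monic element of
    \<open>I\<close> of too small a degree.\<close>
  have low: "m \<le> d \<Longrightarrow> x \<in> I \<Longrightarrow> x \<in> V m \<Longrightarrow> x \<in> Idl {p}" for m x
  proof (induct m arbitrary: x)
    case 0
    then show ?case using V_0 Idl_single[OF pC] ideal_zero by auto
  next
    case (Suc m)
    have xC: "x \<in> carrier R" using Suc V_carr by auto
    from lead[OF Suc(4)] show ?case
    proof (elim disjE bexE)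
      fix w assume w: "w \<in> Idl {p}" "x \<ominus> w \<in> V m"
      have "x \<ominus> w \<in> I" using Suc(3) w pI I ideal_minus by auto
      then have "x \<ominus> w \<in> Idl {p}" using Suc w by simp
      then show ?thesis using ideal_cancel[OF Idl_single(1)[OF pC], of x w] w xC
          ideal.Icarr[OF Idl_single(1)[OF pC] w(1)] by auto
    next
      fix u w assume w: "u \<in> carrier R" "w \<in> Idl {p}" "u \<otimes> x \<oplus> w \<in> M m"
      then have "u \<otimes> x \<oplus> w \<in> I" using Suc(3) pI I by (auto intro!: ideal_add ideal.I_l_closed)
      then show ?thesis using least[of m] w Suc(2) by auto
    qed
  qed
  show "I \<subseteq> Idl {g, p}"
  proof
    fix x assume x: "x \<in> I"
    have xC: "x \<in> carrier R" using x I ideal.Icarr by metis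
    obtain q where q: "q \<in> carrier R" "x \<ominus> q \<otimes> g \<in> V d" using division[OF g(1) xC] by auto
    note idp = Idl_pair[OF gC pC]
    have "x \<ominus> q \<otimes> g \<in> I" using x I g q by (auto intro!: ideal_minus ideal.I_l_closed)
    then have "x \<ominus> q \<otimes> g \<in> Idl {g, p}" using low[OF order_refl] q Idl_single_le[OF idp(1,3)] by blast
    moreover have "q \<otimes> g \<in> Idl {g, p}" using idp q by (auto intro!: ideal.I_l_closed)
    ultimately show "x \<in> Idl {g, p}" using ideal_cancel[OF idp(1), of x "q \<otimes> g"] xC q gC by simp
  qed
qed

text \<open>For a monic polynomial this is irreducibility modulo \<open>p\<close>. Maximality of
  \<open>(g, p)\<close> is phrased as a way to obtain \<open>\<one>\<close>, the form in which
  Nakayama's lemma takes over.\<close>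

definition residually_irreducible :: "'a \<Rightarrow> bool" where
  "residually_irreducible g \<longleftrightarrow> \<one> \<notin> Idl {g, p} \<and>
    (\<forall>K. ideal K R \<and> Idl {g, p} \<subseteq> K \<and> \<not> K \<subseteq> Idl {g, p} \<longrightarrow> \<one> \<in> K)"

text \<open>A maximal ideal above \<open>I\<close> is found by minimising the degree of
  \<open>g\<close> among all proper \<open>(g, p)\<close> containing \<open>I\<close>. A larger
  proper ideal is again of this form, so it offers no smaller degree.\<close>

lemma ex_residually_irreducible:
  assumes I: "ideal I R" "p \<in> I" "f \<in> M c" "f \<in> I" and one: "\<one> \<notin> I"
  shows "\<exists>d. \<exists>g\<in>M d. I \<subseteq> Idl {g, p} \<and> residually_irreducible g"
proof -
  define Q where "Q d \<longleftrightarrow> (\<exists>g\<in>M d. I \<subseteq> Idl {g, p} \<and> \<one> \<notin> Idl {g, p})" for d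
  have gen: "\<exists>d. \<exists>g\<in>M d. g \<in> K \<and> (\<forall>m<d. M m \<inter> K = {}) \<and> K = Idl {g, p}"
    if K: "ideal K R" "p \<in> K" "h \<in> M e" "h \<in> K" for K h e
  proof -
    let ?d = "LEAST m. M m \<inter> K \<noteq> {}"
    have "M ?d \<inter> K \<noteq> {}" by (rule LeastI[of _ e]) (use K in auto)
    then obtain g where g: "g \<in> M ?d" "g \<in> K" by auto
    have least: "\<forall>m<?d. M m \<inter> K = {}" using not_less_Least by blast
    then have "K = Idl {g, p}" using ideal_eq_monic_p[OF K(1,2) g] by blast
    then show ?thesis using g least by blast
  qed
  have "\<exists>d. Q d" using gen[OF I] one unfolding Q_def by (metis subset_refl)
  then have "Q (LEAST d. Q d)" by (rule LeastI_ex)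
  then obtain d g where d: "d = (LEAST d. Q d)" and g: "g \<in> M d" "I \<subseteq> Idl {g, p}" "\<one> \<notin> Idl {g, p}"
    unfolding Q_def by auto
  have gC: "g \<in> carrier R" using g M_carr by auto
  note idp = Idl_pair[OF gC pC]
  have "\<one> \<in> K" if K: "ideal K R" "Idl {g, p} \<subseteq> K" "\<not> K \<subseteq> Idl {g, p}" for K
  proof (rule ccontr)
    assume one: "\<one> \<notin> K"
    have gK: "g \<in> K" "p \<in> K" using K idp by auto
    obtain d' g' where g': "g' \<in> M d'" "g' \<in> K" "\<forall>m<d'. M m \<inter> K = {}" "K = Idl {g', p}"
      using gen[OF K(1) gK(2) g(1) gK(1)] by blast
    have "Q d'" unfolding Q_def using g' K g one by blast
    then have "d \<le> d'" unfolding d by (rule Least_le)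
    \<comment> \<open>As \<open>d'\<close> is the least degree of a monic element of
      \<open>K\<close>, the bound \<open>d \<le> d'\<close> makes \<open>g\<close> itself monic of
      least degree in \<open>K\<close>.\<close>
    then have "K = Idl {g, p}" using ideal_eq_monic_p[OF K(1) gK(2) g(1) gK(1)] g'(3) by auto
    then show False using K by simp
  qed
  then show ?thesis using g unfolding residually_irreducible_def by blast
qed

text \<open>With \<open>f = g h + r P\<close> and \<open>P = p ^ (k + 1)\<close>, corrections
  \<open>P s\<close> of \<open>g\<close> and \<open>P t\<close> of \<open>h\<close> remove the error
  to first order as soon as \<open>s h + g t\<close> is \<open>r\<close> modulo \<open>p\<close>.
  Comaximality of \<open>g\<close> and \<open>h\<close> modulo \<open>p\<close> solves this.\<close>

lemma hensel_step:
  assumes g: "g \<in> M d" and c: "f \<in> carrier R" "h \<in> carrier R"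
    and fgh: "f \<ominus> g \<otimes> h \<in> Idl {p [^] Suc k}" and com: "\<one> \<in> Idl {g, h} <+>\<^bsub>R\<^esub> Idl {p}"
  shows "\<exists>g'\<in>M d. \<exists>h'\<in>carrier R. g' \<ominus> g \<in> Idl {p [^] Suc k} \<and> f \<ominus> g' \<otimes> h' \<in> Idl {p [^] Suc (Suc k)}"
proof -
  have gC: "g \<in> carrier R" using g M_carr by auto
  let ?P = "p [^] Suc k"
  obtain r where r: "r \<in> carrier R" "f \<ominus> g \<otimes> h = r \<otimes> ?P" using fgh Idl1_iff[OF pkC[of "Suc k"]] by auto
  obtain \<alpha> \<beta> \<gamma> where 1: "\<alpha> \<in> carrier R" "\<beta> \<in> carrier R" "\<gamma> \<in> carrier R" "\<one> = \<alpha> \<otimes> g \<oplus> \<beta> \<otimes> h \<oplus> \<gamma> \<otimes> p"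
    using com gC c pC by (auto simp: sum_Idl1_iff Idl2_iff)
  \<comment> \<open>The obvious choice \<open>s = r \<beta>\<close> could spoil the degree of
    \<open>g\<close>. Its remainder modulo \<open>g\<close> is used instead, and
    \<open>q \<otimes> h\<close> is added to \<open>t\<close> in compensation.\<close>
  obtain q where q: "q \<in> carrier R" "r \<otimes> \<beta> \<ominus> q \<otimes> g \<in> V d"
    using division[OF g, of "r \<otimes> \<beta>"] r 1 by auto
  let ?s = "r \<otimes> \<beta> \<ominus> q \<otimes> g" and ?t = "r \<otimes> \<alpha> \<oplus> q \<otimes> h"
  let ?g = "g \<oplus> ?P \<otimes> ?s" and ?h = "h \<oplus> ?P \<otimes> ?t"
  note C = gC c r(1) 1(1-3) q(1) pkC[of "Suc k"] pC pkC[of k]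
  have stC: "?s \<in> carrier R" "?t \<in> carrier R" using C by auto
  have f: "f = g \<otimes> h \<oplus> r \<otimes> ?P"
  proof -
    have "f = g \<otimes> h \<oplus> (f \<ominus> g \<otimes> h)" using C(1-3) by algebra
    then show ?thesis using r(2) by simp
  qed
  have "r = r \<otimes> (\<alpha> \<otimes> g \<oplus> \<beta> \<otimes> h \<oplus> \<gamma> \<otimes> p)" using 1(4) r(1) by (metis r_one)
  then have r': "?s \<otimes> h \<oplus> g \<otimes> ?t = r \<ominus> r \<otimes> \<gamma> \<otimes> p"
  proof -
    assume A: "r = r \<otimes> (\<alpha> \<otimes> g \<oplus> \<beta> \<otimes> h \<oplus> \<gamma> \<otimes> p)"
    have "r \<otimes> (\<alpha> \<otimes> g \<oplus> \<beta> \<otimes> h \<oplus> \<gamma> \<otimes> p) \<ominus> r \<otimes> \<gamma> \<otimes> p = ?s \<otimes> h \<oplus> g \<otimes> ?t"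
      using C by algebra
    then show ?thesis by (simp only: A[symmetric])
  qed
  have expand: "g \<otimes> h \<oplus> r \<otimes> A \<ominus> (g \<oplus> A \<otimes> S) \<otimes> (h \<oplus> A \<otimes> T) = A \<otimes> (r \<ominus> (S \<otimes> h \<oplus> g \<otimes> T)) \<ominus> A \<otimes> A \<otimes> S \<otimes> T"
    if "A \<in> carrier R" "S \<in> carrier R" "T \<in> carrier R" for A S T
    using that gC c(2) r(1) by algebra
  \<comment> \<open>The quadratic term is harmless: \<open>P\<close> contains at least one factor
    \<open>p\<close>, so \<open>P \<otimes> P\<close> is a multiple of
    \<open>p ^ (k + 2)\<close>.\<close>
  have factor: "A \<otimes> p \<otimes> (W \<otimes> p) \<ominus> (A \<otimes> p) \<otimes> (A \<otimes> p) \<otimes> S \<otimes> T = (W \<ominus> A \<otimes> S \<otimes> T) \<otimes> (A \<otimes> p \<otimes> p)"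
    if "A \<in> carrier R" "S \<in> carrier R" "T \<in> carrier R" "W \<in> carrier R" for A S T W
    using that pC by algebra
  have "f \<ominus> ?g \<otimes> ?h = ?P \<otimes> (r \<ominus> (?s \<otimes> h \<oplus> g \<otimes> ?t)) \<ominus> ?P \<otimes> ?P \<otimes> ?s \<otimes> ?t"
    by (subst f) (rule expand[OF pkC stC])
  also have "r \<ominus> (?s \<otimes> h \<oplus> g \<otimes> ?t) = r \<otimes> \<gamma> \<otimes> p"
    unfolding r' using C(4,7) pC by algebra
  also have "?P \<otimes> (r \<otimes> \<gamma> \<otimes> p) \<ominus> ?P \<otimes> ?P \<otimes> ?s \<otimes> ?t = (r \<otimes> \<gamma> \<ominus> p [^] k \<otimes> ?s \<otimes> ?t) \<otimes> p [^] Suc (Suc k)"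
    using factor[OF pkC[of k] stC, of "r \<otimes> \<gamma>"] C by simp
  finally have "f \<ominus> ?g \<otimes> ?h \<in> Idl {p [^] Suc (Suc k)}"
    unfolding Idl1_iff[OF pkC] using C stC by (intro bexI[of _ "r \<otimes> \<gamma> \<ominus> p [^] k \<otimes> ?s \<otimes> ?t"]) auto
  moreover have "?g \<ominus> g = ?s \<otimes> ?P" using gC stC pkC[of "Suc k"] by algebra
  then have "?g \<ominus> g \<in> Idl {?P}" unfolding Idl1_iff[OF pkC] using stC by blast
  moreover have "?g \<in> M d" using M_add[OF g] V_pk[OF q(2)] by blast
  moreover have "?h \<in> carrier R" using C by simp
  ultimately show ?thesis by blast
qed

text \<open>Comaximality is assumed for every factorisation of \<open>f\<close> modulo
  \<open>p\<close>, since each step needs it for its current pair. Only the monic factor is taken to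
  the limit; the cofactors carry no degree bound, and divisibility of \<open>f\<close> by the limit
  comes from membership in all \<open>(\<pi>, p ^ k)\<close>.\<close>

lemma hensel:
  assumes f: "f \<in> carrier R" and g: "g \<in> M d" and fg: "f \<in> Idl {g, p}"
    and com: "\<And>g h r. \<lbrakk>g \<in> carrier R; h \<in> carrier R; f \<ominus> g \<otimes> h \<in> Idl {p}\<rbrakk> \<Longrightarrow> \<one> \<in> Idl {g, h} <+>\<^bsub>R\<^esub> Idl {p}"
  shows "\<exists>\<pi>\<in>M d. f \<in> Idl {\<pi>} \<and> \<pi> \<ominus> g \<in> Idl {p}"
proof -
  have gC: "g \<in> carrier R" using g M_carr by auto
  have p1: "p [^] Suc 0 = p" using pC by simp
  obtain h r where h: "h \<in> carrier R" "r \<in> carrier R" "f = h \<otimes> g \<oplus> r \<otimes> p"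
    using fg gC pC by (auto simp: Idl2_iff)
  have "f \<ominus> g \<otimes> h = r \<otimes> p" unfolding h(3) using h(1,2) gC pC by algebra
  then have fgh: "f \<ominus> g \<otimes> h \<in> Idl {p [^] Suc 0}" unfolding p1 Idl1_iff[OF pC] using h by blast
  \<comment> \<open>Stage \<open>k\<close> is correct modulo \<open>p ^ (k + 1)\<close>. The clause
    for \<open>k = 0\<close> pins the start to \<open>g\<close>, which later gives
    \<open>\<pi> \<ominus> g \<in> Idl {p}\<close>.\<close>
  let ?S = "\<lambda>k s. fst s \<in> M d \<and> snd s \<in> carrier R \<and> f \<ominus> fst s \<otimes> snd s \<in> Idl {p [^] Suc k} \<and> (k = 0 \<longrightarrow> s = (g, h))"
  have "\<exists>s. \<forall>k. ?S k (s k) \<and> fst (s (Suc k)) \<ominus> fst (s k) \<in> Idl {p [^] Suc k}"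
  proof (rule dependent_nat_choice)
    show "\<exists>s. ?S 0 s" using g h fgh by (intro exI[of _ "(g, h)"]) auto
  next
    fix s k assume s: "?S k s"
    have "fst s \<in> carrier R" using s M_carr by auto
    moreover have "f \<ominus> fst s \<otimes> snd s \<in> Idl {p}"
      using s power_Idl_antimono[OF pC, of "Suc 0" "Suc k"] unfolding p1 by auto
    ultimately have "\<one> \<in> Idl {fst s, snd s} <+>\<^bsub>R\<^esub> Idl {p}" using com s by blast
    then show "\<exists>t. ?S (Suc k) t \<and> fst t \<ominus> fst s \<in> Idl {p [^] Suc k}"
      using hensel_step[OF _ f, of "fst s" d "snd s" k] s by fastforce
  qed
  then obtain s where s: "\<And>k. ?S k (s k)" "\<And>k. fst (s (Suc k)) \<ominus> fst (s k) \<in> Idl {p [^] Suc k}" by blast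
  have sM: "fst (s k) \<in> M d" for k using s by blast
  then have sC: "fst (s k) \<in> carrier R" for k using M_carr by blast
  have s0: "fst (s 0) = g" using s(1)[of 0] by simp
  \<comment> \<open>Limits are available in \<open>V d\<close>, not in \<open>M d\<close>, so the
    differences from the starting factor \<open>g\<close> are used.\<close>
  define v where "v k = fst (s k) \<ominus> g" for k
  have vV: "v k \<in> V d" for k unfolding v_def using M_minus sM g by blast
  have "v (Suc k) \<ominus> v k = fst (s (Suc k)) \<ominus> fst (s k)" for k
    unfolding v_def using sC[of k] sC[of "Suc k"] gC by algebra
  then have "v (Suc k) \<ominus> v k \<in> Idl {p [^] k}" for k
    using s(2)[of k] power_Idl_antimono[OF pC, of k "Suc k"] by auto
  then obtain x where x: "x \<in> V d" "\<And>k. x \<ominus> v k \<in> Idl {p [^] k}" using limit[of v d, OF vV] by blast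
  have xC: "x \<in> carrier R" using x V_carr by auto
  let ?\<pi> = "g \<oplus> x"
  have \<pi>: "?\<pi> \<in> M d" using M_add g x by blast
  have \<pi>C: "?\<pi> \<in> carrier R" using gC xC by simp
  have near: "?\<pi> \<ominus> fst (s k) \<in> Idl {p [^] k}" for k
  proof -
    have "?\<pi> \<ominus> fst (s k) = x \<ominus> v k" unfolding v_def using gC xC sC[of k] by algebra
    then show ?thesis using x by simp
  qed
  have "f \<in> Idl {?\<pi>, p [^] k}" for k :: nat
  proof -
    note idp = Idl_pair[OF \<pi>C pkC[of k]]
    have hC: "snd (s k) \<in> carrier R" using s by blast
    have "f \<ominus> fst (s k) \<otimes> snd (s k) \<in> Idl {?\<pi>, p [^] k}"
      using s(1)[of k] power_Idl_antimono[OF pC, of k "Suc k"] Idl_single_le[OF idp(1,3)] by auto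
    moreover have "(?\<pi> \<ominus> fst (s k)) \<otimes> snd (s k) \<in> Idl {?\<pi>, p [^] k}"
      using near[of k] Idl_single_le[OF idp(1,3)] hC by (intro ideal.I_r_closed[OF idp(1)]) auto
    moreover have "?\<pi> \<otimes> snd (s k) \<in> Idl {?\<pi>, p [^] k}"
      using idp hC by (intro ideal.I_r_closed) auto
    moreover have "f = (f \<ominus> fst (s k) \<otimes> snd (s k)) \<ominus> (?\<pi> \<ominus> fst (s k)) \<otimes> snd (s k) \<oplus> ?\<pi> \<otimes> snd (s k)"
      using f hC sC[of k] gC xC by algebra
    ultimately show ?thesis using idp ideal_add ideal_minus by metis
  qed
  then have "f \<in> Idl {?\<pi>}" by (rule mem_Idl_of_mem_powers[OF \<pi> f])
  moreover have "?\<pi> \<ominus> g \<in> Idl {p}"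
  proof -
    have "?\<pi> \<ominus> fst (s 1) \<in> Idl {p}" "fst (s 1) \<ominus> g \<in> Idl {p}"
      using near[of 1] s(2)[of 0] pC s0 by auto
    moreover have "?\<pi> \<ominus> g = (?\<pi> \<ominus> fst (s 1)) \<oplus> (fst (s 1) \<ominus> g)"
      using sC[of 1] gC xC by algebra
    ultimately show ?thesis using ideal_add[OF Idl_single(1)[OF pC]] by metis
  qed
  ultimately show ?thesis using \<pi> by blast
qed

end

section \<open>Lifts of the residually irreducible factors\<close>

text \<open>\<open>separable\<close> expresses squarefreeness of \<open>F\<close> modulo
  \<open>p\<close> without a residue field: two complementary parts of a factorisation modulo
  \<open>p\<close> have no common proper ideal containing \<open>p\<close>. The spare factor
  \<open>l\<close> makes it applicable to divisors of \<open>F\<close>. By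
  \<open>power_eq_zero\<close>, \<open>a\<close> is the nilpotency index of \<open>p\<close>, or
  \<open>\<infinity>\<close>.\<close>

locale separable_lift = poly_filtration +
  fixes F :: 'a and n :: nat and a :: enat
  assumes F: "F \<in> M n"
    and separable: "\<lbrakk>g \<in> carrier R; h \<in> carrier R; l \<in> carrier R; F \<ominus> g \<otimes> h \<otimes> l \<in> Idl {p};
      ideal I R; p \<in> I; g \<in> I; h \<in> I\<rbrakk> \<Longrightarrow> \<one> \<in> I"
    and power_eq_zero: "p [^] k = \<zero> \<longleftrightarrow> a \<le> enat k"
    and nontrivial: "\<one> \<noteq> \<zero>"
begin

section \<open>Divisibility among monic elements\<close>

lemma FC: "F \<in> carrier R"
  using F M_carr by blast

lemma Idl_trans: "x \<in> Idl {y} \<Longrightarrow> y \<in> Idl {z} \<Longrightarrow> z \<in> carrier R \<Longrightarrow> x \<in> Idl {z}"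
  using Idl_single_le[OF Idl_single(1), of z y] by blast

lemma one_in_Idl_iff: "x \<in> carrier R \<Longrightarrow> \<one> \<in> Idl {x} \<longleftrightarrow> x \<in> Units R"
  by (auto simp: Idl1_iff Units_def m_comm) metis

lemma divides_iff: "f \<in> carrier R \<Longrightarrow> f divides x \<longleftrightarrow> x \<in> Idl {f}"
  by (auto simp: Idl1_iff factor_def m_comm)

lemma monic_deg_le:
  assumes "f \<in> M d" "h \<in> M e" "f \<in> Idl {h}"
  shows "e \<le> d"
proof (rule ccontr)
  assume "\<not> e \<le> d"
  then have fV: "f \<in> V e" using M_less assms by simp
  obtain q where q: "q \<in> carrier R" "f = q \<otimes> h" using assms M_carr by (auto simp: Idl1_iff)
  then have "q = \<zero>" using unique[OF assms(2)] fV by blast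
  then have "f = \<zero>" using q assms M_carr by auto
  then have "\<one> = \<zero>" using unique[OF assms(1), of \<one>] V_zero by simp
  then show False using nontrivial by simp
qed

text \<open>Polynomials over the integers modulo \<open>p ^ a\<close> can have nonconstant units
  such as \<open>1 + p X\<close>, so mutual divisibility alone does not fix a polynomial up to
  constants. For monic elements the degrees agree, and uniqueness of division makes the quotient
  \<open>\<one>\<close>.\<close>

lemma monic_antisym:
  assumes "f \<in> M d" "h \<in> M e" "f \<in> Idl {h}" "h \<in> Idl {f}"
  shows "f = h"
proof -
  have "d = e" using monic_deg_le assms by (meson le_antisym)
  obtain q where q: "q \<in> carrier R" "f = q \<otimes> h" using assms M_carr by (auto simp: Idl1_iff)
  have hC: "h \<in> carrier R" using assms M_carr by auto
  have "(q \<ominus> \<one>) \<otimes> h = f \<ominus> h" unfolding q(2) using q(1) hC by algebra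
  moreover have "f \<ominus> h \<in> V e" using M_minus assms \<open>d = e\<close> by blast
  ultimately have "q \<ominus> \<one> = \<zero>" using unique[OF assms(2), of "q \<ominus> \<one>"] q by simp
  then show ?thesis using q hC by simp
qed

definition irr_factors :: "'a set" where
  "irr_factors = {\<pi>. (\<exists>d. \<pi> \<in> M d) \<and> F \<in> Idl {\<pi>} \<and> residually_irreducible \<pi>}"

lemma irr_factorsD:
  assumes "\<pi> \<in> irr_factors"
  shows "\<pi> \<in> carrier R" "F \<in> Idl {\<pi>}" "\<one> \<notin> Idl {\<pi>, p}" "\<exists>d. \<pi> \<in> M d"
  using assms M_carr unfolding irr_factors_def residually_irreducible_def by auto

lemma irr_factors_maximal:
  assumes \<pi>: "\<pi> \<in> irr_factors" and K: "ideal K R" "\<pi> \<in> K" "p \<in> K" and x: "x \<in> K" "x \<notin> Idl {\<pi>, p}"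
  shows "\<one> \<in> K"
  using assms Idl_pair_le[OF K] unfolding irr_factors_def residually_irreducible_def by blast

lemma add_Idl_p:
  assumes I: "ideal I R"
  shows "ideal (I <+>\<^bsub>R\<^esub> Idl {p}) R" "p \<in> I <+>\<^bsub>R\<^esub> Idl {p}" "x \<in> I \<Longrightarrow> x \<in> I <+>\<^bsub>R\<^esub> Idl {p}"
proof -
  show "ideal (I <+>\<^bsub>R\<^esub> Idl {p}) R" using I Idl_single[OF pC] add_ideals by blast
  have "p = \<zero> \<oplus> \<one> \<otimes> p" using pC by simp
  then show "p \<in> I <+>\<^bsub>R\<^esub> Idl {p}" using ideal_zero[OF I] by (subst sum_Idl1_iff[OF pC]) blast
  assume x: "x \<in> I"
  have "x = x \<oplus> \<zero> \<otimes> p" using pC ideal.Icarr[OF I x] by simp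
  then show "x \<in> I <+>\<^bsub>R\<^esub> Idl {p}" using x by (subst sum_Idl1_iff[OF pC]) blast
qed

text \<open>Some maximal \<open>(g, p)\<close> lies above \<open>I\<close>, so \<open>g\<close>
  divides \<open>f\<close> modulo \<open>p\<close>. Hensel's lemma is applied to \<open>f\<close>
  and not to \<open>F\<close>, so that the lift divides \<open>f\<close>; it is congruent to
  \<open>g\<close> modulo \<open>p\<close> and thus defines the same maximal ideal.\<close>

lemma lift_factor:
  assumes f: "f \<in> M e" "F \<in> Idl {f}" and I: "ideal I R" "p \<in> I" "f \<in> I" "\<one> \<notin> I"
  shows "\<exists>\<pi>\<in>irr_factors. f \<in> Idl {\<pi>} \<and> I \<subseteq> Idl {\<pi>, p}"
proof -
  have fC: "f \<in> carrier R" using f M_carr by auto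
  obtain d g where g: "g \<in> M d" "I \<subseteq> Idl {g, p}" "residually_irreducible g"
    using ex_residually_irreducible[OF I(1,2) f(1) I(3,4)] by blast
  have gC: "g \<in> carrier R" using g M_carr by auto
  obtain c where c: "c \<in> carrier R" "F = c \<otimes> f" using f fC by (auto simp: Idl1_iff)
  have com: "\<one> \<in> Idl {g, h} <+>\<^bsub>R\<^esub> Idl {p}"
    if gh: "g \<in> carrier R" "h \<in> carrier R" "f \<ominus> g \<otimes> h \<in> Idl {p}" for g h
  proof (rule separable[of g h c])
    \<comment> \<open>The cofactor \<open>c\<close> of \<open>f\<close> in \<open>F\<close> serves
      as the spare factor in \<open>separable\<close>, so \<open>f\<close> inherits squarefreeness
      modulo \<open>p\<close>.\<close>
    have "F \<ominus> g \<otimes> h \<otimes> c = c \<otimes> (f \<ominus> g \<otimes> h)" unfolding c(2) using gh(1,2) fC c(1) by algebra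
    then show "F \<ominus> g \<otimes> h \<otimes> c \<in> Idl {p}"
      using gh(3) c Idl_single[OF pC] by (simp add: ideal.I_l_closed)
  qed (use gh c add_Idl_p[OF Idl_pair(1)[OF gh(1,2)]] Idl_pair[OF gh(1,2)] in auto)
  obtain \<pi> where \<pi>: "\<pi> \<in> M d" "f \<in> Idl {\<pi>}" "\<pi> \<ominus> g \<in> Idl {p}"
    using hensel[OF fC g(1) _ com] g(2) I(3) by blast
  have \<pi>C: "\<pi> \<in> carrier R" using \<pi> M_carr by auto
  note idg = Idl_pair[OF gC pC] and idpi = Idl_pair[OF \<pi>C pC]
  have "\<pi> \<in> Idl {g, p}" "g \<in> Idl {\<pi>, p}"
    using ideal_cancel[OF idg(1) _ \<pi>C gC] ideal_cancel[OF idpi(1) _ \<pi>C gC] \<pi>(3)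
      Idl_single_le[OF idg(1,3)] Idl_single_le[OF idpi(1,3)] idg idpi by blast+
  then have eq: "Idl {\<pi>, p} = Idl {g, p}"
    using Idl_pair_le[OF idg(1) _ idg(3)] Idl_pair_le[OF idpi(1) _ idpi(3)] by blast
  have "F \<in> Idl {\<pi>}" using Idl_trans[OF f(2) \<pi>(2) \<pi>C] .
  then have "\<pi> \<in> irr_factors" using \<pi> g(3) eq unfolding irr_factors_def residually_irreducible_def by auto
  then show ?thesis using \<pi> g eq by blast
qed

text \<open>In a factorisation \<open>\<pi> = b c\<close>, maximality of \<open>(\<pi>, p)\<close>
  and squarefreeness make one factor a unit modulo \<open>p\<close>, hence a unit. Conversely, a
  monic irreducible divisor is no unit modulo \<open>p\<close>, so it is divisible by a lift, with
  which it must coincide.\<close>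

lemma irr_factors_eq_irreducible:
  "irr_factors = {f. (\<exists>d. f \<in> M d) \<and> Divisibility.irreducible R f \<and> f divides F}"
proof (intro equalityI subsetI CollectI conjI)
  fix \<pi> assume \<pi>: "\<pi> \<in> irr_factors"
  note D = irr_factorsD[OF \<pi>]
  obtain d where d: "\<pi> \<in> M d" using D by blast
  note idpi = Idl_pair[OF D(1) pC]
  show "\<exists>d. \<pi> \<in> M d" using D by blast
  show "\<pi> divides F" using D by (simp add: divides_iff)
  show "Divisibility.irreducible R \<pi>"
  proof (unfold Divisibility.irreducible_def, intro conjI ballI impI)
    show "\<pi> \<notin> Units R" using D(3) one_in_Idl_iff[OF D(1)] Idl_single_le[OF idpi(1,2)] by blast
    fix b assume b: "b \<in> carrier R" "properfactor R b \<pi>"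
    obtain c where c: "c \<in> carrier R" "\<pi> = b \<otimes> c" using b unfolding properfactor_def factor_def by blast
    obtain m where m: "m \<in> carrier R" "F = m \<otimes> \<pi>" using D by (auto simp: Idl1_iff)
    have Fbc: "F \<ominus> b \<otimes> c \<otimes> m \<in> Idl {p}"
    proof -
      have "F \<ominus> b \<otimes> c \<otimes> m = \<zero>" unfolding m(2) c(2) using m(1) b(1) c(1) by algebra
      then show ?thesis using ideal_zero[OF Idl_single(1)[OF pC]] by simp
    qed
    note idb = Idl_single[OF b(1)] and idc = Idl_single[OF c(1)]
    have \<pi>b: "\<pi> \<in> Idl {b}" and \<pi>c: "\<pi> \<in> Idl {c}"
      using c b idb idc by (auto intro: ideal.I_l_closed ideal.I_r_closed)
    show "b \<in> Units R"
    proof (cases "c \<in> Idl {\<pi>, p}")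
      \<comment> \<open>Since \<open>\<pi>\<close> is a multiple of \<open>b\<close>, the ideal
        \<open>(b, p)\<close> contains \<open>c\<close>; but \<open>b\<close> and \<open>c\<close>
        are comaximal modulo \<open>p\<close>.\<close>
      case True
      note K = add_Idl_p[OF idb(1)]
      have "c \<in> Idl {b} <+>\<^bsub>R\<^esub> Idl {p}"
        using True Idl_pair_le[OF K(1) K(3)[OF \<pi>b] K(2)] by blast
      then have "\<one> \<in> Idl {b} <+>\<^bsub>R\<^esub> Idl {p}"
        using separable[OF b(1) c(1) m(1) Fbc K(1,2) K(3)[OF idb(2)]] by blast
      then have "\<one> \<in> Idl {b}" using nakayama[OF idb(1) d \<pi>b] by blast
      then show ?thesis using one_in_Idl_iff b by blast
    next
      \<comment> \<open>Now \<open>c\<close> is a unit modulo \<open>p\<close> by maximality, hence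
        a unit, so \<open>b\<close> is no proper divisor of \<open>\<pi>\<close>.\<close>
      case False
      note K = add_Idl_p[OF idc(1)]
      have "\<one> \<in> Idl {c} <+>\<^bsub>R\<^esub> Idl {p}"
        using irr_factors_maximal[OF \<pi> K(1) K(3)[OF \<pi>c] K(2) K(3)[OF idc(2)] False] .
      then have "\<one> \<in> Idl {c}" using nakayama[OF idc(1) d \<pi>c] by blast
      then obtain c' where c': "c' \<in> carrier R" "\<one> = c' \<otimes> c" using c by (auto simp: Idl1_iff)
      have "b = b \<otimes> (c' \<otimes> c)" using b c'(2) by (metis r_one)
      then have "b = \<pi> \<otimes> c'" unfolding c(2) using b(1) c(1) c'(1) by (simp add: m_ac)
      then have "\<pi> divides b" using c' by (auto simp: factor_def)
      then show ?thesis using b unfolding properfactor_def by blast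
    qed
  qed
next
  fix f assume "f \<in> {f. (\<exists>d. f \<in> M d) \<and> Divisibility.irreducible R f \<and> f divides F}"
  then obtain e where f: "f \<in> M e" "Divisibility.irreducible R f" "f divides F" by blast
  have fC: "f \<in> carrier R" using f M_carr by auto
  note idf = Idl_single[OF fC]
  note K = add_Idl_p[OF idf(1)]
  have "\<one> \<notin> Idl {f} <+>\<^bsub>R\<^esub> Idl {p}"
    using nakayama[OF idf(1) f(1) idf(2)] one_in_Idl_iff[OF fC] f(2) by (auto simp: Divisibility.irreducible_def)
  then obtain \<pi> where \<pi>: "\<pi> \<in> irr_factors" "f \<in> Idl {\<pi>}"
    using lift_factor[OF f(1) _ K(1,2) K(3)[OF idf(2)]] f(3) divides_iff[OF fC] by blast
  note D = irr_factorsD[OF \<pi>(1)]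
  have "\<pi> \<notin> Units R"
    using D(3) one_in_Idl_iff[OF D(1)] Idl_single_le[OF Idl_pair(1,2)[OF D(1) pC]] by blast
  then have "\<not> properfactor R \<pi> f" using f(2) D(1) by (auto simp: Divisibility.irreducible_def)
  then have "f divides \<pi>" using \<pi>(2) D(1) by (auto simp: properfactor_def divides_iff)
  then have "\<pi> \<in> Idl {f}" using divides_iff fC by blast
  then have "f = \<pi>" using monic_antisym f(1) D(4) \<pi>(2) by blast
  then show "f \<in> irr_factors" using \<pi> by simp
qed

section \<open>Cofactors, comaximality and idempotents\<close>

lemma cofactor:
  assumes \<pi>: "\<pi> \<in> irr_factors"
  shows "\<exists>c\<in>carrier R. F = c \<otimes> \<pi> \<and> (\<forall>K. ideal K R \<and> \<pi> \<in> K \<and> c \<in> K \<and> p \<in> K \<longrightarrow> \<one> \<in> K)"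
proof -
  note D = irr_factorsD[OF \<pi>]
  obtain c where c: "c \<in> carrier R" "F = c \<otimes> \<pi>" using D by (auto simp: Idl1_iff)
  \<comment> \<open>With spare factor \<open>\<one>\<close>, squarefreeness says that
    \<open>\<pi>\<close> and its full cofactor are comaximal modulo \<open>p\<close>.\<close>
  have "F \<ominus> \<pi> \<otimes> c \<otimes> \<one> = \<zero>" unfolding c(2) using D(1) c(1) by algebra
  then have "F \<ominus> \<pi> \<otimes> c \<otimes> \<one> \<in> Idl {p}" using ideal_zero[OF Idl_single(1)[OF pC]] by simp
  then have "\<forall>K. ideal K R \<and> \<pi> \<in> K \<and> c \<in> K \<and> p \<in> K \<longrightarrow> \<one> \<in> K"
    using separable[OF D(1) c(1) one_closed] by blast
  then show ?thesis using c by blast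
qed

text \<open>If \<open>\<pi>\<close> is outside \<open>(\<rho>, p)\<close>, maximality and Nakayama's
  lemma apply directly. Otherwise the cofactor \<open>c\<close> of \<open>\<pi>\<close> is outside,
  hence comaximal with \<open>\<rho>\<close>; multiplying \<open>\<one> = r c + s \<rho>\<close> by
  \<open>\<pi>\<close> turns \<open>c\<close> into \<open>F\<close>, a multiple of
  \<open>\<rho>\<close>.\<close>

lemma factor_dvd_or_comaximal:
  assumes \<pi>: "\<pi> \<in> irr_factors" and \<rho>: "\<rho> \<in> irr_factors"
  shows "\<pi> \<in> Idl {\<rho>} \<or> \<one> \<in> Idl {\<pi>, \<rho>}"
proof (cases "\<pi> \<in> Idl {\<rho>, p}")
  case True
  note D = irr_factorsD[OF \<pi>] and D' = irr_factorsD[OF \<rho>]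
  obtain d where d: "\<rho> \<in> M d" using D' by blast
  obtain c where c: "c \<in> carrier R" "F = c \<otimes> \<pi>" "\<forall>K. ideal K R \<and> \<pi> \<in> K \<and> c \<in> K \<and> p \<in> K \<longrightarrow> \<one> \<in> K"
    using cofactor[OF \<pi>] by blast
  note idr = Idl_pair[OF D'(1) pC] and idc = Idl_pair[OF c(1) D'(1)]
  have "c \<notin> Idl {\<rho>, p}" using c(3) True idr D'(3) by blast
  note K = add_Idl_p[OF idc(1)]
  have "\<one> \<in> Idl {c, \<rho>} <+>\<^bsub>R\<^esub> Idl {p}"
    using irr_factors_maximal[OF \<rho> K(1) K(3)[OF idc(3)] K(2) K(3)[OF idc(2)] \<open>c \<notin> _\<close>] .
  then have "\<one> \<in> Idl {c, \<rho>}" using nakayama[OF idc(1) d idc(3)] by blast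
  then obtain r s where rs: "r \<in> carrier R" "s \<in> carrier R" "\<one> = r \<otimes> c \<oplus> s \<otimes> \<rho>"
    using c D' by (auto simp: Idl2_iff)
  have "\<pi> \<otimes> (r \<otimes> c \<oplus> s \<otimes> \<rho>) = r \<otimes> F \<oplus> \<pi> \<otimes> s \<otimes> \<rho>"
    unfolding c(2) using D(1) c(1) rs(1,2) D'(1) by algebra
  then have eq: "\<pi> = r \<otimes> F \<oplus> \<pi> \<otimes> s \<otimes> \<rho>" using D(1) by (simp only: rs(3)[symmetric] r_one)
  have "r \<otimes> F \<oplus> \<pi> \<otimes> s \<otimes> \<rho> \<in> Idl {\<rho>}" using rs(1,2) D(1) D'(2) Idl_single[OF D'(1)]
    by (intro ideal_add[OF Idl_single(1)[OF D'(1)]] ideal.I_l_closed[OF Idl_single(1)[OF D'(1)]]) auto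
  then show ?thesis using eq by simp
next
  case False
  note D = irr_factorsD[OF \<pi>] and D' = irr_factorsD[OF \<rho>]
  obtain d where d: "\<rho> \<in> M d" using D' by blast
  note id = Idl_pair[OF D(1) D'(1)]
  note K = add_Idl_p[OF id(1)]
  have "\<one> \<in> Idl {\<pi>, \<rho>} <+>\<^bsub>R\<^esub> Idl {p}"
    using irr_factors_maximal[OF \<rho> K(1) K(3)[OF id(3)] K(2) K(3)[OF id(2)] False] .
  then show ?thesis using nakayama[OF id(1) d id(3)] by blast
qed

lemma irr_factors_comaximal:
  assumes "\<pi> \<in> irr_factors" "\<rho> \<in> irr_factors" "\<pi> \<noteq> \<rho>"
  shows "\<one> \<in> Idl {\<pi>, \<rho>}"
proof (rule ccontr)
  assume A: "\<one> \<notin> Idl {\<pi>, \<rho>}"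
  then have "\<pi> \<in> Idl {\<rho>}" "\<rho> \<in> Idl {\<pi>}"
    using factor_dvd_or_comaximal[OF assms(1,2)] factor_dvd_or_comaximal[OF assms(2,1)]
    by (auto simp: insert_commute)
  then show False using monic_antisym irr_factorsD(4)[OF assms(1)] irr_factorsD(4)[OF assms(2)] assms(3) by blast
qed

text \<open>Multiply \<open>\<one> = r \<pi> + s \<rho>\<close> by \<open>c\<close>: the first term
  becomes a multiple of \<open>F\<close>, hence of \<open>\<rho>\<close>.\<close>

lemma cofactor_in_other:
  assumes \<pi>: "\<pi> \<in> irr_factors" and \<rho>: "\<rho> \<in> irr_factors" "\<pi> \<noteq> \<rho>" and c: "c \<in> carrier R" "F = c \<otimes> \<pi>"
  shows "c \<in> Idl {\<rho>}"
proof -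
  note D = irr_factorsD[OF \<pi>] and D' = irr_factorsD[OF \<rho>(1)]
  obtain r s where rs: "r \<in> carrier R" "s \<in> carrier R" "\<one> = r \<otimes> \<pi> \<oplus> s \<otimes> \<rho>"
    using irr_factors_comaximal[OF \<pi> \<rho>] D D' by (auto simp: Idl2_iff)
  have "c \<otimes> (r \<otimes> \<pi> \<oplus> s \<otimes> \<rho>) = r \<otimes> F \<oplus> c \<otimes> s \<otimes> \<rho>"
    unfolding c(2) using D(1) c(1) rs(1,2) D'(1) by algebra
  then have eq: "c = r \<otimes> F \<oplus> c \<otimes> s \<otimes> \<rho>" using c(1) by (simp only: rs(3)[symmetric] r_one)
  have "r \<otimes> F \<oplus> c \<otimes> s \<otimes> \<rho> \<in> Idl {\<rho>}" using rs(1,2) c(1) D'(2) Idl_single[OF D'(1)]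
    by (intro ideal_add[OF Idl_single(1)[OF D'(1)]] ideal.I_l_closed[OF Idl_single(1)[OF D'(1)]]) auto
  then show ?thesis using eq by simp
qed

lemma idempotent:
  assumes \<pi>: "\<pi> \<in> irr_factors"
  shows "\<exists>e\<in>carrier R. e \<otimes> \<pi> \<in> Idl {F} \<and> \<one> \<ominus> e \<in> Idl {\<pi>} \<and> (\<forall>\<rho>\<in>irr_factors. \<pi> \<noteq> \<rho> \<longrightarrow> e \<in> Idl {\<rho>})"
proof -
  note D = irr_factorsD[OF \<pi>]
  obtain d where d: "\<pi> \<in> M d" using D by blast
  obtain c where c: "c \<in> carrier R" "F = c \<otimes> \<pi>" "\<forall>K. ideal K R \<and> \<pi> \<in> K \<and> c \<in> K \<and> p \<in> K \<longrightarrow> \<one> \<in> K"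
    using cofactor[OF \<pi>] by blast
  note id = Idl_pair[OF D(1) c(1)]
  note K = add_Idl_p[OF id(1)]
  have "\<one> \<in> Idl {\<pi>, c}" using nakayama[OF id(1) d id(2)] c(3) K id by blast
  \<comment> \<open>The witness is the summand \<open>s \<otimes> c\<close>: times
    \<open>\<pi>\<close> it is a multiple of \<open>F\<close>, it is \<open>\<one>\<close> modulo
    \<open>\<pi>\<close>, and it inherits from \<open>c\<close> divisibility by the other
    factors.\<close>
  then obtain r s where rs: "r \<in> carrier R" "s \<in> carrier R" "\<one> = r \<otimes> \<pi> \<oplus> s \<otimes> c"
    using D(1) c(1) by (auto simp: Idl2_iff)
  have "(s \<otimes> c) \<otimes> \<pi> = s \<otimes> F" unfolding c(2) using rs(2) c(1) D(1) by algebra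
  then have 1: "(s \<otimes> c) \<otimes> \<pi> \<in> Idl {F}" using rs FC by (auto simp: Idl1_iff)
  have "\<one> \<ominus> s \<otimes> c = r \<otimes> \<pi> \<oplus> s \<otimes> c \<ominus> s \<otimes> c" by (simp only: rs(3)[symmetric])
  also have "\<dots> = r \<otimes> \<pi>" using rs(1,2) c(1) D(1) by algebra
  finally have 2: "\<one> \<ominus> s \<otimes> c \<in> Idl {\<pi>}" using rs D by (auto simp: Idl1_iff)
  have 3: "s \<otimes> c \<in> Idl {\<rho>}" if "\<rho> \<in> irr_factors" "\<pi> \<noteq> \<rho>" for \<rho>
    using cofactor_in_other[OF \<pi> that c(1,2)] Idl_single[OF irr_factorsD(1)[OF that(1)]] rs
    by (intro ideal.I_l_closed) auto
  show ?thesis using 1 2 3 rs c by (intro bexI[of _ "s \<otimes> c"]) auto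
qed

lemma irr_factors_separating:
  assumes x: "x \<in> carrier R" and all: "\<And>\<pi>. \<pi> \<in> irr_factors \<Longrightarrow> x \<in> Idl {\<pi>}"
  shows "x \<in> Idl {F}"
proof -
  \<comment> \<open>If \<open>(F : x)\<close> were proper modulo \<open>p\<close>, it would lie in some \<open>(\<pi>, p)\<close>; but it contains the cofactor of \<open>\<pi>\<close>.\<close>
  let ?A = "{y \<in> carrier R. y \<otimes> x \<in> Idl {F}}"
  note idF = Idl_single[OF FC]
  have A: "ideal ?A R"
  proof (rule cring_idealI)
    fix y z assume y: "y \<in> ?A" and z: "z \<in> ?A"
    then show "y \<oplus> z \<in> ?A" using x idF ideal_add by (auto simp: l_distr)
  next
    fix r y assume "r \<in> carrier R" "y \<in> ?A"
    then show "r \<otimes> y \<in> ?A" using x idF by (auto simp: m_assoc intro: ideal.I_l_closed)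
  qed (use x idF ideal_zero in auto)
  have FA: "F \<in> ?A" using FC x idF by (auto intro: ideal.I_r_closed)
  note K = add_Idl_p[OF A]
  have "\<one> \<in> ?A <+>\<^bsub>R\<^esub> Idl {p}"
  proof (rule ccontr)
    assume "\<one> \<notin> ?A <+>\<^bsub>R\<^esub> Idl {p}"
    then obtain \<pi> where \<pi>: "\<pi> \<in> irr_factors" "?A <+>\<^bsub>R\<^esub> Idl {p} \<subseteq> Idl {\<pi>, p}"
      using lift_factor[OF F idF(2) K(1,2) K(3)[OF FA]] by blast
    note D = irr_factorsD[OF \<pi>(1)]
    obtain c where c: "c \<in> carrier R" "F = c \<otimes> \<pi>" "\<forall>K. ideal K R \<and> \<pi> \<in> K \<and> c \<in> K \<and> p \<in> K \<longrightarrow> \<one> \<in> K"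
      using cofactor[OF \<pi>(1)] by blast
    obtain y where y: "y \<in> carrier R" "x = y \<otimes> \<pi>" using all[OF \<pi>(1)] D by (auto simp: Idl1_iff)
    have "c \<otimes> x = y \<otimes> F" unfolding c(2) y(2) using c(1) y(1) D(1) by algebra
    then have "c \<in> ?A" using c(1) y(1) FC by (auto simp: Idl1_iff)
    then have "c \<in> Idl {\<pi>, p}" using \<pi>(2) K(3) by blast
    then show False using c(3) Idl_pair[OF D(1) pC] D(3) by blast
  qed
  then have "\<one> \<in> ?A" using nakayama[OF A F FA] by blast
  then show ?thesis using x by simp
qed

lemma finite_irr_factors: "finite irr_factors"
proof -
  \<comment> \<open>The elements lying in almost all \<open>(\<pi>, p)\<close> form an ideal; it contains the cofactor of every \<open>\<pi>\<close>, so it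
    lies in no \<open>(\<pi>, p)\<close> and therefore contains \<open>1\<close>.\<close>
  let ?A = "{x \<in> carrier R. \<exists>T. finite T \<and> (\<forall>\<pi>\<in>irr_factors - T. x \<in> Idl {\<pi>, p})}"
  have idpi: "ideal (Idl {\<pi>, p}) R" "p \<in> Idl {\<pi>, p}" "\<pi> \<in> Idl {\<pi>, p}" if "\<pi> \<in> irr_factors" for \<pi>
    using Idl_pair[OF irr_factorsD(1)[OF that] pC] by auto
  have A: "ideal ?A R"
  proof (rule cring_idealI)
    fix y z assume "y \<in> ?A" "z \<in> ?A"
    then obtain T U where "y \<in> carrier R" "finite T" "\<forall>\<pi>\<in>irr_factors - T. y \<in> Idl {\<pi>, p}"
      "z \<in> carrier R" "finite U" "\<forall>\<pi>\<in>irr_factors - U. z \<in> Idl {\<pi>, p}" by blast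
    then have "y \<oplus> z \<in> carrier R \<and> finite (T \<union> U) \<and> (\<forall>\<pi>\<in>irr_factors - (T \<union> U). y \<oplus> z \<in> Idl {\<pi>, p})"
      using ideal_add[OF idpi(1)] by simp
    then show "y \<oplus> z \<in> ?A" by blast
  next
    fix r y assume "r \<in> carrier R" "y \<in> ?A"
    then show "r \<otimes> y \<in> ?A" using ideal.I_l_closed[OF idpi(1)] by auto
  qed (use ideal_zero[OF idpi(1)] in auto)
  have pA: "p \<in> ?A" using pC idpi by auto
  have "F \<in> Idl {\<pi>, p}" if "\<pi> \<in> irr_factors" for \<pi>
    using irr_factorsD(2)[OF that] Idl_single_le[OF idpi(1,3)[OF that]] by blast
  then have FA: "F \<in> ?A" using FC by auto
  have "\<one> \<in> ?A"
  proof (rule ccontr)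
    assume "\<one> \<notin> ?A"
    then obtain \<pi> where \<pi>: "\<pi> \<in> irr_factors" "?A \<subseteq> Idl {\<pi>, p}"
      using lift_factor[OF F Idl_single(2)[OF FC] A pA FA] by blast
    obtain c where c: "c \<in> carrier R" "F = c \<otimes> \<pi>" "\<forall>K. ideal K R \<and> \<pi> \<in> K \<and> c \<in> K \<and> p \<in> K \<longrightarrow> \<one> \<in> K"
      using cofactor[OF \<pi>(1)] by blast
    have "c \<in> Idl {\<rho>, p}" if "\<rho> \<in> irr_factors - {\<pi>}" for \<rho>
      using cofactor_in_other[OF \<pi>(1) _ _ c(1,2), of \<rho>] that Idl_single_le[OF idpi(1,3), of \<rho>] by auto
    then have "c \<in> ?A" using c(1) by (auto intro!: exI[of _ "{\<pi>}"])
    then show False using \<pi> c(3) idpi[OF \<pi>(1)] irr_factorsD(3)[OF \<pi>(1)] by blast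
  qed
  then obtain T where "finite T" "\<forall>\<pi>\<in>irr_factors - T. \<one> \<in> Idl {\<pi>, p}" by blast
  then have "irr_factors \<subseteq> T" using irr_factorsD(3) by blast
  then show ?thesis using \<open>finite T\<close> finite_subset by blast
qed

text \<open>\<open>p [^] k\<close> is a constant and \<open>\<pi>\<close> has positive degree, so by
  uniqueness of division a constant multiple of \<open>\<pi>\<close> is zero.\<close>

lemma irr_factors_power:
  assumes \<pi>: "\<pi> \<in> irr_factors" and k: "p [^] (k::nat) \<in> Idl {\<pi>}"
  shows "a \<le> enat k"
proof -
  note D = irr_factorsD[OF \<pi>]
  obtain d where d: "\<pi> \<in> M d" using D by blast
  have "d \<noteq> 0" using M_0[of \<pi>] d D(3) Idl_pair(2)[OF D(1) pC] by metis
  then obtain e where "d = Suc e" by (cases d) auto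
  then have "p [^] k \<in> V d" using V_pk[OF V_one, of k e] by simp
  moreover obtain q where q: "q \<in> carrier R" "p [^] k = q \<otimes> \<pi>" using k D by (auto simp: Idl1_iff)
  ultimately have "q = \<zero>" using unique[OF d q(1)] by simp
  then have "p [^] k = \<zero>" using q D by simp
  then show ?thesis using power_eq_zero by blast
qed

text \<open>Modulo \<open>\<pi>\<close>, write \<open>x\<close> as \<open>u\<close> times the exact
  power of \<open>p\<close> dividing it. Then \<open>u\<close> is outside the maximal ideal
  \<open>(\<pi>, p)\<close>, hence a unit modulo \<open>\<pi>\<close> by Nakayama's lemma, and
  \<open>x\<close> and the power divide each other.\<close>

lemma irr_factors_assoc_power:
  assumes \<pi>: "\<pi> \<in> irr_factors" and x: "x \<in> carrier R" "x \<notin> Idl {\<pi>}"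
  shows "\<exists>k. enat k < a \<and> p [^] k \<in> Idl {x, \<pi>} \<and> x \<in> Idl {\<pi>, p [^] k}"
proof -
  note D = irr_factorsD[OF \<pi>]
  obtain d where d: "\<pi> \<in> M d" using D by blast
  let ?N = "\<lambda>k::nat. x \<notin> Idl {\<pi>, p [^] k}"
  have ex: "\<exists>k. ?N k" using mem_Idl_of_mem_powers[OF d x(1)] x(2) by blast
  have "\<one> \<in> Idl {\<pi>, \<one>}" "ideal (Idl {\<pi>, \<one>}) R" using Idl_pair[OF D(1) one_closed] by auto
  then have "Idl {\<pi>, \<one>} = carrier R" by (metis ideal.one_imp_carrier)
  then have "\<not> ?N 0" using x by simp
  \<comment> \<open>Such a \<open>k\<close> exists because membership in all
    \<open>(\<pi>, p ^ k)\<close> would already place \<open>x\<close> in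
    \<open>(\<pi>)\<close>.\<close>
  then obtain k where k: "\<not> ?N k" "?N (Suc k)"
    using ex nat_induct[of "\<lambda>k. \<not> ?N k"] by blast
  obtain c u where cu: "c \<in> carrier R" "u \<in> carrier R" "x = c \<otimes> \<pi> \<oplus> u \<otimes> p [^] k"
    using k(1) D by (auto simp: Idl2_iff)
  have u: "u \<notin> Idl {\<pi>, p}"
  proof
    assume "u \<in> Idl {\<pi>, p}"
    then obtain r s where rs: "r \<in> carrier R" "s \<in> carrier R" "u = r \<otimes> \<pi> \<oplus> s \<otimes> p"
      using D pC by (auto simp: Idl2_iff)
    have "x = (c \<oplus> r \<otimes> p [^] k) \<otimes> \<pi> \<oplus> s \<otimes> (p [^] k \<otimes> p)"
      unfolding cu(3) rs(3) using cu(1) rs(1,2) D(1) pC pkC[of k] by algebra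
    then have "x = (c \<oplus> r \<otimes> p [^] k) \<otimes> \<pi> \<oplus> s \<otimes> p [^] Suc k" by simp
    moreover have "c \<oplus> r \<otimes> p [^] k \<in> carrier R" using cu rs by simp
    ultimately have "x \<in> Idl {\<pi>, p [^] Suc k}" using rs(2) unfolding Idl2_iff[OF D(1) pkC] by blast
    then show False using k(2) by simp
  qed
  note id = Idl_pair[OF cu(2) D(1)]
  note K = add_Idl_p[OF id(1)]
  have "\<one> \<in> Idl {u, \<pi>} <+>\<^bsub>R\<^esub> Idl {p}"
    using irr_factors_maximal[OF \<pi> K(1) K(3)[OF id(3)] K(2) K(3)[OF id(2)] u] .
  then have "\<one> \<in> Idl {u, \<pi>}" using nakayama[OF id(1) d id(3)] by blast
  then obtain r s where rs: "r \<in> carrier R" "s \<in> carrier R" "\<one> = r \<otimes> u \<oplus> s \<otimes> \<pi>"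
    using D(1) cu(2) by (auto simp: Idl2_iff)
  have "p [^] k \<otimes> (r \<otimes> u \<oplus> s \<otimes> \<pi>) = r \<otimes> x \<oplus> (p [^] k \<otimes> s \<ominus> r \<otimes> c) \<otimes> \<pi>"
    unfolding cu(3) using cu(1,2) rs(1,2) D(1) pkC[of k] by algebra
  then have "p [^] k = r \<otimes> x \<oplus> (p [^] k \<otimes> s \<ominus> r \<otimes> c) \<otimes> \<pi>"
    by (simp only: rs(3)[symmetric] r_one pkC)
  moreover have "p [^] k \<otimes> s \<ominus> r \<otimes> c \<in> carrier R" using rs cu by simp
  ultimately have "p [^] k \<in> Idl {x, \<pi>}" using rs(1) unfolding Idl2_iff[OF x(1) D(1)] by blast
  moreover have "enat k < a"
  proof (rule ccontr)
    assume "\<not> enat k < a"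
    then have "p [^] k = \<zero>" using power_eq_zero by simp
    then have "x = c \<otimes> \<pi>" using cu D by simp
    then show False using x(2) cu(1) D by (auto simp: Idl1_iff)
  qed
  ultimately show ?thesis using k(1) by blast
qed

end

section \<open>Polynomials over the integers modulo a prime power and over the p-adic integers\<close>

text \<open>The properties that the residue rings modulo \<open>p ^ a\<close> and the \<open>p\<close>-adic integers have in common.\<close>

locale complete_residue_ring = cring R for R (structure) +
  fixes p :: nat and a :: enat
  assumes prime: "prime p"
    and a_pos: "1 \<le> a"
    and near_nat: "x \<in> carrier R \<Longrightarrow> \<exists>m::nat. x \<ominus> [m] \<cdot> \<one> \<in> Idl {[p] \<cdot> \<one>}"
    and complete: "(\<And>k. s k \<in> carrier R) \<Longrightarrow>
      (\<And>k::nat. s (Suc k) \<ominus> s k \<in> Idl {([p] \<cdot> \<one>) [^] k}) \<Longrightarrow>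
      \<exists>x\<in>carrier R. \<forall>k. x \<ominus> s k \<in> Idl {([p] \<cdot> \<one>) [^] k}"
    and hausdorff: "x \<in> carrier R \<Longrightarrow> (\<And>k::nat. x \<in> Idl {([p] \<cdot> \<one>) [^] k}) \<Longrightarrow> x = \<zero>"
    and power_p: "([p] \<cdot> \<one>) [^] (k::nat) = \<zero> \<longleftrightarrow> a \<le> enat k"

text \<open>Bezout's identity pushed into the ring. It serves twice: to invert elements modulo
  \<open>p\<close>, and to exploit that \<open>n\<close> is prime to \<open>p\<close>.\<close>

lemma (in cring) coprime_in_ideal:
  assumes I: "ideal I R" and m: "[m] \<cdot> \<one> \<in> I" and n: "[n] \<cdot> \<one> \<in> I" and cop: "coprime m (n::nat)"
  shows "\<one> \<in> I"
proof (cases "m = 0")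
  case True
  then show ?thesis using cop n by simp
next
  case False
  obtain x y where xy: "m * x = n * y + 1" using bezout_nat[OF False, of n] cop by auto
  have mult: "[(k * l)] \<cdot> \<one> \<in> I" if "[k] \<cdot> \<one> \<in> I" for k l :: nat
  proof -
    have "[(k * l)] \<cdot> \<one> = [k] \<cdot> \<one> \<otimes> [l] \<cdot> \<one>"
      by (simp add: add_pow_ldistr add.nat_pow_pow mult.commute)
    then show ?thesis using that I by (simp add: ideal.I_r_closed)
  qed
  have "[(m * x)] \<cdot> \<one> = [(n * y)] \<cdot> \<one> \<oplus> \<one>" unfolding xy by simp
  moreover have "[(m * x)] \<cdot> \<one> \<in> I" "[(n * y)] \<cdot> \<one> \<in> I" using mult m n by auto
  moreover have "\<one> = [(n * y)] \<cdot> \<one> \<oplus> \<one> \<ominus> [(n * y)] \<cdot> \<one>"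
  proof -
    have "[(n * y)] \<cdot> \<one> \<in> carrier R" by simp
    then show ?thesis by algebra
  qed
  ultimately show ?thesis using ideal_minus[OF I] by metis
qed

context complete_residue_ring
begin

abbreviation "q \<equiv> [p] \<cdot> \<one>"

text \<open>By \<open>near_nat\<close> the residue ring modulo \<open>p\<close> consists of images
  of integers, so an inverse comes from Bezout's identity.\<close>

lemma inverse_mod_p:
  assumes x: "x \<in> carrier R" "x \<notin> Idl {q}"
  shows "\<exists>u\<in>carrier R. u \<otimes> x \<ominus> \<one> \<in> Idl {q}"
proof -
  obtain m :: nat where m: "x \<ominus> [m] \<cdot> \<one> \<in> Idl {q}" using near_nat x by blast
  have qC: "q \<in> carrier R" and mC: "[m] \<cdot> \<one> \<in> carrier R" by simp_all
  note id = Idl_pair[OF x(1) qC] and idq = Idl_single[OF qC]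
  have "coprime m p"
  proof (rule ccontr)
    assume "\<not> coprime m p"
    then have "p dvd m" using prime_imp_coprime[OF prime, of m] by (auto simp: coprime_commute)
    then obtain l where "m = p * l" by blast
    then have "[m] \<cdot> \<one> = [l] \<cdot> \<one> \<otimes> q"
      by (simp add: add_pow_ldistr add.nat_pow_pow)
    then have "[m] \<cdot> \<one> \<in> Idl {q}" using idq by (simp add: ideal.I_l_closed)
    then show False using x ideal_cancel[OF idq(1) m x(1) mC] by blast
  qed
  moreover have "[m] \<cdot> \<one> \<in> Idl {x, q}"
    using ideal_cancel[OF id(1) _ x(1) mC] m Idl_single_le[OF id(1,3)] id(2) by blast
  ultimately have "\<one> \<in> Idl {x, q}" using coprime_in_ideal[OF id(1)] id by blast
  then obtain u s where u: "u \<in> carrier R" "s \<in> carrier R" "\<one> = u \<otimes> x \<oplus> s \<otimes> q"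
    using x qC by (auto simp: Idl2_iff)
  have "u \<otimes> x \<ominus> (u \<otimes> x \<oplus> s \<otimes> q) = \<ominus> s \<otimes> q" using u(1,2) x(1) qC by algebra
  then have "u \<otimes> x \<ominus> \<one> = \<ominus> s \<otimes> q" by (simp only: u(3)[symmetric])
  then show ?thesis using u qC by (intro bexI[of _ u]) (auto simp: Idl1_iff)
qed

end

section \<open>Division, limits and leading coefficients of polynomials\<close>

locale complete_residue_poly = UP_cring R P + complete_residue_ring R p a
  for R (structure) and P (structure) and p a
begin

declare coeff_mult [simp del]

abbreviation qP where "qP \<equiv> [p] \<cdot>\<^bsub>P\<^esub> \<one>\<^bsub>P\<^esub>"

text \<open>A bound on the coefficients is used because \<open>deg\<close> is \<open>0\<close> for
  the zero polynomial as for nonzero constants; here \<open>d = 0\<close> leaves only the zero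
  polynomial.\<close>

definition Pdeg_less :: "nat \<Rightarrow> (nat \<Rightarrow> 'a) set" where
  "Pdeg_less d = {f \<in> carrier P. \<forall>i\<ge>d. coeff P f i = \<zero>}"

definition Pmonic :: "nat \<Rightarrow> (nat \<Rightarrow> 'a) set" where
  "Pmonic d = {f \<in> carrier P. coeff P f d = \<one> \<and> (\<forall>i>d. coeff P f i = \<zero>)}"

text \<open>Used to assemble polynomials from coefficients chosen one at a time, such as quotients
  by \<open>p ^ k\<close> and limits.\<close>

lemma poly_of_coeffs:
  assumes "\<And>i. c i \<in> carrier R" "\<And>i. i \<ge> d \<Longrightarrow> c i = \<zero>"
  shows "c \<in> carrier P" "coeff P c i = c i"
proof -
  show c: "c \<in> carrier P"
    using assms by (auto simp: P_def UP_def intro!: exI[of _ d])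
  show "coeff P c i = c i"
    using c by (simp add: P_def UP_def)
qed

lemma ex_Pdeg_less: "f \<in> carrier P \<Longrightarrow> \<exists>d. f \<in> Pdeg_less d"
  using deg_aboveD[of f] unfolding Pdeg_less_def
  by (intro exI[of _ "Suc (deg R f)"]) auto

lemma qP_power: "qP [^]\<^bsub>P\<^esub> (k::nat) = monom P (q [^] k) 0"
proof -
  have "[m] \<cdot>\<^bsub>P\<^esub> \<one>\<^bsub>P\<^esub> = monom P ([m] \<cdot> \<one>) 0" for m :: nat
    by (induct m) simp_all
  then show ?thesis
    using monom_mult[of _ _ 0 0] by (induct k) simp_all
qed

lemma coeff_mult_power: "f \<in> carrier P \<Longrightarrow> coeff P (f \<otimes>\<^bsub>P\<^esub> qP [^]\<^bsub>P\<^esub> (k::nat)) i = coeff P f i \<otimes> q [^] k"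
  using UP_m_comm[of f "monom P (q [^] k) 0"] by (simp add: qP_power monom_mult_is_smult R.m_comm)

lemma mem_Idl_power_iff:
  assumes f: "f \<in> carrier P"
  shows "f \<in> Idl\<^bsub>P\<^esub> {qP [^]\<^bsub>P\<^esub> (k::nat)} \<longleftrightarrow> (\<forall>i. coeff P f i \<in> Idl {q [^] k})"
proof
  assume "f \<in> Idl\<^bsub>P\<^esub> {qP [^]\<^bsub>P\<^esub> k}"
  then obtain r where "r \<in> carrier P" "f = r \<otimes>\<^bsub>P\<^esub> qP [^]\<^bsub>P\<^esub> k" by (auto simp: P.Idl1_iff)
  then show "\<forall>i. coeff P f i \<in> Idl {q [^] k}"
    by (auto simp: coeff_mult_power R.Idl1_iff)
next
  assume A: "\<forall>i. coeff P f i \<in> Idl {q [^] k}"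
  obtain d where d: "f \<in> Pdeg_less d" using ex_Pdeg_less f by blast
  have "\<forall>i. \<exists>r\<in>carrier R. coeff P f i = r \<otimes> q [^] k" using A by (auto simp: R.Idl1_iff)
  then obtain r where r: "\<And>i. r i \<in> carrier R" "\<And>i. coeff P f i = r i \<otimes> q [^] k" by metis
  \<comment> \<open>The choice of \<open>r i\<close> need not vanish where the coefficient of
    \<open>f\<close> does, since \<open>q [^] k\<close> may be a zero divisor; hence the cut at
    \<open>d\<close>.\<close>
  define g where "g i = (if i < d then r i else \<zero>)" for i
  have "g i \<in> carrier R" "i \<ge> d \<Longrightarrow> g i = \<zero>" for i using r(1) by (auto simp: g_def)
  then have g: "g \<in> carrier P" "coeff P g i = (if i < d then r i else \<zero>)" for i
    using poly_of_coeffs[of g d] by (auto simp: g_def)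
  have "f = g \<otimes>\<^bsub>P\<^esub> qP [^]\<^bsub>P\<^esub> k"
  proof (rule up_eqI)
    fix i show "coeff P f i = coeff P (g \<otimes>\<^bsub>P\<^esub> qP [^]\<^bsub>P\<^esub> k) i"
      using d r(2)[of i] g by (auto simp: coeff_mult_power Pdeg_less_def)
  qed (use f g in auto)
  then show "f \<in> Idl\<^bsub>P\<^esub> {qP [^]\<^bsub>P\<^esub> k}" using g by (auto simp: P.Idl1_iff)
qed

lemma mem_Idl_p_iff: "f \<in> carrier P \<Longrightarrow> f \<in> Idl\<^bsub>P\<^esub> {qP} \<longleftrightarrow> (\<forall>i. coeff P f i \<in> Idl {q})"
  using mem_Idl_power_iff[of f 1] by simp

lemma coeff_monom_mult_shift:
  assumes "c \<in> carrier R" "f \<in> carrier P" "n \<le> i"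
  shows "coeff P (monom P c n \<otimes>\<^bsub>P\<^esub> f) i = c \<otimes> coeff P f (i - n)"
  using coeff_monom_mult[OF assms(1,2), of n "i - n"] assms(3) by simp

lemma Pmonic_division:
  assumes f: "f \<in> Pmonic d" and x: "x \<in> carrier P"
  shows "\<exists>h\<in>carrier P. x \<ominus>\<^bsub>P\<^esub> h \<otimes>\<^bsub>P\<^esub> f \<in> Pdeg_less d"
proof -
  have fC: "f \<in> carrier P" using f by (simp add: Pmonic_def)
  have "x \<in> Pdeg_less N \<Longrightarrow> \<exists>h\<in>carrier P. x \<ominus>\<^bsub>P\<^esub> h \<otimes>\<^bsub>P\<^esub> f \<in> Pdeg_less d" for N x
  proof (induct N arbitrary: x)
    case 0
    then show ?case using fC by (intro bexI[of _ "\<zero>\<^bsub>P\<^esub>"]) (auto simp: Pdeg_less_def P.minus_eq)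
  next
    case (Suc N)
    have xC: "x \<in> carrier P" using Suc by (simp add: Pdeg_less_def)
    show ?case
    proof (cases "Suc N \<le> d")
      case True
      then show ?thesis using fC Suc(2)
        by (intro bexI[of _ "\<zero>\<^bsub>P\<^esub>"]) (auto simp: Pdeg_less_def P.minus_eq)
    next
      case False
      let ?m = "monom P (coeff P x N) (N - d)"
      have mC: "?m \<in> carrier P" using xC by simp
      have "coeff P (x \<ominus>\<^bsub>P\<^esub> ?m \<otimes>\<^bsub>P\<^esub> f) i = \<zero>" if i: "i \<ge> N" for i
      proof -
        have "coeff P (?m \<otimes>\<^bsub>P\<^esub> f) i = coeff P x N \<otimes> coeff P f (i - (N - d))"
          using coeff_monom_mult_shift[of "coeff P x N" f "N - d" i] xC fC i by simp
        moreover have "i > N \<Longrightarrow> coeff P f (i - (N - d)) = \<zero>"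
          using f False i by (auto simp: Pmonic_def)
        moreover have "i = N \<Longrightarrow> coeff P f (i - (N - d)) = \<one>"
          using f False by (auto simp: Pmonic_def)
        moreover have "i > N \<Longrightarrow> coeff P x i = \<zero>" using Suc(2) by (auto simp: Pdeg_less_def)
        ultimately show ?thesis using i xC mC fC
          by (cases "i = N") (auto simp: R.minus_eq R.r_neg)
      qed
      moreover have "x \<ominus>\<^bsub>P\<^esub> ?m \<otimes>\<^bsub>P\<^esub> f \<in> carrier P" using xC fC mC by blast
      ultimately have "x \<ominus>\<^bsub>P\<^esub> ?m \<otimes>\<^bsub>P\<^esub> f \<in> Pdeg_less N" unfolding Pdeg_less_def by blast
      then obtain h where h: "h \<in> carrier P" "x \<ominus>\<^bsub>P\<^esub> ?m \<otimes>\<^bsub>P\<^esub> f \<ominus>\<^bsub>P\<^esub> h \<otimes>\<^bsub>P\<^esub> f \<in> Pdeg_less d"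
        using Suc(1) by blast
      have "x \<ominus>\<^bsub>P\<^esub> ?m \<otimes>\<^bsub>P\<^esub> f \<ominus>\<^bsub>P\<^esub> h \<otimes>\<^bsub>P\<^esub> f = x \<ominus>\<^bsub>P\<^esub> (?m \<oplus>\<^bsub>P\<^esub> h) \<otimes>\<^bsub>P\<^esub> f"
        using xC fC mC h(1) by algebra
      then show ?thesis using h mC by (intro bexI[of _ "?m \<oplus>\<^bsub>P\<^esub> h"]) auto
    qed
  qed
  then show ?thesis using ex_Pdeg_less[OF x] by blast
qed

lemma coeff_mult_top:
  assumes f: "f \<in> Pmonic d" and h: "h \<in> Pdeg_less (Suc e)"
  shows "coeff P (h \<otimes>\<^bsub>P\<^esub> f) (e + d) = coeff P h e"
proof -
  have C: "f \<in> carrier P" "h \<in> carrier P" using assms by (auto simp: Pmonic_def Pdeg_less_def)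
  have "coeff P h i \<otimes> coeff P f (e + d - i) = (if e = i then coeff P h i else \<zero>)" if "i \<le> e + d" for i
    using assms C by (cases i e rule: linorder_cases) (auto simp: Pmonic_def Pdeg_less_def)
  then have "coeff P (h \<otimes>\<^bsub>P\<^esub> f) (e + d) = (\<Oplus>i\<in>{..e + d}. if e = i then coeff P h i else \<zero>)"
    using C by (simp add: coeff_mult) (auto intro!: R.finsum_cong')
  also have "\<dots> = coeff P h e" using C by (intro R.finsum_singleton) auto
  finally show ?thesis .
qed

text \<open>The coefficients of \<open>h\<close> vanish from the top down: since \<open>f\<close> is
  monic, the leading coefficient of \<open>h\<close> reappears in the product \<open>d\<close>
  places higher, whatever zero divisors exist.\<close>

lemma Pmonic_unique:
  assumes f: "f \<in> Pmonic d" and h: "h \<in> carrier P" "h \<otimes>\<^bsub>P\<^esub> f \<in> Pdeg_less d"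
  shows "h = \<zero>\<^bsub>P\<^esub>"
proof -
  obtain N where N: "h \<in> Pdeg_less N" using ex_Pdeg_less h by blast
  have "h \<in> Pdeg_less 0" using N
  proof (induct N)
    case (Suc e)
    have "coeff P h e = \<zero>"
      using coeff_mult_top[OF f Suc(2)] h(2) by (auto simp: Pdeg_less_def)
    then have "\<forall>i\<ge>e. coeff P h i = \<zero>"
      using Suc(2) by (auto simp: Pdeg_less_def) (metis not_less_eq_eq le_antisym)
    then show ?case using Suc(1) h(1) by (auto simp: Pdeg_less_def)
  qed
  then show ?thesis using h by (intro up_eqI) (auto simp: Pdeg_less_def)
qed

text \<open>Limits are taken coefficientwise; the common bound \<open>d\<close> keeps the result a
  polynomial.\<close>

lemma Pdeg_less_limit:
  assumes s: "\<And>k. s k \<in> Pdeg_less d" and step: "\<And>k::nat. s (Suc k) \<ominus>\<^bsub>P\<^esub> s k \<in> Idl\<^bsub>P\<^esub> {qP [^]\<^bsub>P\<^esub> k}"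
  shows "\<exists>x\<in>Pdeg_less d. \<forall>k. x \<ominus>\<^bsub>P\<^esub> s k \<in> Idl\<^bsub>P\<^esub> {qP [^]\<^bsub>P\<^esub> k}"
proof -
  have sC: "s k \<in> carrier P" for k using s by (auto simp: Pdeg_less_def)
  have "\<exists>x\<in>carrier R. \<forall>k. x \<ominus> coeff P (s k) i \<in> Idl {q [^] k}" for i
  proof (rule complete)
    show "coeff P (s k) i \<in> carrier R" for k using sC by simp
    show "coeff P (s (Suc k)) i \<ominus> coeff P (s k) i \<in> Idl {q [^] k}" for k
      using step[of k] mem_Idl_power_iff[of "s (Suc k) \<ominus>\<^bsub>P\<^esub> s k" k] sC by auto
  qed
  then obtain x where x: "\<And>i. x i \<in> carrier R" "\<And>i k. x i \<ominus> coeff P (s k) i \<in> Idl {q [^] k}" by metis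
  define y where "y i = (if i < d then x i else \<zero>)" for i
  have "y i \<in> carrier R" "i \<ge> d \<Longrightarrow> y i = \<zero>" for i using x(1) by (auto simp: y_def)
  then have y: "y \<in> carrier P" "coeff P y i = (if i < d then x i else \<zero>)" for i
    using poly_of_coeffs[of y d] by (auto simp: y_def)
  have "y \<ominus>\<^bsub>P\<^esub> s k \<in> Idl\<^bsub>P\<^esub> {qP [^]\<^bsub>P\<^esub> k}" for k
  proof (subst mem_Idl_power_iff)
    have "\<zero> \<in> Idl {q [^] k}" using R.ideal_zero R.Idl_single by simp
    moreover have "i \<ge> d \<Longrightarrow> coeff P (s k) i = \<zero>" for i using s[of k] by (simp add: Pdeg_less_def)
    ultimately show "\<forall>i. coeff P (y \<ominus>\<^bsub>P\<^esub> s k) i \<in> Idl {q [^] k}"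
      using y sC x by (auto simp: R.minus_eq)
  qed (use y sC in auto)
  moreover have "y \<in> Pdeg_less d" using y by (simp add: Pdeg_less_def)
  ultimately show ?thesis by blast
qed

lemma Pdeg_less_lead:
  assumes x: "x \<in> Pdeg_less (Suc d)"
  shows "(\<exists>w\<in>Idl\<^bsub>P\<^esub> {qP}. x \<ominus>\<^bsub>P\<^esub> w \<in> Pdeg_less d) \<or>
    (\<exists>u\<in>carrier P. \<exists>w\<in>Idl\<^bsub>P\<^esub> {qP}. u \<otimes>\<^bsub>P\<^esub> x \<oplus>\<^bsub>P\<^esub> w \<in> Pmonic d)"
proof -
  have xC: "x \<in> carrier P" using x by (simp add: Pdeg_less_def)
  let ?c = "coeff P x d"
  have cC: "?c \<in> carrier R" using xC by simp
  have monom_in: "monom P c d \<in> Idl\<^bsub>P\<^esub> {qP}" if "c \<in> carrier R" "c \<in> Idl {q}" for c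
    using that R.ideal_zero R.Idl_single by (subst mem_Idl_p_iff) auto
  have high: "i > d \<Longrightarrow> coeff P x i = \<zero>" for i using x by (simp add: Pdeg_less_def)
  show ?thesis
  proof (cases "?c \<in> Idl {q}")
    case True
    have "x \<ominus>\<^bsub>P\<^esub> monom P ?c d \<in> Pdeg_less d"
      using xC cC high by (auto simp: Pdeg_less_def R.minus_eq R.r_neg le_eq_less_or_eq)
    then show ?thesis using monom_in[OF cC True] by blast
  next
    case False
    obtain u where u: "u \<in> carrier R" "u \<otimes> ?c \<ominus> \<one> \<in> Idl {q}"
      using inverse_mod_p[OF cC False] by blast
    \<comment> \<open>The defect of \<open>u \<otimes> ?c\<close> from \<open>\<one>\<close>; adding
      it makes the leading coefficient exactly \<open>\<one>\<close> at the cost of a multiple of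
      \<open>p\<close>.\<close>
    let ?w = "monom P (\<one> \<ominus> u \<otimes> ?c) d"
    have "\<one> \<ominus> u \<otimes> ?c = \<ominus> \<one> \<otimes> (u \<otimes> ?c \<ominus> \<one>)" using u(1) cC by algebra
    moreover have "\<ominus> \<one> \<otimes> (u \<otimes> ?c \<ominus> \<one>) \<in> Idl {q}"
      using u R.Idl_single by (intro ideal.I_l_closed) auto
    ultimately have "\<one> \<ominus> u \<otimes> ?c \<in> Idl {q}" by simp
    then have w: "?w \<in> Idl\<^bsub>P\<^esub> {qP}" using monom_in u cC by simp
    have eq: "monom P u 0 \<otimes>\<^bsub>P\<^esub> x \<oplus>\<^bsub>P\<^esub> ?w = u \<odot>\<^bsub>P\<^esub> x \<oplus>\<^bsub>P\<^esub> ?w"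
      using u xC by (simp add: monom_mult_is_smult)
    have "u \<otimes> ?c \<oplus> (\<one> \<ominus> u \<otimes> ?c) = \<one>" using u(1) cC by algebra
    then have "u \<odot>\<^bsub>P\<^esub> x \<oplus>\<^bsub>P\<^esub> ?w \<in> Pmonic d" using u xC high by (auto simp: Pmonic_def)
    then show ?thesis using w u eq by (metis monom_closed)
  qed
qed

sublocale Pf: poly_filtration P qP Pdeg_less Pmonic
proof
  show "x \<ominus>\<^bsub>P\<^esub> y \<in> Pdeg_less d" if "x \<in> Pdeg_less d" "y \<in> Pdeg_less d" for x y d
    using that by (auto simp: Pdeg_less_def R.minus_eq)
  show "qP \<otimes>\<^bsub>P\<^esub> x \<in> Pdeg_less d" if "x \<in> Pdeg_less d" for x d
    using that coeff_mult_power[of x 1] by (auto simp: Pdeg_less_def P.m_comm[of qP])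
  show "x = \<zero>\<^bsub>P\<^esub>" if "x \<in> Pdeg_less 0" for x
    using that by (intro up_eqI) (auto simp: Pdeg_less_def)
  show "f \<oplus>\<^bsub>P\<^esub> x \<in> Pmonic d" if "f \<in> Pmonic d" "x \<in> Pdeg_less d" for f x d
    using that by (auto simp: Pdeg_less_def Pmonic_def)
  show "f \<ominus>\<^bsub>P\<^esub> h \<in> Pdeg_less d" if "f \<in> Pmonic d" "h \<in> Pmonic d" for f h d
    using that by (auto simp: Pdeg_less_def Pmonic_def R.minus_eq R.r_neg le_eq_less_or_eq)
  show "f = \<one>\<^bsub>P\<^esub>" if "f \<in> Pmonic 0" for f
    using that by (intro up_eqI) (auto simp: Pmonic_def)
  show "x = \<zero>\<^bsub>P\<^esub>" if x: "x \<in> Pdeg_less d" and k: "\<And>k::nat. x \<in> Idl\<^bsub>P\<^esub> {qP [^]\<^bsub>P\<^esub> k}" for x d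
  proof (rule up_eqI)
    fix i
    have "x \<in> carrier P" using x by (simp add: Pdeg_less_def)
    then show "coeff P x i = coeff P \<zero>\<^bsub>P\<^esub> i" using k mem_Idl_power_iff hausdorff[of "coeff P x i"] by simp
  qed (use x in \<open>auto simp: Pdeg_less_def\<close>)
qed (use Pmonic_division Pmonic_unique Pdeg_less_limit Pdeg_less_lead in \<open>auto simp: Pdeg_less_def Pmonic_def\<close>)

end

section \<open>The Euler derivation and separability of \<open>X ^ n - 1\<close> modulo
  \<open>p\<close>\<close>

context complete_residue_poly
begin

text \<open>The derivation \<open>X d/dX\<close>; unlike \<open>d/dX\<close> it does not shift the coefficients.\<close>

definition theta :: "(nat \<Rightarrow> 'a) \<Rightarrow> nat \<Rightarrow> 'a" where
  "theta f = (\<lambda>i. [i] \<cdot> \<one> \<otimes> coeff P f i)"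

lemma theta:
  assumes f: "f \<in> carrier P"
  shows "theta f \<in> carrier P" "coeff P (theta f) i = [i] \<cdot> \<one> \<otimes> coeff P f i"
proof -
  obtain d where d: "f \<in> Pdeg_less d" using ex_Pdeg_less f by blast
  have "[i] \<cdot> \<one> \<otimes> coeff P f i \<in> carrier R" "i \<ge> d \<Longrightarrow> [i] \<cdot> \<one> \<otimes> coeff P f i = \<zero>" for i
    using d by (auto simp: Pdeg_less_def)
  note poly_of_coeffs[OF this, folded theta_def]
  then show "theta f \<in> carrier P" "coeff P (theta f) i = [i] \<cdot> \<one> \<otimes> coeff P f i"
    by (simp_all add: theta_def)
qed

lemma theta_mult:
  assumes g: "g \<in> carrier P" and h: "h \<in> carrier P"
  shows "theta (g \<otimes>\<^bsub>P\<^esub> h) = theta g \<otimes>\<^bsub>P\<^esub> h \<oplus>\<^bsub>P\<^esub> g \<otimes>\<^bsub>P\<^esub> theta h"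
proof (rule up_eqI)
  fix k
  have C: "coeff P g i \<in> carrier R" "coeff P h i \<in> carrier R" "[i] \<cdot> \<one> \<in> carrier R" for i :: nat
    using g h by auto
  \<comment> \<open>The product rule holds termwise, because the index \<open>k\<close> of a
    coefficient of the product splits as \<open>i\<close> plus \<open>k - i\<close>.\<close>
  have split: "[k] \<cdot> \<one> \<otimes> (coeff P g i \<otimes> coeff P h (k - i)) =
      [i] \<cdot> \<one> \<otimes> coeff P g i \<otimes> coeff P h (k - i) \<oplus> coeff P g i \<otimes> ([(k - i)] \<cdot> \<one> \<otimes> coeff P h (k - i))"
    if "i \<le> k" for i
  proof -
    have "[k] \<cdot> \<one> = [i] \<cdot> \<one> \<oplus> [(k - i)] \<cdot> \<one>" using that by (simp add: R.add.nat_pow_mult)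
    then show ?thesis by (simp only:) (use C[of i] C[of "k - i"] in algebra)
  qed
  have "coeff P (theta (g \<otimes>\<^bsub>P\<^esub> h)) k = [k] \<cdot> \<one> \<otimes> (\<Oplus>i\<in>{..k}. coeff P g i \<otimes> coeff P h (k - i))"
    using g h by (simp add: theta coeff_mult)
  also have "\<dots> = (\<Oplus>i\<in>{..k}. [k] \<cdot> \<one> \<otimes> (coeff P g i \<otimes> coeff P h (k - i)))"
    using C by (intro R.finsum_rdistr) auto
  also have "\<dots> = (\<Oplus>i\<in>{..k}. [i] \<cdot> \<one> \<otimes> coeff P g i \<otimes> coeff P h (k - i) \<oplus>
      coeff P g i \<otimes> ([(k - i)] \<cdot> \<one> \<otimes> coeff P h (k - i)))"
    using C split by (intro R.finsum_cong') auto
  also have "\<dots> = (\<Oplus>i\<in>{..k}. [i] \<cdot> \<one> \<otimes> coeff P g i \<otimes> coeff P h (k - i)) \<oplus>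
      (\<Oplus>i\<in>{..k}. coeff P g i \<otimes> ([(k - i)] \<cdot> \<one> \<otimes> coeff P h (k - i)))"
    using C by (intro R.finsum_addf) auto
  also have "\<dots> = coeff P (theta g \<otimes>\<^bsub>P\<^esub> h \<oplus>\<^bsub>P\<^esub> g \<otimes>\<^bsub>P\<^esub> theta h) k"
    using g h by (simp add: theta coeff_mult)
  finally show "coeff P (theta (g \<otimes>\<^bsub>P\<^esub> h)) k = coeff P (theta g \<otimes>\<^bsub>P\<^esub> h \<oplus>\<^bsub>P\<^esub> g \<otimes>\<^bsub>P\<^esub> theta h) k" .
qed (use g h theta in auto)

lemma theta_minus:
  assumes g: "g \<in> carrier P" and h: "h \<in> carrier P"
  shows "theta (g \<ominus>\<^bsub>P\<^esub> h) = theta g \<ominus>\<^bsub>P\<^esub> theta h"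
proof (rule up_eqI)
  fix k :: nat
  have "[k] \<cdot> \<one> \<otimes> (coeff P g k \<ominus> coeff P h k) = [k] \<cdot> \<one> \<otimes> coeff P g k \<ominus> [k] \<cdot> \<one> \<otimes> coeff P h k"
    using coeff_closed[OF g, of k] coeff_closed[OF h, of k] R.add.nat_pow_closed[OF R.one_closed, of k]
    by algebra
  then show "coeff P (theta (g \<ominus>\<^bsub>P\<^esub> h)) k = coeff P (theta g \<ominus>\<^bsub>P\<^esub> theta h) k"
    using g h by (simp add: theta)
qed (use g h theta in auto)

lemma theta_Idl_p:
  assumes "f \<in> carrier P" "f \<in> Idl\<^bsub>P\<^esub> {qP}"
  shows "theta f \<in> Idl\<^bsub>P\<^esub> {qP}"
  using assms R.Idl_single[of q] by (auto simp: mem_Idl_p_iff theta intro!: ideal.I_l_closed)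

end

locale xn_minus_one_poly = complete_residue_poly +
  fixes n :: nat
  assumes n_pos: "1 \<le> n" and coprime: "coprime n p"
begin

definition F where "F = monom P \<one> n \<ominus>\<^bsub>P\<^esub> \<one>\<^bsub>P\<^esub>"

lemma F_closed: "F \<in> carrier P"
  by (simp add: F_def)

lemma F_monic: "F \<in> Pmonic n"
  using n_pos by (auto simp: F_def Pmonic_def R.minus_eq)

text \<open>This is \<open>X F' - n F = n\<close>, which makes \<open>F\<close> separable modulo \<open>p\<close>.\<close>

lemma theta_F: "theta F \<ominus>\<^bsub>P\<^esub> [n] \<cdot>\<^bsub>P\<^esub> \<one>\<^bsub>P\<^esub> \<otimes>\<^bsub>P\<^esub> F = [n] \<cdot>\<^bsub>P\<^esub> \<one>\<^bsub>P\<^esub>"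
proof -
  have const: "[m] \<cdot>\<^bsub>P\<^esub> \<one>\<^bsub>P\<^esub> = monom P ([m] \<cdot> \<one>) 0" for m :: nat
    by (induct m) simp_all
  show ?thesis unfolding const
  proof (rule up_eqI)
    fix i :: nat
    show "coeff P (theta F \<ominus>\<^bsub>P\<^esub> monom P ([n] \<cdot> \<one>) 0 \<otimes>\<^bsub>P\<^esub> F) i = coeff P (monom P ([n] \<cdot> \<one>) 0) i"
      using n_pos F_closed by (auto simp: monom_mult_is_smult theta) (auto simp: F_def R.minus_eq R.r_neg R.l_minus R.r_minus)
  qed (use F_closed theta in auto)
qed

text \<open>Modulo \<open>p\<close>, \<open>F\<close> is a product containing both \<open>g\<close>
  and \<open>h\<close>, so each term of the product rule for \<open>theta F\<close> has a factor
  \<open>g\<close> or \<open>h\<close>. Thus \<open>F\<close> and \<open>theta F\<close> lie in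
  \<open>I\<close>, hence so does \<open>n\<close>, which is prime to \<open>p\<close>.\<close>

lemma F_separable:
  assumes C: "g \<in> carrier P" "h \<in> carrier P" "l \<in> carrier P" and fgh: "F \<ominus>\<^bsub>P\<^esub> g \<otimes>\<^bsub>P\<^esub> h \<otimes>\<^bsub>P\<^esub> l \<in> Idl\<^bsub>P\<^esub> {qP}"
    and I: "ideal I P" "qP \<in> I" "g \<in> I" "h \<in> I"
  shows "\<one>\<^bsub>P\<^esub> \<in> I"
proof -
  note th = theta(1)
  let ?D = "F \<ominus>\<^bsub>P\<^esub> g \<otimes>\<^bsub>P\<^esub> (h \<otimes>\<^bsub>P\<^esub> l)"
  have hl: "h \<otimes>\<^bsub>P\<^esub> l \<in> carrier P" "h \<otimes>\<^bsub>P\<^esub> l \<in> I" using C I by (auto intro: ideal.I_r_closed)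
  have D: "?D \<in> carrier P" "?D \<in> Idl\<^bsub>P\<^esub> {qP}" using C F_closed fgh by (auto simp: P.m_assoc)
  have pI: "Idl\<^bsub>P\<^esub> {qP} \<subseteq> I" using P.Idl_single_le I by blast
  have "g \<otimes>\<^bsub>P\<^esub> (h \<otimes>\<^bsub>P\<^esub> l) \<in> I" using C I hl by (intro ideal.I_r_closed[OF I(1)]) auto
  then have FI: "F \<in> I"
    using P.ideal_cancel[OF I(1), of F "g \<otimes>\<^bsub>P\<^esub> (h \<otimes>\<^bsub>P\<^esub> l)"] D pI C hl F_closed by auto
  have "theta ?D = theta F \<ominus>\<^bsub>P\<^esub> theta (g \<otimes>\<^bsub>P\<^esub> (h \<otimes>\<^bsub>P\<^esub> l))" using theta_minus C hl F_closed by simp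
  moreover have "theta ?D \<in> I" using theta_Idl_p[OF D] pI by blast
  moreover have "theta (g \<otimes>\<^bsub>P\<^esub> (h \<otimes>\<^bsub>P\<^esub> l)) \<in> I"
    unfolding theta_mult[OF C(1) hl(1)]
    using I hl C th by (intro P.ideal_add ideal.I_l_closed[OF I(1) hl(2)] ideal.I_r_closed[OF I(1) I(3)]) auto
  ultimately have "theta F \<in> I"
    using P.ideal_cancel[OF I(1), of "theta F" "theta (g \<otimes>\<^bsub>P\<^esub> (h \<otimes>\<^bsub>P\<^esub> l))"] C hl F_closed th by auto
  moreover have "[n] \<cdot>\<^bsub>P\<^esub> \<one>\<^bsub>P\<^esub> \<otimes>\<^bsub>P\<^esub> F \<in> I" using FI I by (intro ideal.I_l_closed[OF I(1)]) auto
  ultimately have "[n] \<cdot>\<^bsub>P\<^esub> \<one>\<^bsub>P\<^esub> \<in> I" using theta_F P.ideal_minus[OF I(1)] by metis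
  then show ?thesis using P.coprime_in_ideal[OF I(1) _ I(2) coprime] by blast
qed

lemma monom_0_eq_zero_iff: "c \<in> carrier R \<Longrightarrow> monom P c 0 = \<zero>\<^bsub>P\<^esub> \<longleftrightarrow> c = \<zero>"
  using coeff_monom[of c 0 0] by (metis coeff_zero monom_zero)

sublocale Sep: separable_lift P qP Pdeg_less Pmonic F n a
proof
  show "F \<in> Pmonic n" by (rule F_monic)
  show "qP [^]\<^bsub>P\<^esub> k = \<zero>\<^bsub>P\<^esub> \<longleftrightarrow> a \<le> enat k" for k :: nat
    by (simp add: qP_power monom_0_eq_zero_iff power_p)
  show "\<one>\<^bsub>P\<^esub> \<noteq> \<zero>\<^bsub>P\<^esub>"
  proof -
    \<comment> \<open>At exponent \<open>0\<close>, \<open>power_p\<close> says that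
      \<open>\<one> = \<zero>\<close> only if \<open>a \<le> 0\<close>.\<close>
    have "\<one> \<noteq> \<zero>" using power_p[of 0] a_pos by (auto simp: zero_enat_def[symmetric])
    then show ?thesis using coeff_one[of 0] coeff_zero[of 0] by metis
  qed
qed (use F_separable in blast)

lemma monic_iff:
  assumes "f \<in> carrier P"
  shows "coeff P f (deg R f) = \<one> \<longleftrightarrow> (\<exists>d. f \<in> Pmonic d)"
proof
  assume "coeff P f (deg R f) = \<one>"
  then show "\<exists>d. f \<in> Pmonic d" using assms deg_aboveD[OF _ assms] unfolding Pmonic_def by blast
next
  assume "\<exists>d. f \<in> Pmonic d"
  then obtain d where d: "f \<in> Pmonic d" by blast
  have "\<one> \<noteq> \<zero>" using power_p[of 0] a_pos by (auto simp: zero_enat_def[symmetric])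
  then have "deg R f = d" using d
    by (intro le_antisym deg_aboveI deg_belowI) (auto simp: Pmonic_def)
  then show "coeff P f (deg R f) = \<one>" using d by (simp add: Pmonic_def)
qed

lemma monic_irred_divisors_eq: "monic_irred_divisors R n = Sep.irr_factors"
proof -
  have "xn_minus_one R n = F" by (simp add: xn_minus_one_def F_def P_def)
  then show ?thesis
    unfolding monic_irred_divisors_def Sep.irr_factors_eq_irreducible
    using monic_iff Pf.M_carr by (auto simp: P_def)
qed

end

section \<open>The two models of the coefficient ring\<close>

context ring_hom_cring
begin

lemma hom_add_pow: "x \<in> carrier R \<Longrightarrow> h ([k] \<cdot>\<^bsub>R\<^esub> x) = [(k::nat)] \<cdot>\<^bsub>S\<^esub> h x"
  by (induct k) simp_all

lemma hom_minus: "x \<in> carrier R \<Longrightarrow> y \<in> carrier R \<Longrightarrow> h (x \<ominus>\<^bsub>R\<^esub> y) = h x \<ominus>\<^bsub>S\<^esub> h y"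
  by (simp add: R.minus_eq S.minus_eq)

end

text \<open>Needed because \<open>is_Zq\<close> fixes the coefficient ring only up to isomorphism.
  The conditions involve only differences, multiples of \<open>\<one>\<close> and principal ideals,
  and an isomorphism preserves and reflects membership in the latter.\<close>

lemma complete_residue_ring_iso:
  fixes R :: "('a, 'm) ring_scheme" and S :: "('b, 'n) ring_scheme"
  assumes R: "complete_residue_ring R p a" and S: "cring S" and h: "h \<in> ring_iso R S"
  shows "complete_residue_ring S p a"
proof -
  interpret R: complete_residue_ring R p a by fact
  interpret S: cring S by fact
  have hh: "h \<in> ring_hom R S" and bij: "bij_betw h (carrier R) (carrier S)"
    using h by (auto simp: ring_iso_def)
  interpret h: ring_hom_cring R S h
    by (rule ring_hom_cringI[OF R.is_cring S hh])
  have inj: "h x = h y \<longleftrightarrow> x = y" if "x \<in> carrier R" "y \<in> carrier R" for x y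
    using bij that by (auto simp: bij_betw_def inj_on_def)
  have surj: "\<exists>x\<in>carrier R. y = h x" if "y \<in> carrier S" for y
    using bij that by (auto simp: bij_betw_def)
  have mem: "h x \<in> Idl\<^bsub>S\<^esub> {h y} \<longleftrightarrow> x \<in> Idl\<^bsub>R\<^esub> {y}" if x: "x \<in> carrier R" and y: "y \<in> carrier R" for x y
  proof
    assume "h x \<in> Idl\<^bsub>S\<^esub> {h y}"
    then obtain r where r: "r \<in> carrier S" "h x = r \<otimes>\<^bsub>S\<^esub> h y" using S.Idl1_iff y by auto
    obtain r' where r': "r' \<in> carrier R" "r = h r'" using surj[OF r(1)] by blast
    have "x = r' \<otimes>\<^bsub>R\<^esub> y" using inj[of x "r' \<otimes>\<^bsub>R\<^esub> y"] r r' x y by auto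
    then show "x \<in> Idl\<^bsub>R\<^esub> {y}" using R.Idl1_iff[OF y] r'(1) by blast
  next
    assume "x \<in> Idl\<^bsub>R\<^esub> {y}"
    then show "h x \<in> Idl\<^bsub>S\<^esub> {h y}" using y by (auto simp: R.Idl1_iff S.Idl1_iff)
  qed
  have nat: "[m] \<cdot>\<^bsub>S\<^esub> \<one>\<^bsub>S\<^esub> = h ([m] \<cdot>\<^bsub>R\<^esub> \<one>\<^bsub>R\<^esub>)" for m :: nat
    by (simp add: h.hom_add_pow)
  have pow: "([p] \<cdot>\<^bsub>S\<^esub> \<one>\<^bsub>S\<^esub>) [^]\<^bsub>S\<^esub> k = h (([p] \<cdot>\<^bsub>R\<^esub> \<one>\<^bsub>R\<^esub>) [^]\<^bsub>R\<^esub> k)" for k :: nat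
    by (simp add: nat)
  have qC: "R.q [^]\<^bsub>R\<^esub> k \<in> carrier R" for k :: nat by simp
  have diff: "h x \<ominus>\<^bsub>S\<^esub> h y \<in> Idl\<^bsub>S\<^esub> {([p] \<cdot>\<^bsub>S\<^esub> \<one>\<^bsub>S\<^esub>) [^]\<^bsub>S\<^esub> k} \<longleftrightarrow> x \<ominus>\<^bsub>R\<^esub> y \<in> Idl\<^bsub>R\<^esub> {R.q [^]\<^bsub>R\<^esub> k}"
    if "x \<in> carrier R" "y \<in> carrier R" for x y and k :: nat
    unfolding pow h.hom_minus[OF that, symmetric] by (rule mem) (use that in auto)
  show ?thesis
  proof
    show "prime p" "1 \<le> a" by (rule R.prime R.a_pos)+
  next
    fix y assume "y \<in> carrier S"
    then obtain x where x: "x \<in> carrier R" "y = h x" using surj by blast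
    then obtain m :: nat where "x \<ominus>\<^bsub>R\<^esub> [m] \<cdot>\<^bsub>R\<^esub> \<one>\<^bsub>R\<^esub> \<in> Idl\<^bsub>R\<^esub> {R.q}" using R.near_nat by blast
    then have "h (x \<ominus>\<^bsub>R\<^esub> [m] \<cdot>\<^bsub>R\<^esub> \<one>\<^bsub>R\<^esub>) \<in> Idl\<^bsub>S\<^esub> {h R.q}"
      using mem[of "x \<ominus>\<^bsub>R\<^esub> [m] \<cdot>\<^bsub>R\<^esub> \<one>\<^bsub>R\<^esub>" R.q] x(1) by blast
    moreover have "h (x \<ominus>\<^bsub>R\<^esub> [m] \<cdot>\<^bsub>R\<^esub> \<one>\<^bsub>R\<^esub>) = y \<ominus>\<^bsub>S\<^esub> [m] \<cdot>\<^bsub>S\<^esub> \<one>\<^bsub>S\<^esub>"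
      unfolding nat x(2) by (rule h.hom_minus) (use x(1) in auto)
    ultimately show "\<exists>m::nat. y \<ominus>\<^bsub>S\<^esub> [m] \<cdot>\<^bsub>S\<^esub> \<one>\<^bsub>S\<^esub> \<in> Idl\<^bsub>S\<^esub> {[p] \<cdot>\<^bsub>S\<^esub> \<one>\<^bsub>S\<^esub>}"
      unfolding nat by metis
  next
    fix s :: "nat \<Rightarrow> 'b"
    assume s: "\<And>k. s k \<in> carrier S"
      and step: "\<And>k::nat. s (Suc k) \<ominus>\<^bsub>S\<^esub> s k \<in> Idl\<^bsub>S\<^esub> {([p] \<cdot>\<^bsub>S\<^esub> \<one>\<^bsub>S\<^esub>) [^]\<^bsub>S\<^esub> k}"
    have "\<forall>k. \<exists>x. x \<in> carrier R \<and> s k = h x" using surj[OF s] by blast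
    from choice[OF this] obtain t where t: "\<And>k. t k \<in> carrier R" "\<And>k. s k = h (t k)" by blast
    have "t (Suc k) \<ominus>\<^bsub>R\<^esub> t k \<in> Idl\<^bsub>R\<^esub> {R.q [^]\<^bsub>R\<^esub> k}" for k
      using step[of k] unfolding t(2) diff[OF t(1) t(1)] by blast
    then obtain x where x: "x \<in> carrier R" "\<And>k. x \<ominus>\<^bsub>R\<^esub> t k \<in> Idl\<^bsub>R\<^esub> {R.q [^]\<^bsub>R\<^esub> k}"
      using R.complete[of t, OF t(1)] by blast
    then have "h x \<ominus>\<^bsub>S\<^esub> s k \<in> Idl\<^bsub>S\<^esub> {([p] \<cdot>\<^bsub>S\<^esub> \<one>\<^bsub>S\<^esub>) [^]\<^bsub>S\<^esub> k}" for k
      unfolding t(2) diff[OF x(1) t(1)] using x(2) by blast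
    then show "\<exists>x\<in>carrier S. \<forall>k. x \<ominus>\<^bsub>S\<^esub> s k \<in> Idl\<^bsub>S\<^esub> {([p] \<cdot>\<^bsub>S\<^esub> \<one>\<^bsub>S\<^esub>) [^]\<^bsub>S\<^esub> k}"
      using x(1) h.hom_closed by blast
  next
    fix y assume y: "y \<in> carrier S" "\<And>k::nat. y \<in> Idl\<^bsub>S\<^esub> {([p] \<cdot>\<^bsub>S\<^esub> \<one>\<^bsub>S\<^esub>) [^]\<^bsub>S\<^esub> k}"
    then obtain x where x: "x \<in> carrier R" "y = h x" using surj by blast
    then have "x \<in> Idl\<^bsub>R\<^esub> {R.q [^]\<^bsub>R\<^esub> k}" for k :: nat
      using y(2)[of k] mem[OF x(1) qC[of k]] unfolding pow x(2) by blast
    then show "y = \<zero>\<^bsub>S\<^esub>" using R.hausdorff[OF x(1)] x by simp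
  next
    show "([p] \<cdot>\<^bsub>S\<^esub> \<one>\<^bsub>S\<^esub>) [^]\<^bsub>S\<^esub> k = \<zero>\<^bsub>S\<^esub> \<longleftrightarrow> a \<le> enat k" for k :: nat
      using inj[of "R.q [^]\<^bsub>R\<^esub> k" "\<zero>\<^bsub>R\<^esub>"] by (simp add: pow R.power_p)
  qed
qed

section \<open>Completeness of the two models\<close>

lemma (in cring) telescope_Idl:
  assumes q: "q \<in> carrier R" and s: "\<And>k. s k \<in> carrier R"
    and step: "\<And>k::nat. s (Suc k) \<ominus> s k \<in> Idl {q [^] k}" and "k \<le> l"
  shows "s l \<ominus> s k \<in> Idl {q [^] k}"
  using \<open>k \<le> l\<close>
proof (induct l rule: dec_induct)
  note id = Idl_single(1)[OF nat_pow_closed[OF q]]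
  case base
  have "s k \<ominus> s k = \<zero>" using s[of k] by algebra
  then show ?case using ideal_zero[OF id] by simp
next
  note id = Idl_single(1)[OF nat_pow_closed[OF q]]
  case (step l)
  have "s (Suc l) \<ominus> s k = (s (Suc l) \<ominus> s l) \<oplus> (s l \<ominus> s k)"
    using s[of k] s[of l] s[of "Suc l"] by algebra
  then show ?case using ideal_add[OF id] step assms(3)[of l] power_Idl_antimono[OF q step(1)] by auto
qed

text \<open>As \<open>p ^ K\<close> vanishes, an admissible sequence is constant from index
  \<open>K\<close> on, so \<open>s K\<close> is its limit.\<close>

lemma complete_residue_ring_residue_ring:
  assumes p: "prime p" and K: "1 \<le> K"
  shows "complete_residue_ring (residue_ring (int p ^ K)) p (enat K)"
proof -
  let ?m = "int p ^ K"
  have "?m > 1" using p K prime_gt_1_nat[of p] by (intro one_less_power) auto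
  then interpret residues ?m "residue_ring ?m" by unfold_locales auto
  have nat: "[k] \<cdot>\<^bsub>residue_ring ?m\<^esub> \<one>\<^bsub>residue_ring ?m\<^esub> = int k mod ?m" for k :: nat
    by (induct k) (simp_all add: res_zero_eq res_one_eq res_add_eq mod_simps add.commute)
  have pow: "([p] \<cdot>\<^bsub>residue_ring ?m\<^esub> \<one>\<^bsub>residue_ring ?m\<^esub>) [^]\<^bsub>residue_ring ?m\<^esub> k = int p ^ k mod ?m" for k :: nat
    by (simp add: nat pow_cong)
  have qC: "[p] \<cdot>\<^bsub>residue_ring ?m\<^esub> \<one>\<^bsub>residue_ring ?m\<^esub> \<in> carrier (residue_ring ?m)" by simp
  have null: "([p] \<cdot>\<^bsub>residue_ring ?m\<^esub> \<one>\<^bsub>residue_ring ?m\<^esub>) [^]\<^bsub>residue_ring ?m\<^esub> k = \<zero>\<^bsub>residue_ring ?m\<^esub> \<longleftrightarrow> K \<le> k" for k :: nat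
  proof -
    have "int p ^ k mod ?m = 0 \<longleftrightarrow> p ^ K dvd p ^ k"
      unfolding mod_eq_0_iff_dvd by (metis of_nat_dvd_iff of_nat_power)
    also have "\<dots> \<longleftrightarrow> K \<le> k" using prime_ge_2_nat[OF p] by (rule dvd_power_iff_le)
    finally show ?thesis unfolding pow res_zero_eq .
  qed
  show ?thesis
  proof
    show "prime p" by fact
    show "1 \<le> enat K" using K by (simp add: one_enat_def)
  next
    fix x assume x: "x \<in> carrier (residue_ring ?m)"
    have "[(nat x)] \<cdot>\<^bsub>residue_ring ?m\<^esub> \<one>\<^bsub>residue_ring ?m\<^esub> = x"
      using x by (simp add: nat res_carrier_eq)
    then have "x \<ominus>\<^bsub>residue_ring ?m\<^esub> [(nat x)] \<cdot>\<^bsub>residue_ring ?m\<^esub> \<one>\<^bsub>residue_ring ?m\<^esub> = \<zero>\<^bsub>residue_ring ?m\<^esub>"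
      using x by (simp add: r_right_minus_eq)
    then show "\<exists>m::nat. x \<ominus>\<^bsub>residue_ring ?m\<^esub> [m] \<cdot>\<^bsub>residue_ring ?m\<^esub> \<one>\<^bsub>residue_ring ?m\<^esub> \<in> Idl\<^bsub>residue_ring ?m\<^esub> {[p] \<cdot>\<^bsub>residue_ring ?m\<^esub> \<one>\<^bsub>residue_ring ?m\<^esub>}"
      using ideal_zero[OF Idl_single(1)[OF qC]] by metis
  next
    fix s :: "nat \<Rightarrow> int"
    let ?I = "\<lambda>k::nat. Idl\<^bsub>residue_ring ?m\<^esub> {([p] \<cdot>\<^bsub>residue_ring ?m\<^esub> \<one>\<^bsub>residue_ring ?m\<^esub>) [^]\<^bsub>residue_ring ?m\<^esub> k}"
    assume s: "\<And>k. s k \<in> carrier (residue_ring ?m)"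
      and step: "\<And>k. s (Suc k) \<ominus>\<^bsub>residue_ring ?m\<^esub> s k \<in> ?I k"
    have "s K \<ominus>\<^bsub>residue_ring ?m\<^esub> s k \<in> ?I k" for k
    proof (cases "k \<le> K")
      case True
      then show ?thesis using telescope_Idl[OF qC s step] by blast
    next
      case False
      then have "s k \<ominus>\<^bsub>residue_ring ?m\<^esub> s K \<in> ?I K" using telescope_Idl[OF qC s step, of K k] by simp
      then have "s k \<ominus>\<^bsub>residue_ring ?m\<^esub> s K = \<zero>\<^bsub>residue_ring ?m\<^esub>" using null[of K] genideal_zero by simp
      then have "s k = s K" using s by simp
      then have "s K \<ominus>\<^bsub>residue_ring ?m\<^esub> s k = \<zero>\<^bsub>residue_ring ?m\<^esub>" using s by simp
      then show ?thesis using ideal_zero[OF Idl_single(1)[OF nat_pow_closed[OF qC]]] by simp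
    qed
    then show "\<exists>x\<in>carrier (residue_ring ?m). \<forall>k. x \<ominus>\<^bsub>residue_ring ?m\<^esub> s k \<in> ?I k" using s by blast
  next
    fix x assume "\<And>k::nat. x \<in> Idl\<^bsub>residue_ring ?m\<^esub> {([p] \<cdot>\<^bsub>residue_ring ?m\<^esub> \<one>\<^bsub>residue_ring ?m\<^esub>) [^]\<^bsub>residue_ring ?m\<^esub> k}"
    from this[of K] show "x = \<zero>\<^bsub>residue_ring ?m\<^esub>" using null[of K] genideal_zero by simp
  qed (simp add: null)
qed

lemma complete_residue_ring_padic_ints:
  assumes p: "prime p"
  shows "complete_residue_ring (padic_ints p) p \<infinity>"
proof -
  interpret cring "padic_ints p" using p by (rule cring_padic_ints)
  let ?Z = "padic_ints p" and ?q = "[p] \<cdot>\<^bsub>padic_ints p\<^esub> \<one>\<^bsub>padic_ints p\<^esub>"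
  have pos: "int p ^ k > 0" for k using p prime_gt_0_nat[of p] by simp
  have car: "x \<in> carrier ?Z \<longleftrightarrow> (\<forall>k. 0 \<le> x k \<and> x k < int p ^ k \<and> x (Suc k) mod int p ^ k = x k)" for x
    by (auto simp: padic_ints_def)
  have range: "x k mod int p ^ k = x k" if "x \<in> carrier ?Z" for x k
    using that by (simp add: car)
  have coh: "x (k + j) mod int p ^ k = x k" if x: "x \<in> carrier ?Z" for x k j
  proof (induct j)
    case (Suc j)
    have "x (k + Suc j) mod int p ^ k = x (Suc (k + j)) mod int p ^ (k + j) mod int p ^ k"
      by (simp add: mod_mod_cancel le_imp_power_dvd)
    also have "x (Suc (k + j)) mod int p ^ (k + j) = x (k + j)" using x by (simp add: car)
    finally show ?case using Suc by simp
  qed (use range x in simp)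
  have add: "(x \<oplus>\<^bsub>?Z\<^esub> y) k = (x k + y k) mod int p ^ k" for x y k by (simp add: padic_ints_def)
  have mult: "(x \<otimes>\<^bsub>?Z\<^esub> y) k = (x k * y k) mod int p ^ k" for x y k by (simp add: padic_ints_def)
  have zero: "\<zero>\<^bsub>?Z\<^esub> k = 0" for k by (simp add: padic_ints_def)
  have one: "\<one>\<^bsub>?Z\<^esub> k = 1 mod int p ^ k" for k by (simp add: padic_ints_def)
  have minus: "(x \<ominus>\<^bsub>?Z\<^esub> y) k = (x k - y k) mod int p ^ k"
    if x: "x \<in> carrier ?Z" and y: "y \<in> carrier ?Z" for x y k
  proof -
    have "x = (x \<ominus>\<^bsub>?Z\<^esub> y) \<oplus>\<^bsub>?Z\<^esub> y" using x y by algebra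
    then have "x k = ((x \<ominus>\<^bsub>?Z\<^esub> y) k + y k) mod int p ^ k" using add by metis
    then have "(x k - y k) mod int p ^ k = (x \<ominus>\<^bsub>?Z\<^esub> y) k mod int p ^ k" by (simp add: mod_simps)
    then show ?thesis using range[of "x \<ominus>\<^bsub>?Z\<^esub> y" k] x y by simp
  qed
  have nat: "([m] \<cdot>\<^bsub>?Z\<^esub> \<one>\<^bsub>?Z\<^esub>) k = int m mod int p ^ k" for m k :: nat
    by (induct m) (simp_all add: zero add one mod_simps add.commute)
  have pow: "(?q [^]\<^bsub>?Z\<^esub> k) j = int p ^ k mod int p ^ j" for k j :: nat
    by (induct k) (simp add: one, simp add: mult nat mod_simps mult.commute)
  have qC: "?q [^]\<^bsub>?Z\<^esub> k \<in> carrier ?Z" for k :: nat by simp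
  have mem: "x \<in> Idl\<^bsub>?Z\<^esub> {?q [^]\<^bsub>?Z\<^esub> k} \<longleftrightarrow> x k = 0" if x: "x \<in> carrier ?Z" for x and k :: nat
  proof
    assume "x \<in> Idl\<^bsub>?Z\<^esub> {?q [^]\<^bsub>?Z\<^esub> k}"
    then obtain r where "x = r \<otimes>\<^bsub>?Z\<^esub> ?q [^]\<^bsub>?Z\<^esub> k" using Idl1_iff[OF qC] by blast
    then show "x k = 0" by (simp add: mult pow)
  next
    assume xk: "x k = 0"
    \<comment> \<open>Division by \<open>p ^ k\<close> shifts the precision: the quotient modulo
      \<open>p ^ j\<close> is determined by \<open>x\<close> modulo
      \<open>p ^ (j + k)\<close>.\<close>
    define y where "y j = x (j + k) div int p ^ k" for j
    have dvd: "y j * int p ^ k = x (j + k)" for j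
      using coh[OF x, of k j] xk by (auto simp: y_def add.commute mod_eq_0_iff_dvd)
    have yC: "y \<in> carrier ?Z"
      unfolding car
    proof (intro allI conjI)
      fix j
      have b: "0 \<le> x (j + k)" "x (j + k) < int p ^ (j + k)" using x by (auto simp: car)
      show "0 \<le> y j" unfolding y_def using b pos by (simp add: pos_imp_zdiv_nonneg_iff)
      have "y j * int p ^ k < int p ^ j * int p ^ k" unfolding dvd using b by (simp add: power_add)
      then show "y j < int p ^ j" using pos[of k] by simp
      have "(y (Suc j) mod int p ^ j) * int p ^ k = (y (Suc j) * int p ^ k) mod (int p ^ j * int p ^ k)"
        by (simp add: mult_mod_left)
      also have "\<dots> = x (Suc (j + k)) mod int p ^ (j + k)" unfolding dvd by (simp add: power_add)
      also have "\<dots> = y j * int p ^ k" unfolding dvd using x by (simp add: car)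
      finally show "y (Suc j) mod int p ^ j = y j"
        using pos[of k] mult_right_cancel[of "int p ^ k"] by (metis less_irrefl)
    qed
    have "x = y \<otimes>\<^bsub>?Z\<^esub> ?q [^]\<^bsub>?Z\<^esub> k"
    proof
      fix j
      show "x j = (y \<otimes>\<^bsub>?Z\<^esub> ?q [^]\<^bsub>?Z\<^esub> k) j"
        using coh[OF x, of j k] by (simp add: mult pow mod_simps dvd)
    qed
    then show "x \<in> Idl\<^bsub>?Z\<^esub> {?q [^]\<^bsub>?Z\<^esub> k}" using yC Idl1_iff[OF qC] by blast
  qed
  show ?thesis
  proof
    show "prime p" by fact
    show "1 \<le> (\<infinity>::enat)" by simp
  next
    fix x assume x: "x \<in> carrier ?Z"
    have q1: "?q [^]\<^bsub>?Z\<^esub> (1::nat) = ?q" by simp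
    have "0 \<le> x 1" using x by (simp add: car)
    then have "(x \<ominus>\<^bsub>?Z\<^esub> [(nat (x 1))] \<cdot>\<^bsub>?Z\<^esub> \<one>\<^bsub>?Z\<^esub>) 1 = 0"
      using minus[OF x, of "[(nat (x 1))] \<cdot>\<^bsub>?Z\<^esub> \<one>\<^bsub>?Z\<^esub>" 1] by (simp add: nat mod_simps)
    then show "\<exists>m::nat. x \<ominus>\<^bsub>?Z\<^esub> [m] \<cdot>\<^bsub>?Z\<^esub> \<one>\<^bsub>?Z\<^esub> \<in> Idl\<^bsub>?Z\<^esub> {?q}"
      using mem[of "x \<ominus>\<^bsub>?Z\<^esub> [(nat (x 1))] \<cdot>\<^bsub>?Z\<^esub> \<one>\<^bsub>?Z\<^esub>" 1] x unfolding q1 by (intro exI[of _ "nat (x 1)"]) simp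
  next
    fix s :: "nat \<Rightarrow> nat \<Rightarrow> int"
    assume s: "\<And>k. s k \<in> carrier ?Z"
      and step: "\<And>k::nat. s (Suc k) \<ominus>\<^bsub>?Z\<^esub> s k \<in> Idl\<^bsub>?Z\<^esub> {?q [^]\<^bsub>?Z\<^esub> k}"
    have eq: "s (Suc k) k = s k k" for k
    proof -
      have "(s (Suc k) k - s k k) mod int p ^ k = 0"
        using step[of k] mem[of "s (Suc k) \<ominus>\<^bsub>?Z\<^esub> s k" k] s minus[OF s s, of "Suc k" k k] by simp
      then have "s (Suc k) k mod int p ^ k = s k k mod int p ^ k"
        by (simp add: mod_eq_dvd_iff mod_eq_0_iff_dvd)
      then show ?thesis using range[OF s] by simp
    qed
    \<comment> \<open>The diagonal: \<open>s k\<close> is already correct modulo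
      \<open>p ^ k\<close>, and coherence of the diagonal is the equation \<open>eq\<close>.\<close>
    let ?x = "\<lambda>k. s k k"
    have xC: "?x \<in> carrier ?Z"
      unfolding car
    proof (intro allI conjI)
      fix k
      show "0 \<le> s k k" "s k k < int p ^ k" using s[of k] by (auto simp: car)
      show "s (Suc k) (Suc k) mod int p ^ k = s k k" using s[of "Suc k"] eq[of k] by (simp add: car)
    qed
    have "?x \<ominus>\<^bsub>?Z\<^esub> s k \<in> Idl\<^bsub>?Z\<^esub> {?q [^]\<^bsub>?Z\<^esub> k}" for k :: nat
      using mem[of "?x \<ominus>\<^bsub>?Z\<^esub> s k" k] minus[OF xC s, of k k] xC s by simp
    then show "\<exists>x\<in>carrier ?Z. \<forall>k. x \<ominus>\<^bsub>?Z\<^esub> s k \<in> Idl\<^bsub>?Z\<^esub> {?q [^]\<^bsub>?Z\<^esub> k}" using xC by blast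
  next
    fix x assume "x \<in> carrier ?Z" "\<And>k::nat. x \<in> Idl\<^bsub>?Z\<^esub> {?q [^]\<^bsub>?Z\<^esub> k}"
    then show "x = \<zero>\<^bsub>?Z\<^esub>" using mem by (auto simp: fun_eq_iff zero)
  next
    fix k :: nat
    \<comment> \<open>\<open>p ^ k\<close> is nonzero already in the next residue ring, modulo
      \<open>p ^ (k + 1)\<close>.\<close>
    have "(?q [^]\<^bsub>?Z\<^esub> k) (Suc k) \<noteq> 0"
      unfolding pow using prime_gt_1_nat[OF p] pos[of k] by simp
    then have "?q [^]\<^bsub>?Z\<^esub> k \<noteq> \<zero>\<^bsub>?Z\<^esub>" using zero[of "Suc k"] by metis
    then show "?q [^]\<^bsub>?Z\<^esub> k = \<zero>\<^bsub>?Z\<^esub> \<longleftrightarrow> \<infinity> \<le> enat k" by simp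
  qed
qed

lemma ring_iso_sym: "ring R \<Longrightarrow> R \<simeq> S \<Longrightarrow> \<exists>h. h \<in> ring_iso S R"
  using ring_iso_set_sym unfolding is_ring_iso_def by blast

lemma complete_residue_ring_of_is_Zq:
  assumes p: "prime p" and a: "1 \<le> a" and Z: "is_Zq p a Z"
  shows "complete_residue_ring Z p a"
proof -
  have cr: "cring Z" using Z by (simp add: is_Zq_def)
  then have rg: "ring Z" by (simp add: cring.axioms(1))
  show ?thesis
  proof (cases a)
    case (enat K)
    then have "1 \<le> K" "Z \<simeq> residue_ring (int p ^ K)"
      using a Z by (auto simp: is_Zq_def one_enat_def)
    then show ?thesis
      using complete_residue_ring_iso[OF complete_residue_ring_residue_ring[OF p] cr] ring_iso_sym[OF rg] enat by blast
  next
    case infinity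
    then have "Z \<simeq> padic_ints p" using Z by (simp add: is_Zq_def)
    then show ?thesis
      using complete_residue_ring_iso[OF complete_residue_ring_padic_ints[OF p] cr] ring_iso_sym[OF rg] infinity by blast
  qed
qed

section \<open>Passage to the quotient\<close>

lemma (in ideal) quot_surj: "r \<in> carrier (R Quot I) \<Longrightarrow> \<exists>x\<in>carrier R. r = I +> x"
  unfolding FactRing_def A_RCOSETS_def' by auto

lemma (in ideal) quot_mem_Idl:
  assumes "cring R" "x \<in> carrier R" "y \<in> carrier R" "z \<in> carrier R" "x \<in> Idl {y, z}"
  shows "I +> x \<in> Idl\<^bsub>R Quot I\<^esub> {I +> y, I +> z}"
proof -
  interpret R: cring R by fact
  interpret h: ring_hom_cring R "R Quot I" "(+>) I" using assms(1) by (rule rcos_ring_hom_cring)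
  obtain r s where rs: "r \<in> carrier R" "s \<in> carrier R" "x = r \<otimes> y \<oplus> s \<otimes> z"
    using assms(5) R.Idl2_iff[OF assms(3,4)] by blast
  then have "I +> x = (I +> r) \<otimes>\<^bsub>R Quot I\<^esub> (I +> y) \<oplus>\<^bsub>R Quot I\<^esub> (I +> s) \<otimes>\<^bsub>R Quot I\<^esub> (I +> z)"
    using assms(3,4) by simp
  then show ?thesis
    using h.S.Idl2_iff[OF h.hom_closed[OF assms(3)] h.hom_closed[OF assms(4)]]
      h.hom_closed[OF rs(1)] h.hom_closed[OF rs(2)] by blast
qed

text \<open>After lifting the coefficients, \<open>x\<close> differs from the lifted combination by
  an element of \<open>I\<close>, which is absorbed since \<open>I\<close> lies in
  \<open>(y, z)\<close>.\<close>

lemma (in ideal) quot_mem_Idl_rev: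
  assumes "cring R" "x \<in> carrier R" "y \<in> carrier R" "z \<in> carrier R" "I \<subseteq> Idl {y, z}"
    "I +> x \<in> Idl\<^bsub>R Quot I\<^esub> {I +> y, I +> z}"
  shows "x \<in> Idl {y, z}"
proof -
  interpret R: cring R by fact
  interpret h: ring_hom_cring R "R Quot I" "(+>) I" using assms(1) by (rule rcos_ring_hom_cring)
  obtain r s where rs: "r \<in> carrier (R Quot I)" "s \<in> carrier (R Quot I)"
    "I +> x = r \<otimes>\<^bsub>R Quot I\<^esub> (I +> y) \<oplus>\<^bsub>R Quot I\<^esub> s \<otimes>\<^bsub>R Quot I\<^esub> (I +> z)"
    using assms(6) h.S.Idl2_iff[OF h.hom_closed[OF assms(3)] h.hom_closed[OF assms(4)]] by blast
  obtain r' s' where r': "r' \<in> carrier R" "s' \<in> carrier R" "r = I +> r'" "s = I +> s'"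
    using quot_surj[OF rs(1)] quot_surj[OF rs(2)] by blast
  let ?w = "r' \<otimes> y \<oplus> s' \<otimes> z"
  have wC: "?w \<in> carrier R" using r' assms by simp
  have "I +> x = I +> ?w" using rs(3) r' assms by simp
  then have "x \<ominus> ?w \<in> I"
    using quotient_eq_iff_same_a_r_cos[OF is_ideal assms(2) wC] by simp
  then have "x \<ominus> ?w \<in> Idl {y, z}" using assms(5) by blast
  moreover have "?w \<in> Idl {y, z}" using r' assms by (auto simp: R.Idl2_iff)
  ultimately show ?thesis using R.ideal_cancel[OF R.Idl_pair(1)[OF assms(3,4)] _ assms(2) wC] by blast
qed

context xn_minus_one_poly
begin

abbreviation "Q \<equiv> P Quot (PIdl\<^bsub>P\<^esub> F)"

abbreviation "proj \<equiv> (+>\<^bsub>P\<^esub>) (PIdl\<^bsub>P\<^esub> F)"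

lemma local_components_quotient:
  "\<exists>e. local_components Q Sep.irr_factors proj e (proj qP) a"
proof -
  interpret I: ideal "PIdl\<^bsub>P\<^esub> F" P using F_closed by (rule P.cgenideal_ideal)
  interpret h: ring_hom_cring P Q proj using P.is_cring by (rule I.rcos_ring_hom_cring)
  have F_eq: "PIdl\<^bsub>P\<^esub> F = Idl\<^bsub>P\<^esub> {F}" using F_closed by (rule P.cgenideal_eq_genideal)
  have FI: "PIdl\<^bsub>P\<^esub> F \<subseteq> J" if "ideal J P" "F \<in> J" for J
    using that P.cgenideal_minimal by blast
  note D = Sep.irr_factorsD
  have F1: "PIdl\<^bsub>P\<^esub> F \<subseteq> Idl\<^bsub>P\<^esub> {\<pi>}" if "\<pi> \<in> Sep.irr_factors" for \<pi>
    using FI D(2)[OF that] P.Idl_single[OF D(1)[OF that]] by blast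
  have F2: "PIdl\<^bsub>P\<^esub> F \<subseteq> Idl\<^bsub>P\<^esub> {\<pi>, x}" if "\<pi> \<in> Sep.irr_factors" "x \<in> carrier P" for \<pi> x
    using F1[OF that(1)] P.Idl_single_le[OF P.Idl_pair(1,2)[OF D(1)[OF that(1)] that(2)]] by blast
  \<comment> \<open>The principal case of the two-generator statements, with both generators equal
    to \<open>\<pi>\<close>.\<close>
  have mem1: "proj x \<in> Idl\<^bsub>Q\<^esub> {proj \<pi>} \<longleftrightarrow> x \<in> Idl\<^bsub>P\<^esub> {\<pi>}"
    if "\<pi> \<in> Sep.irr_factors" "x \<in> carrier P" for \<pi> x
    using I.quot_mem_Idl[OF P.is_cring that(2) D(1) D(1), OF that(1) that(1)]
      I.quot_mem_Idl_rev[OF P.is_cring that(2) D(1) D(1), OF that(1) that(1)] F1[OF that(1)] by auto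
  have zero: "proj x = \<zero>\<^bsub>Q\<^esub> \<longleftrightarrow> x \<in> Idl\<^bsub>P\<^esub> {F}" if "x \<in> carrier P" for x
    unfolding F_eq[symmetric]
    using P.quotient_eq_iff_same_a_r_cos[OF I.is_ideal that P.zero_closed] that
    by (simp flip: h.hom_zero add: P.minus_eq)
  note surj = I.quot_surj
  have qC: "qP \<in> carrier P" "\<And>k::nat. qP [^]\<^bsub>P\<^esub> k \<in> carrier P" by simp_all
  have pow: "proj qP [^]\<^bsub>Q\<^esub> k = proj (qP [^]\<^bsub>P\<^esub> k)" for k :: nat
    by (simp only: h.hom_pow[OF qC(1)])
  obtain e where e: "\<And>\<pi>. \<pi> \<in> Sep.irr_factors \<Longrightarrow> e \<pi> \<in> carrier P \<and> e \<pi> \<otimes>\<^bsub>P\<^esub> \<pi> \<in> Idl\<^bsub>P\<^esub> {F} \<and>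
      \<one>\<^bsub>P\<^esub> \<ominus>\<^bsub>P\<^esub> e \<pi> \<in> Idl\<^bsub>P\<^esub> {\<pi>} \<and> (\<forall>\<rho>\<in>Sep.irr_factors. \<pi> \<noteq> \<rho> \<longrightarrow> e \<pi> \<in> Idl\<^bsub>P\<^esub> {\<rho>})"
    using bchoice[of Sep.irr_factors] Sep.idempotent unfolding Bex_def by metis
  have "local_components Q Sep.irr_factors proj (\<lambda>\<pi>. proj (e \<pi>)) (proj qP) a"
  proof
    show "finite Sep.irr_factors" by (rule Sep.finite_irr_factors)
    show "proj \<pi> \<in> carrier Q" "proj (e \<pi>) \<in> carrier Q" if "\<pi> \<in> Sep.irr_factors" for \<pi>
      using D(1) e that h.hom_closed by blast+
    show "proj qP \<in> carrier Q" using qC h.hom_closed by blast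
    show "proj (e \<pi>) \<otimes>\<^bsub>Q\<^esub> proj \<pi> = \<zero>\<^bsub>Q\<^esub>" if "\<pi> \<in> Sep.irr_factors" for \<pi>
      using zero[of "e \<pi> \<otimes>\<^bsub>P\<^esub> \<pi>"] e[OF that] D(1)[OF that] h.hom_mult[of "e \<pi>" \<pi>] by simp
    show "\<one>\<^bsub>Q\<^esub> \<ominus>\<^bsub>Q\<^esub> proj (e \<pi>) \<in> Idl\<^bsub>Q\<^esub> {proj \<pi>}" if "\<pi> \<in> Sep.irr_factors" for \<pi>
      using mem1[OF that, of "\<one>\<^bsub>P\<^esub> \<ominus>\<^bsub>P\<^esub> e \<pi>"] e[OF that] h.hom_minus[of "\<one>\<^bsub>P\<^esub>" "e \<pi>"] by simp
    show "proj (e \<pi>) \<in> Idl\<^bsub>Q\<^esub> {proj \<rho>}"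
      if "\<pi> \<in> Sep.irr_factors" "\<rho> \<in> Sep.irr_factors" "\<pi> \<noteq> \<rho>" for \<pi> \<rho>
      using mem1[OF that(2), of "e \<pi>"] e[OF that(1)] that by blast
    show "y = \<zero>\<^bsub>Q\<^esub>" if y: "y \<in> carrier Q" "\<And>\<pi>. \<pi> \<in> Sep.irr_factors \<Longrightarrow> y \<in> Idl\<^bsub>Q\<^esub> {proj \<pi>}" for y
    proof -
      obtain x where x: "x \<in> carrier P" "y = proj x" using surj y by blast
      then have "x \<in> Idl\<^bsub>P\<^esub> {F}" using Sep.irr_factors_separating[OF x(1)] y(2) mem1 by blast
      then show ?thesis using zero x by blast
    qed
    show "\<exists>k. enat k < a \<and> proj qP [^]\<^bsub>Q\<^esub> k \<in> Idl\<^bsub>Q\<^esub> {y, proj \<pi>} \<and> y \<in> Idl\<^bsub>Q\<^esub> {proj \<pi>, proj qP [^]\<^bsub>Q\<^esub> k}"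
      if \<pi>: "\<pi> \<in> Sep.irr_factors" and y: "y \<in> carrier Q" "y \<notin> Idl\<^bsub>Q\<^esub> {proj \<pi>}" for \<pi> y
    proof -
      obtain x where x: "x \<in> carrier P" "y = proj x" using surj y by blast
      then have "x \<notin> Idl\<^bsub>P\<^esub> {\<pi>}" using y(2) mem1[OF \<pi>] by blast
      from Sep.irr_factors_assoc_power[OF \<pi> x(1) this] obtain k :: nat where k: "enat k < a"
        "qP [^]\<^bsub>P\<^esub> k \<in> Idl\<^bsub>P\<^esub> {x, \<pi>}" "x \<in> Idl\<^bsub>P\<^esub> {\<pi>, qP [^]\<^bsub>P\<^esub> k}" by blast
      show ?thesis unfolding pow x(2)
        using k I.quot_mem_Idl[OF P.is_cring qC(2) x(1) D(1)[OF \<pi>] k(2)]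
          I.quot_mem_Idl[OF P.is_cring x(1) D(1)[OF \<pi>] qC(2) k(3)] by blast
    qed
    show "a \<le> enat k" if "\<pi> \<in> Sep.irr_factors" "proj qP [^]\<^bsub>Q\<^esub> k \<in> Idl\<^bsub>Q\<^esub> {proj \<pi>}" for \<pi> k
      using that Sep.irr_factors_power mem1[OF that(1) qC(2)] unfolding pow by blast
    show "proj qP [^]\<^bsub>Q\<^esub> k = \<zero>\<^bsub>Q\<^esub>" if "a = enat k" for k
    proof -
      have "qP [^]\<^bsub>P\<^esub> k = \<zero>\<^bsub>P\<^esub>" using Sep.power_eq_zero that by simp
      then show ?thesis unfolding pow by simp
    qed
    show "\<one>\<^bsub>Q\<^esub> \<notin> Idl\<^bsub>Q\<^esub> {proj \<pi>, proj qP}" if "\<pi> \<in> Sep.irr_factors" for \<pi>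
      using I.quot_mem_Idl_rev[OF P.is_cring P.one_closed D(1)[OF that] qC(1) F2[OF that qC(1)]]
        D(3)[OF that] by auto
  qed
  then show ?thesis by blast
qed

end

theorem theorem5:
  fixes p n :: nat and a :: enat and Z :: "'r ring"
  assumes "prime p"
    and "a \<ge> 1"
    and "n \<ge> 1"
    and "coprime n p"
    and "is_Zq p a Z"
  shows "finite (monic_irred_divisors Z n) \<and>
    (\<forall>I. ideal I (cyc_ring Z n) \<longrightarrow>
      (\<exists>!m. m \<in> monic_irred_divisors Z n \<rightarrow>\<^sub>E {..a} \<and>
         I = (\<Otimes>\<^bsub>ideals_set (cyc_ring Z n)\<^esub> \<pi> \<in> monic_irred_divisors Z n.
                pi_p_power Z n p \<pi> (m \<pi>)))) \<and>
    (\<forall>k. a = enat k \<longrightarrow>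
      card {I. ideal I (cyc_ring Z n)} = (k + 1) ^ card (monic_irred_divisors Z n))"
proof -
  interpret xn_minus_one_poly Z "UP Z" p a n
  proof (intro xn_minus_one_poly.intro complete_residue_poly.intro)
    show cr: "complete_residue_ring Z p a" using complete_residue_ring_of_is_Zq assms by blast
    show "UP_cring Z" using complete_residue_ring.axioms(1)[OF cr] by (simp add: UP_cring_def)
    show "xn_minus_one_poly_axioms p n" using assms by unfold_locales
  qed
  obtain e where "local_components Q Sep.irr_factors proj e (proj qP) a"
    using local_components_quotient by blast
  then interpret C: local_components Q "Sep.irr_factors" proj e "proj qP" a .
  have F: "xn_minus_one Z n = F" by (simp add: xn_minus_one_def F_def)
  have cyc: "cyc_ring Z n = Q" by (simp add: cyc_ring_def F)
  \<comment> \<open>Reduction modulo \<open>F\<close> sends the generators \<open>\<pi>\<close> and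
    \<open>p\<close> to those of the component ideal, so the two notions of power agree by
    definition, the convention for \<open>\<infinity>\<close> included.\<close>
  have power: "pi_p_power Z n p = C.comp_power"
    by (intro ext) (simp add: pi_p_power_def C.comp_power_def image_ideal_def cyc F split: enat.split)
  show ?thesis
    unfolding monic_irred_divisors_eq cyc power
    using C.finD C.ideal_decomposition C.card_ideals by blast
qed

end
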